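(* Let $X$ be a white Lévy noise with triplet $(\mu,\sigma,V)$, $V=V_d+V_{ac}+V_{cs}$, and assume $X_0$ is either discrete, continuous, or discrete-continuous. Then: (1) If $X_0$ is discrete, and $H(X_0)<\infty$ and $H(A)<\infty$, where $A$ is the (discrete) random variable with distribution function $V(x)/\lambda$, $\lambda=\int_{\mathbb R\setminus\{0\}}dV(a)<\infty$, then there exist functions $m(n)$ and $\zeta(n)$ with $\lim_{n\to\infty}\sup_{m\ge m(n)}|\mathcal H_{m,n}(X)-\zeta(n)|=0$ and $c_1\log n\le\zeta(n)\le c_2\log n$ for some constants $0<c_1\le c_2<\infty$ independent of $n$. (2) If $X_0$ is discrete-continuous, set $\lambda=\int_{\mathbb R\setminus\{0\}}dV(a)$, $\alpha=\frac1\lambda\int_{\mathbb R\setminus\{0\}}dV_d(a)$ and $\kappa(n)=n\big(1-\exp[-\frac{\lambda}{n}(1-\alpha)]\big)$. Let $X_{0,D},X_{0,c}$ be the discrete and continuous parts of $X_0$, $X_{1,c}^{(n)}$ the continuous part of $X_1^{(n)}$, $A_c$ the continuous random variable with density $\frac{dV_{ac}(x)/dx}{\int_{\mathbb R\setminus\{0\}}dV_{ac}}$ and $A_D$ the discrete random variable with distribution $V_d/\int_{\mathbb R\setminus\{0\}}dV_d$ (when $V_d\not\equiv0$). If $H([X_0]_1)$, $h(X_{1,c}^{(n)})$ (for all $n$), $h(A_c)$, $H(X_{0,D})$ and $H(A_D)$ are well-defined and finite, then there exist functions $m(n)$ and $\zeta(n)$ with $$\lim_{n\to\infty}\sup_{m\ge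 m(n)}\left|\frac{\mathcal H_{m,n}(X)}{\kappa(n)}-\log m-\zeta(n)\right|=0$$ and $c_1\log n\le\zeta(n)\le c_2\log n$ for some constants $0<c_1\le c_2<\infty$ independent of $n$. (3) If $X_0$ is continuous with $\sigma>0$ or $\int_{\mathbb R\setminus\{0\}}dV_{ac}(a)=\infty$, $H([X_0]_1)<\infty$, and $h(X_1^{(n)})$ is well-defined for all $n$, then with $\kappa(n)=n$ and $\zeta(n)=h(X_1^{(n)})$ there exists $m(n)$ such that $$\lim_{n\to\infty}\sup_{m\ge m(n)}\left|\frac{\mathcal H_{m,n}(X)}{\kappa(n)}-\log m-\zeta(n)\right|=0,$$ and $\zeta(n)=h(X_1^{(n)})$ is non-increasing in $n$.
   Context: A white Lévy noise $X$ is a generalized random process on $\mathcal S'(\mathbb R)$ with characteristic functional $\mathbb E[e^{j\langle X,\varphi\rangle}]=\exp\big(\int_{\mathbb R} f(\varphi(t))\,dt\big)$ for $\varphi\in\mathcal S(\mathbb R)$, where the Lévy exponent is $f(\omega)=-\frac{\sigma^2}{2}\omega^2+j\mu\omega+\int_{\mathbb R\setminus\{0\}}\big(e^{j\omega a}-1-j\omega a\mathbf 1_{(-1,1)}(a)\big)\,dV(a)$, with $\sigma,\mu\in\mathbb R$ and $V$ non-decreasing, continuous at $0$, $\lim_{a\to-\infty}V(a)=0$, $\int_{\mathbb R\setminus\{0\}}\min\{1,a^2\}\,dV(a)<\infty$ and $\int_{\mathbb R\setminus[-1,1]}|a|^\theta dV(a)<\infty$ for some $\theta>0$; $(\mu,\sigma,V)$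 is called its triplet. $V=V_d+V_{ac}+V_{cs}$ is the decomposition of $V$ into its discrete (jump) part, absolutely continuous part and continuous singular part. For $n\in\mathbb N$, $i\in\mathbb Z$, $X_i^{(n)}=\int_{(i-1)/n}^{i/n}X(t)\,dt$ (increments of the associated Lévy process; i.i.d. in $i$), and $X_0=\int_0^1X(t)\,dt$. $[x]_m=\frac1m\lfloor\frac12+mx\rfloor$ and $\mathcal H_{m,n}(X)=n\,H([X_1^{(n)}]_m)$. $H$ is discrete entropy, $h$ differential entropy (natural logs); $h(p)$ is well-defined when $\int p|\log p|<\infty$. A random variable is discrete if it takes countably many values, continuous if its law is absolutely continuous w.r.t. Lebesgue measure, and discrete-continuous if for some countable set $\mathcal D$, $0<\Pr(X\in\mathcal D)<1$, its conditional law on $\mathcal D$ is discrete and its conditional law given $X\notin\mathcal D$ is absolutely continuous; these conditional variables are its discrete and continuous parts. *)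

theory Defs
  imports "HOL-Probability.Probability"
begin

text \<open>The Levy measure dV is represented as a measure nu on the Borel sets of the reals
  (no mass at 0).  The standing assumptions on V become assumptions on nu.\<close>

definition levy_triplet :: "real \<Rightarrow> real \<Rightarrow> real measure \<Rightarrow> bool" where
  "levy_triplet \<mu> \<sigma> \<nu> \<longleftrightarrow>
     sets \<nu> = sets borel \<and> emeasure \<nu> {0} = 0 \<and>
     (\<integral>\<^sup>+ a. ennreal (min 1 (a\<^sup>2)) \<partial>\<nu>) < \<infinity> \<and>
     (\<exists>\<theta>>0. (\<integral>\<^sup>+ a. ennreal (indicator {a. \<bar>a\<bar> > 1} a * \<bar>a\<bar> powr \<theta>) \<partial>\<nu>) < \<infinity>)"

definition levy_exponent :: "real \<Rightarrow> real \<Rightarrow> real measure \<Rightarrow> real \<Rightarrow> complex" where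
  "levy_exponent \<mu> \<sigma> \<nu> \<omega> =
     - complex_of_real (\<sigma>\<^sup>2 / 2 * \<omega>\<^sup>2) + \<i> * complex_of_real (\<mu> * \<omega>)
     + (\<integral> a. iexp (\<omega> * a) - 1 - \<i> * complex_of_real (\<omega> * a * indicator {-1<..<1} a) \<partial>\<nu>)"

definition discrete_law :: "real measure \<Rightarrow> bool" where
  "discrete_law M \<longleftrightarrow> (\<exists>D. countable D \<and> emeasure M (UNIV - D) = 0)"

definition continuous_law :: "real measure \<Rightarrow> bool" where
  "continuous_law M \<longleftrightarrow> absolutely_continuous lborel M"

definition cond_law :: "real measure \<Rightarrow> real set \<Rightarrow> real measure" where
  "cond_law M A = scale_measure (ennreal (1 / measure M A)) (density M (indicator A))"

definition dc_split :: "real measure \<Rightarrow> real set \<Rightarrow> bool" where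
  "dc_split M D \<longleftrightarrow> countable D \<and> 0 < measure M D \<and> measure M D < 1 \<and>
     discrete_law (cond_law M D) \<and> continuous_law (cond_law M (UNIV - D))"

definition dc_law :: "real measure \<Rightarrow> bool" where
  "dc_law M \<longleftrightarrow> (\<exists>D. dc_split M D)"

definition dentropy :: "real measure \<Rightarrow> ennreal" where
  "dentropy M = (\<integral>\<^sup>+ x. ennreal (- measure M {x} * ln (measure M {x})) \<partial>count_space UNIV)"

definition dens :: "real measure \<Rightarrow> real \<Rightarrow> real" where
  "dens M x = enn2real (RN_deriv lborel M x)"

definition dentropy_wd :: "real measure \<Rightarrow> bool" where
  "dentropy_wd M \<longleftrightarrow> absolutely_continuous lborel M \<and>
     integrable lborel (\<lambda>x. dens M x * \<bar>ln (dens M x)\<bar>)"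

definition diff_entropy :: "real measure \<Rightarrow> real" where
  "diff_entropy M = - (\<integral> x. dens M x * ln (dens M x) \<partial>lborel)"

definition quant :: "nat \<Rightarrow> real \<Rightarrow> real" where
  "quant m x = real_of_int \<lfloor>1/2 + real m * x\<rfloor> / real m"

definition Hq :: "nat \<Rightarrow> real measure \<Rightarrow> ennreal" where
  "Hq m M = dentropy (distr M borel (quant m))"

end

theory Submission
  imports Defs "HOL-Real_Asymp.Real_Asymp"
begin

text \<open>
Write \<open>eta t = - t * ln t\<close>. The entropy of the quantized variable is the sum of \<open>eta\<close> over the masses of the
cells of length \<open>1 / m\<close>. For a discrete law it tends to the entropy of the law, by dominated convergence of
the logarithm of the cell mass under the law itself. For a law with density \<open>g\<close> and total mass \<open>q\<close>, the
sum minus \<open>q * ln m\<close> is the integral of \<open>eta\<close> over the cell averages of \<open>g\<close>. By Gibbs' inequality it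
dominates the integral of \<open>eta (g x)\<close>; the converse inequality in the limit is Fatou's lemma for the
relative entropy with respect to a log-Lipschitz reference density, the cell averages converging almost
everywhere by Lebesgue's differentiation theorem. For a mixture of a discrete and an atomless measure the
defect \<open>eta a + eta b - eta (a + b) \<le> 4 * sqrt (a * b)\<close> is negligible.

If the Levy measure has finite mass \<open>r\<close>, then \<open>P n\<close> is compound Poisson with rate \<open>r / n\<close>, translated by the
drift. Comparing the Poisson series of \<open>P n\<close> and \<open>P 1\<close> term by term shows that, off the drift point, \<open>n\<close>
times \<open>P n\<close> is at most \<open>exp r\<close> times a translate of \<open>P 1\<close>. Hence \<open>n\<close> times the entropies of the atoms and of
the density of \<open>P n\<close> differ from multiples of \<open>ln n\<close> by bounded amounts, which is the logarithmic growth
of \<open>\<zeta>\<close>. The total mass of the atoms is multiplicative under convolution; for \<open>P n\<close> the Poisson series sums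
to \<open>exp (- (r / n) * (1 - \<alpha>))\<close>, where \<open>\<alpha>\<close> is the mass of the atoms of the jump law.

Since \<open>1 / n = 1 / (n + 1) + 1 / (n * (n + 1))\<close>, the law \<open>P n\<close> is the convolution of \<open>P (n + 1)\<close> with another
law, and convolution does not decrease differential entropy.
\<close>


section \<open>The entropy functional\<close>

definition eta :: "real \<Rightarrow> real" where
  "eta t = - t * ln t"

lemma eta_0 [simp]: "eta 0 = 0"
  by (simp add: eta_def)

lemma isCont_eta: "isCont eta x"
proof (cases "x = 0")
  case True
  have "((\<lambda>t::real. - t * ln t) \<longlongrightarrow> 0) (at_right 0)"
    by real_asymp
  moreover from tendsto_minus[OF this] have "((\<lambda>t::real. - t * ln t) \<longlongrightarrow> 0) (at_left 0)"
    by (simp add: filterlim_at_left_to_right ln_minus)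
  ultimately show ?thesis
    using True by (simp add: isCont_def eta_def [abs_def] filterlim_split_at)
next
  case False
  then show ?thesis
    unfolding eta_def [abs_def] by (intro continuous_intros) auto
qed

lemma borel_measurable_eta [measurable]: "eta \<in> borel_measurable borel"
  by (intro borel_measurable_continuous_onI continuous_at_imp_continuous_on ballI isCont_eta)

lemma eta_nonneg: "0 \<le> t \<Longrightarrow> t \<le> 1 \<Longrightarrow> 0 \<le> eta t"
  by (cases "t = 0") (auto simp: eta_def mult_le_0_iff)

lemma eta_mult: "eta (s * t) = s * eta t + eta s * t"
  by (cases "s = 0"; cases "t = 0") (auto simp: eta_def ln_mult algebra_simps)

lemma eta_le_cross_entropy:
  assumes "0 \<le> t" "0 < u"
  shows "eta t \<le> u - t - t * ln u"
proof (cases "t = 0")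
  case False
  then have t: "0 < t" using assms by simp
  then have "t * ln (u / t) \<le> t * (u / t - 1)"
    using assms by (intro mult_left_mono ln_le_minus_one) auto
  then show ?thesis
    using t assms by (simp add: eta_def ln_div algebra_simps)
qed (use assms in auto)

lemma abs_eta_le_dominated:
  assumes "0 \<le> t" "t \<le> C * u" "1 \<le> C"
  shows "\<bar>eta t\<bar> \<le> (1 + C * ln C) * u + C * \<bar>eta u\<bar>"
proof (cases "t = 0")
  case True
  then have "0 \<le> u" using assms by (simp add: zero_le_mult_iff)
  then show ?thesis using True assms by simp
next
  case False
  then have t: "0 < t" using assms by simp
  then have u: "0 < u" using assms by (smt (verit) zero_less_mult_iff)
  have abs_eta_u: "C * \<bar>eta u\<bar> = C * u * \<bar>ln u\<bar>"
    using u by (simp add: eta_def abs_mult)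
  have t_ln_u: "t * \<bar>ln u\<bar> \<le> C * u * \<bar>ln u\<bar>" and t_ln_C: "t * ln C \<le> C * u * ln C"
    using assms by (auto intro: mult_right_mono)
  have ln_C: "0 \<le> C * u * ln C" using assms u by simp
  have "eta t \<le> u - t - t * ln u"
    using assms(1) u by (rule eta_le_cross_entropy)
  also have "\<dots> \<le> u + t * \<bar>ln u\<bar>"
    using t mult_left_mono[OF abs_ge_minus_self, of t "ln u"] by simp
  finally have upper: "eta t \<le> (1 + C * ln C) * u + C * \<bar>eta u\<bar>"
    using t_ln_u ln_C unfolding abs_eta_u by (simp add: algebra_simps)
  have "t * ln t \<le> t * ln (C * u)"
    using assms t by (intro mult_left_mono ln_mono) auto
  also have "\<dots> = t * ln C + t * ln u"
    using assms u by (simp add: ln_mult distrib_left)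
  also have "\<dots> \<le> t * ln C + t * \<bar>ln u\<bar>"
    using t by simp
  finally have "- eta t \<le> (1 + C * ln C) * u + C * \<bar>eta u\<bar>"
    using t_ln_u t_ln_C u unfolding abs_eta_u by (simp add: eta_def algebra_simps)
  with upper show ?thesis by auto
qed

lemma ln_one_plus_le_sqrt:
  assumes "0 \<le> (t::real)"
  shows "ln (1 + t) \<le> 2 * sqrt t"
proof -
  have "1 + t \<le> (1 + sqrt t)\<^sup>2"
    using assms by (simp add: power2_eq_square algebra_simps)
  then have "ln (1 + t) \<le> ln ((1 + sqrt t)\<^sup>2)"
    using assms by (intro ln_mono) auto
  also have "\<dots> = 2 * ln (1 + sqrt t)"
    using assms by (subst ln_realpow) (auto intro: add_pos_nonneg)
  also have "\<dots> \<le> 2 * sqrt t"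
    using assms ln_add_one_self_le_self[of "sqrt t"] by simp
  finally show ?thesis .
qed

lemma eta_add_defect:
  assumes "0 \<le> a" "0 \<le> b"
  shows "0 \<le> eta a + eta b - eta (a + b)"
    and "eta a + eta b - eta (a + b) \<le> 4 * sqrt (a * b)"
proof -
  have log_ratio: "0 \<le> a * ln ((a + b) / a) \<and> a * ln ((a + b) / a) \<le> 2 * sqrt (a * b)"
    if "0 < a" "0 < b" for a b :: real
  proof
    show "0 \<le> a * ln ((a + b) / a)"
      using that by (intro mult_nonneg_nonneg ln_ge_zero) auto
    have "a * ln ((a + b) / a) = a * ln (1 + b / a)"
      using that by (simp add: add_divide_distrib)
    also have "\<dots> \<le> a * (2 * sqrt (b / a))"
      using that by (intro mult_left_mono ln_one_plus_le_sqrt) auto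
    also have "\<dots> = 2 * sqrt (a * b)"
      using that by (simp add: real_sqrt_mult real_sqrt_divide field_simps)
    finally show "a * ln ((a + b) / a) \<le> 2 * sqrt (a * b)" .
  qed
  have "0 \<le> eta a + eta b - eta (a + b) \<and> eta a + eta b - eta (a + b) \<le> 4 * sqrt (a * b)"
  proof (cases "a = 0 \<or> b = 0")
    case False
    then have pos: "0 < a" "0 < b" using assms by auto
    then have "eta a + eta b - eta (a + b) = a * ln ((a + b) / a) + b * ln ((b + a) / b)"
      by (simp add: eta_def ln_div algebra_simps)
    then show ?thesis
      using log_ratio[OF pos] log_ratio[OF pos(2,1)] by (simp add: mult.commute)
  qed auto
  then show "0 \<le> eta a + eta b - eta (a + b)"
    and "eta a + eta b - eta (a + b) \<le> 4 * sqrt (a * b)" by auto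
qed

definition entropic :: "'a measure \<Rightarrow> ('a \<Rightarrow> real) \<Rightarrow> bool" where
  "entropic N f \<longleftrightarrow> (\<forall>x. 0 \<le> f x) \<and> integrable N f \<and> integrable N (\<lambda>x. eta (f x))"

definition shannon_entropy :: "'a measure \<Rightarrow> ('a \<Rightarrow> real) \<Rightarrow> real" where
  "shannon_entropy N f = (\<integral>x. eta (f x) \<partial>N)"

lemma entropicD:
  assumes "entropic N f"
  shows "0 \<le> f x" "integrable N f" "integrable N (\<lambda>x. eta (f x))" "f \<in> borel_measurable N"
  using assms by (auto simp: entropic_def)

lemma
  assumes f: "entropic N f" and c: "0 \<le> c"
  shows entropic_cmult: "entropic N (\<lambda>x. c * f x)"
    and shannon_entropy_cmult:
      "shannon_entropy N (\<lambda>x. c * f x) = c * shannon_entropy N f + eta c * (\<integral>x. f x \<partial>N)"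
  using c entropicD[OF f] by (simp_all add: entropic_def shannon_entropy_def eta_mult)

lemma
  assumes f: "entropic N f" and g: "entropic N g"
  shows entropic_add: "entropic N (\<lambda>x. f x + g x)"
    and shannon_entropy_add_le:
      "shannon_entropy N (\<lambda>x. f x + g x) \<le> shannon_entropy N f + shannon_entropy N g"
    and shannon_entropy_add_defect_le:
      "shannon_entropy N f + shannon_entropy N g - shannon_entropy N (\<lambda>x. f x + g x)
        \<le> 4 * (\<integral>x. sqrt (f x * g x) \<partial>N)"
proof -
  let ?defect = "\<lambda>x. eta (f x) + eta (g x) - eta (f x + g x)"
  note [measurable] = entropicD(4)[OF f] entropicD(4)[OF g]
  note nonneg = entropicD(1)[OF f] entropicD(1)[OF g]
  have defect: "0 \<le> ?defect x" "?defect x \<le> 4 * sqrt (f x * g x)" for x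
    using eta_add_defect nonneg by blast+
  have sqrt_int: "integrable N (\<lambda>x. sqrt (f x * g x))"
  proof (rule Bochner_Integration.integrable_bound)
    show "integrable N (\<lambda>x. f x + g x)"
      using entropicD(2)[OF f] entropicD(2)[OF g] by simp
    show "AE x in N. norm (sqrt (f x * g x)) \<le> norm (f x + g x)"
    proof (rule AE_I2)
      fix x show "norm (sqrt (f x * g x)) \<le> norm (f x + g x)"
        using arith_geo_mean_sqrt[OF nonneg(1)[of x] nonneg(2)[of x]] nonneg(1)[of x] nonneg(2)[of x] by simp
    qed
  qed simp
  have defect_int: "integrable N ?defect"
    by (rule Bochner_Integration.integrable_bound[OF integrable_mult_right[OF sqrt_int, of 4]])
       (use defect in \<open>auto simp: abs_of_nonneg nonneg\<close>)
  have "integrable N (\<lambda>x. eta (f x) + eta (g x) - ?defect x)"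
    by (intro Bochner_Integration.integrable_diff Bochner_Integration.integrable_add defect_int
        entropicD(3)[OF f] entropicD(3)[OF g])
  then show sum: "entropic N (\<lambda>x. f x + g x)"
    using entropicD(2)[OF f] entropicD(2)[OF g] nonneg by (simp add: entropic_def)
  have defect_eq: "shannon_entropy N f + shannon_entropy N g - shannon_entropy N (\<lambda>x. f x + g x)
      = (\<integral>x. ?defect x \<partial>N)"
    using entropicD(3)[OF f] entropicD(3)[OF g] entropicD(3)[OF sum] by (simp add: shannon_entropy_def)
  have "0 \<le> (\<integral>x. ?defect x \<partial>N)"
    using defect(1) by (intro Bochner_Integration.integral_nonneg)
  then show "shannon_entropy N (\<lambda>x. f x + g x) \<le> shannon_entropy N f + shannon_entropy N g"
    using defect_eq by simp
  have "(\<integral>x. ?defect x \<partial>N) \<le> (\<integral>x. 4 * sqrt (f x * g x) \<partial>N)"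
    using defect_int sqrt_int defect(2) by (intro integral_mono) auto
  then show "shannon_entropy N f + shannon_entropy N g - shannon_entropy N (\<lambda>x. f x + g x)
      \<le> 4 * (\<integral>x. sqrt (f x * g x) \<partial>N)"
    using defect_eq by simp
qed

definition entropy_majorant :: "real \<Rightarrow> 'a measure \<Rightarrow> ('a \<Rightarrow> real) \<Rightarrow> real" where
  "entropy_majorant C N u = (\<integral>x. (1 + C * ln C) * u x + C * \<bar>eta (u x)\<bar> \<partial>N)"

lemma
  assumes u: "entropic N u" and [measurable]: "f \<in> borel_measurable N" and nonneg: "\<And>x. 0 \<le> f x"
    and bounded_AE: "AE x in N. f x \<le> C * u x" and C: "1 \<le> C"
  shows entropic_dominated: "entropic N f"
    and abs_shannon_entropy_dominated_le: "\<bar>shannon_entropy N f\<bar> \<le> entropy_majorant C N u"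
proof -
  note [measurable] = entropicD(4)[OF u]
  have majorant_int: "integrable N (\<lambda>x. (1 + C * ln C) * u x + C * \<bar>eta (u x)\<bar>)"
    using entropicD(2,3)[OF u] by auto
  have eta_le: "AE x in N. \<bar>eta (f x)\<bar> \<le> (1 + C * ln C) * u x + C * \<bar>eta (u x)\<bar>"
    using bounded_AE by eventually_elim (intro abs_eta_le_dominated nonneg C)
  have eta_int: "integrable N (\<lambda>x. eta (f x))"
    by (rule Bochner_Integration.integrable_bound[OF majorant_int]) (use eta_le in auto)
  moreover have "integrable N f"
    by (rule Bochner_Integration.integrable_bound[OF integrable_mult_right[OF entropicD(2)[OF u], of C]])
       (use bounded_AE in \<open>auto simp: nonneg elim!: eventually_mono\<close>)
  ultimately show "entropic N f"
    using nonneg by (simp add: entropic_def)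
  have "\<bar>shannon_entropy N f\<bar> \<le> (\<integral>x. \<bar>eta (f x)\<bar> \<partial>N)"
    unfolding shannon_entropy_def by (rule integral_abs_bound)
  also have "\<dots> \<le> entropy_majorant C N u"
    unfolding entropy_majorant_def using eta_int majorant_int eta_le by (intro integral_mono_AE) auto
  finally show "\<bar>shannon_entropy N f\<bar> \<le> entropy_majorant C N u" .
qed

lemma
  assumes u: "entropic N u" and f: "f \<in> borel_measurable N" "\<And>x. 0 \<le> f x"
    and bounded_AE: "AE x in N. s * f x \<le> C * u x" and C: "1 \<le> C" and s: "0 < s"
  shows entropic_scaled_dominated: "entropic N f"
    and abs_shannon_entropy_scaled_dominated_le:
      "\<bar>s * shannon_entropy N f - s * ln s * (\<integral>x. f x \<partial>N)\<bar> \<le> entropy_majorant C N u"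
proof -
  have scaled: "(\<lambda>x. s * f x) \<in> borel_measurable N" "\<And>x. 0 \<le> s * f x"
    using f s by auto
  have "entropic N (\<lambda>x. 1 / s * (s * f x))"
    using s by (intro entropic_cmult entropic_dominated[OF u scaled bounded_AE C]) auto
  then show f_entropic: "entropic N f"
    using s by simp
  have "shannon_entropy N (\<lambda>x. s * f x) = s * shannon_entropy N f - s * ln s * (\<integral>x. f x \<partial>N)"
    using shannon_entropy_cmult[OF f_entropic, of s] s by (simp add: eta_def)
  then show "\<bar>s * shannon_entropy N f - s * ln s * (\<integral>x. f x \<partial>N)\<bar> \<le> entropy_majorant C N u"
    using abs_shannon_entropy_dominated_le[OF u scaled bounded_AE C] by simp
qed

lemma shannon_entropy_le_cross_entropy:
  assumes f: "entropic N f" and u: "integrable N u" "\<And>x. 0 \<le> u x"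
    and pos: "AE x in N. 0 < f x \<longrightarrow> 0 < u x" and f_ln_u: "integrable N (\<lambda>x. f x * ln (u x))"
  shows "shannon_entropy N f \<le> (\<integral>x. u x \<partial>N) - (\<integral>x. f x \<partial>N) - (\<integral>x. f x * ln (u x) \<partial>N)"
proof -
  have "shannon_entropy N f \<le> (\<integral>x. u x - f x - f x * ln (u x) \<partial>N)"
    unfolding shannon_entropy_def
  proof (rule integral_mono_AE)
    show "AE x in N. eta (f x) \<le> u x - f x - f x * ln (u x)"
      using pos
    proof eventually_elim
      case (elim x)
      then show ?case
        using entropicD(1)[OF f, of x] u(2)[of x]
        by (cases "f x = 0") (auto intro!: eta_le_cross_entropy)
    qed
  qed (use f u f_ln_u in \<open>auto simp: entropicD\<close>)
  also have "\<dots> = (\<integral>x. u x \<partial>N) - (\<integral>x. f x \<partial>N) - (\<integral>x. f x * ln (u x) \<partial>N)"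
    using f u f_ln_u by (simp add: entropicD)
  finally show ?thesis .
qed

lemma (in prob_space) shannon_entropy_le_eta_integral:
  assumes f: "entropic M f"
  shows "shannon_entropy M f \<le> eta (\<integral>x. f x \<partial>M)"
proof (cases "(\<integral>x. f x \<partial>M) = 0")
  case True
  then have "AE x in M. f x = 0"
    using f by (subst integral_nonneg_eq_0_iff_AE[symmetric]) (auto simp: entropicD)
  then have "shannon_entropy M f = (\<integral>x. 0 \<partial>M)"
    unfolding shannon_entropy_def using entropicD(4)[OF f]
    by (intro integral_cong_AE) (auto elim!: eventually_mono)
  then show ?thesis using True by simp
next
  case False
  moreover have "0 \<le> (\<integral>x. f x \<partial>M)"
    using f by (intro Bochner_Integration.integral_nonneg) (auto simp: entropicD)
  ultimately have "0 < (\<integral>x. f x \<partial>M)" by simp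
  then show ?thesis
    using shannon_entropy_le_cross_entropy[OF f, of "\<lambda>_. \<integral>x. f x \<partial>M"] f
    by (simp add: entropicD prob_space eta_def)
qed

lemma eta_integral_le_shannon_entropy:
  fixes f :: "'a \<Rightarrow> real"
  assumes f: "entropic (count_space UNIV) f"
  shows "eta (\<integral>x. f x \<partial>count_space UNIV) \<le> shannon_entropy (count_space UNIV) f"
proof -
  let ?s = "\<integral>x. f x \<partial>count_space UNIV"
  have le_sum: "f x \<le> ?s" for x
  proof -
    have "f x = (\<integral>y. f x * indicator {x} y \<partial>count_space UNIV)"
      by simp
    also have "\<dots> \<le> ?s"
      using f by (intro integral_mono integrable_mult_right integrable_real_indicator)
        (auto simp: entropicD indicator_def)
    finally show ?thesis .
  qed
  have "eta ?s = (\<integral>x. f x * - ln ?s \<partial>count_space UNIV)"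
    by (simp add: eta_def)
  also have "\<dots> \<le> shannon_entropy (count_space UNIV) f"
    unfolding shannon_entropy_def
  proof (rule integral_mono)
    fix x
    have "f x * ln (f x) \<le> f x * ln ?s" if "0 < f x"
      using that le_sum[of x] by (intro mult_left_mono ln_mono) auto
    then show "f x * - ln ?s \<le> eta (f x)"
      using entropicD(1)[OF f, of x] by (cases "f x = 0") (auto simp: eta_def)
  qed (use f in \<open>auto simp: entropicD\<close>)
  finally show ?thesis .
qed

lemma
  fixes f :: "'a \<Rightarrow> real"
  assumes f: "entropic (count_space UNIV) (f(c := 0))" and nonneg: "0 \<le> f c"
  shows entropic_fun_upd_0D: "entropic (count_space UNIV) f"
    and shannon_entropy_fun_upd_0:
      "shannon_entropy (count_space UNIV) f = eta (f c) + shannon_entropy (count_space UNIV) (f(c := 0))"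
proof -
  have point: "integrable (count_space UNIV) (\<lambda>x. a * indicator {c} x)" for a :: real
    by (intro integrable_mult_right integrable_real_indicator) auto
  have split: "f = (\<lambda>x. f c * indicator {c} x + (f(c := 0)) x)"
    "(\<lambda>x. eta (f x)) = (\<lambda>x. eta (f c) * indicator {c} x + eta ((f(c := 0)) x))"
    by auto
  have "0 \<le> f x" for x
    using entropicD(1)[OF f, of x] nonneg by (cases "x = c") auto
  moreover have "integrable (count_space UNIV) f"
    by (subst split(1)) (intro Bochner_Integration.integrable_add point entropicD(2)[OF f])
  moreover have "integrable (count_space UNIV) (\<lambda>x. eta (f x))"
    by (subst split(2)) (intro Bochner_Integration.integrable_add point entropicD(3)[OF f])
  ultimately show "entropic (count_space UNIV) f"
    by (simp add: entropic_def)
  show "shannon_entropy (count_space UNIV) f = eta (f c) + shannon_entropy (count_space UNIV) (f(c := 0))"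
    unfolding shannon_entropy_def
    by (subst split(2), subst Bochner_Integration.integral_add[OF point entropicD(3)[OF f]]) simp
qed

subsection \<open>Translation invariance\<close>

definition translation_invariant :: "real measure \<Rightarrow> bool" where
  "translation_invariant N \<longleftrightarrow> (\<forall>c. (\<lambda>x. x + c) \<in> measurable N N \<and> distr N N (\<lambda>x. x + c) = N)"

lemma translation_invariant_lborel: "translation_invariant lborel"
proof -
  have "distr lborel lborel (\<lambda>x::real. x + c) = lborel" for c
    using lborel_distr_plus[of c] by (simp add: add.commute cong: distr_cong)
  then show ?thesis by (simp add: translation_invariant_def)
qed

lemma translation_invariant_count_space: "translation_invariant (count_space UNIV)"
  by (simp add: translation_invariant_def distr_bij_count_space bij_plus_right)

lemma
  fixes f :: "real \<Rightarrow> real"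
  assumes N: "translation_invariant N" and f: "f \<in> borel_measurable N"
  shows integrable_translate_iff: "integrable N (\<lambda>x. f (x + c)) \<longleftrightarrow> integrable N f"
    and integral_translate: "(\<integral>x. f (x + c) \<partial>N) = (\<integral>x. f x \<partial>N)"
  using N f integrable_distr_eq[of "\<lambda>x. x + c" N N f] integral_distr[of "\<lambda>x. x + c" N N f]
  by (simp_all add: translation_invariant_def)

lemma
  assumes N: "translation_invariant N" and f: "entropic N f"
  shows entropic_translate: "entropic N (\<lambda>x. f (x + c))"
    and entropy_majorant_translate: "entropy_majorant C N (\<lambda>x. f (x + c)) = entropy_majorant C N f"
proof -
  note [measurable] = entropicD(4)[OF f]
  show "entropic N (\<lambda>x. f (x + c))"
    using f integrable_translate_iff[OF N, of f c] integrable_translate_iff[OF N, of "\<lambda>x. eta (f x)" c]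
    by (simp add: entropic_def)
  show "entropy_majorant C N (\<lambda>x. f (x + c)) = entropy_majorant C N f"
    unfolding entropy_majorant_def
    using integral_translate[OF N, of "\<lambda>x. (1 + C * ln C) * f x + C * \<bar>eta (f x)\<bar>" c] by simp
qed

section \<open>Atoms and discrete laws\<close>

abbreviation atom_mass :: "real measure \<Rightarrow> real \<Rightarrow> real" where
  "atom_mass M x \<equiv> measure M {x}"

abbreviation finite_atomic_entropy :: "real measure \<Rightarrow> bool" where
  "finite_atomic_entropy M \<equiv> entropic (count_space UNIV) (atom_mass M)"

abbreviation atomic_entropy :: "real measure \<Rightarrow> real" where
  "atomic_entropy M \<equiv> shannon_entropy (count_space UNIV) (atom_mass M)"

lemma countable_in_sets_borel: "countable S \<Longrightarrow> S \<in> sets (borel :: real measure)"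
  by (rule sets.countable) auto

lemma space_eq_UNIV_if_sets_borel: "sets M = sets (borel :: real measure) \<Longrightarrow> space M = UNIV"
  using sets_eq_imp_space_eq by force

lemma discrete_law_eq_distr_density:
  assumes sets_M: "sets M = sets borel" and "discrete_law M"
    and atoms: "\<And>x. emeasure M {x} = ennreal (w x)"
  shows "M = distr (density (count_space UNIV) (\<lambda>x. ennreal (w x))) borel (\<lambda>x. x)"
proof (rule measure_eqI)
  let ?N = "distr (density (count_space UNIV) (\<lambda>x. ennreal (w x))) borel (\<lambda>x. x)"
  show "sets M = sets ?N" by (simp add: sets_M)
  fix A assume "A \<in> sets M"
  then have A [measurable]: "A \<in> sets borel" by (simp add: sets_M)
  obtain D where D: "countable D" "emeasure M (UNIV - D) = 0"
    using \<open>discrete_law M\<close> by (auto simp: discrete_law_def)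
  have [measurable]: "D \<in> sets borel" using D(1) by (rule countable_in_sets_borel)
  have null: "emeasure M B = 0" if "B \<inter> D = {}" for B
    using emeasure_mono[of B "UNIV - D" M] that D(2) by (simp add: sets_M) blast
  have "emeasure M A = emeasure M (A \<inter> D) + emeasure M (A - D)"
    using A by (subst plus_emeasure) (auto simp: sets_M intro!: arg_cong[where f="emeasure M"])
  also have "emeasure M (A - D) = 0" by (rule null) auto
  also have "emeasure M (A \<inter> D) = (\<integral>\<^sup>+x. emeasure M {x} \<partial>count_space (A \<inter> D))"
    using D(1) by (intro emeasure_countable_singleton) (auto simp: sets_M)
  also have "\<dots> = (\<integral>\<^sup>+x. emeasure M {x} * indicator (A \<inter> D) x \<partial>count_space UNIV)"
    by (subst nn_integral_count_space_indicator) auto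
  also have "\<dots> = (\<integral>\<^sup>+x. ennreal (w x) * indicator A x \<partial>count_space UNIV)"
    using null[of "{_}"] by (intro nn_integral_cong) (auto simp: indicator_def atoms)
  also have "\<dots> = emeasure ?N A"
    by (subst emeasure_distr) (auto simp: emeasure_density)
  finally show "emeasure M A = emeasure ?N A" by simp
qed

lemma
  fixes f :: "real \<Rightarrow> real"
  assumes M: "sets M = sets borel" "discrete_law M"
    and atoms: "\<And>x. emeasure M {x} = ennreal (w x)" "\<And>x. 0 \<le> w x"
    and f: "f \<in> borel_measurable borel"
  shows integrable_discrete_law_iff:
      "integrable M f \<longleftrightarrow> integrable (count_space UNIV) (\<lambda>x. w x * f x)"
    and integral_discrete_law: "(\<integral>x. f x \<partial>M) = (\<integral>x. w x * f x \<partial>count_space UNIV)"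
proof -
  let ?N = "density (count_space UNIV) (\<lambda>x. ennreal (w x))"
  note M_eq = discrete_law_eq_distr_density[OF M atoms(1)]
  have "integrable M f \<longleftrightarrow> integrable ?N f"
    using f by (subst M_eq) (subst integrable_distr_eq, auto)
  then show "integrable M f \<longleftrightarrow> integrable (count_space UNIV) (\<lambda>x. w x * f x)"
    using atoms(2) by (simp add: integrable_real_density)
  have "(\<integral>x. f x \<partial>M) = (\<integral>x. f x \<partial>?N)"
    using f by (subst M_eq) (subst integral_distr, auto)
  then show "(\<integral>x. f x \<partial>M) = (\<integral>x. w x * f x \<partial>count_space UNIV)"
    using atoms(2) by (simp add: integral_real_density)
qed

context finite_borel_measure
begin

lemma space_UNIV [simp]: "space M = UNIV"
  using M_is_borel by (rule space_eq_UNIV_if_sets_borel)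

lemma emeasure_le_measure_UNIV: "emeasure M A \<le> ennreal (measure M UNIV)"
  using bounded_measure[of A] by (simp add: emeasure_eq_measure)

lemma nn_integral_atom_mass_le:
  "(\<integral>\<^sup>+x. ennreal (atom_mass M x) \<partial>count_space UNIV) \<le> ennreal (measure M UNIV)"
proof -
  let ?S = "{x. 0 < atom_mass M x}"
  have "countable ?S" using countable_support by (simp add: zero_less_measure_iff)
  then have "emeasure M ?S = (\<integral>\<^sup>+x. ennreal (atom_mass M x) \<partial>count_space ?S)"
    by (subst emeasure_countable_singleton) (auto simp: M_is_borel emeasure_eq_measure)
  also have "\<dots> = (\<integral>\<^sup>+x. ennreal (atom_mass M x) \<partial>count_space UNIV)"
    by (intro nn_integral_count_space_eq) (auto simp: less_le)
  finally show ?thesis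
    using emeasure_le_measure_UNIV[of ?S] by simp
qed

lemma integrable_atom_mass: "integrable (count_space UNIV) (atom_mass M)"
  using nn_integral_atom_mass_le by (intro integrableI_nonneg) (auto intro: le_less_trans)

lemma integral_atom_mass_le: "(\<integral>x. atom_mass M x \<partial>count_space UNIV) \<le> measure M UNIV"
  using nn_integral_atom_mass_le nn_integral_eq_integral[OF integrable_atom_mass]
  by (simp add: Bochner_Integration.integral_nonneg)

lemma borel_measurable_atom_mass [measurable]: "atom_mass M \<in> borel_measurable borel"
proof (rule measurable_discrete_difference[where f="\<lambda>_. 0" and X="{x. 0 < atom_mass M x}"])
  show "countable {x. 0 < atom_mass M x}"
    using countable_support by (simp add: zero_less_measure_iff)
qed (auto simp: less_le)

lemma
  assumes "measure M UNIV \<le> 1"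
  shows finite_atomic_entropy_iff_dentropy: "finite_atomic_entropy M \<longleftrightarrow> dentropy M < \<infinity>"
    and enn2real_dentropy: "enn2real (dentropy M) = atomic_entropy M"
proof -
  have eta_nonneg: "0 \<le> eta (atom_mass M x)" for x
    using bounded_measure[of "{x}"] assms by (intro eta_nonneg) auto
  have dentropy_eq: "dentropy M = (\<integral>\<^sup>+x. ennreal (eta (atom_mass M x)) \<partial>count_space UNIV)"
    by (simp add: dentropy_def eta_def)
  show "finite_atomic_entropy M \<longleftrightarrow> dentropy M < \<infinity>"
    using integrable_atom_mass unfolding entropic_def dentropy_eq
    by (simp add: integrable_iff_bounded[of _ "\<lambda>x. eta (atom_mass M x)"] eta_nonneg)
  show "enn2real (dentropy M) = atomic_entropy M"
    unfolding dentropy_eq shannon_entropy_def using eta_nonneg by (subst integral_eq_nn_integral) auto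
qed

lemmas integrable_discrete_iff = integrable_discrete_law_iff[OF M_is_borel _ emeasure_eq_measure measure_nonneg]
  and integral_discrete = integral_discrete_law[OF M_is_borel _ emeasure_eq_measure measure_nonneg]

lemma AE_atom_mass_pos:
  assumes disc: "discrete_law M"
  shows "AE x in M. 0 < atom_mass M x"
proof -
  let ?N = "distr (density (count_space UNIV) (\<lambda>x. ennreal (atom_mass M x))) borel (\<lambda>x. x)"
  have "AE x in ?N. 0 < atom_mass M x"
    by (subst AE_distr_iff) (auto simp: AE_density AE_count_space)
  then show ?thesis
    by (simp only: discrete_law_eq_distr_density[OF M_is_borel disc emeasure_eq_measure, symmetric])
qed

lemma
  assumes disc: "discrete_law M"
  shows finite_atomic_entropy_discrete_iff:
      "finite_atomic_entropy M \<longleftrightarrow> integrable M (\<lambda>x. ln (atom_mass M x))"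
    and atomic_entropy_discrete: "atomic_entropy M = - (\<integral>x. ln (atom_mass M x) \<partial>M)"
  using integrable_discrete_iff[OF disc, of "\<lambda>x. ln (atom_mass M x)"]
    integral_discrete[OF disc, of "\<lambda>x. ln (atom_mass M x)"]
  by (simp_all add: entropic_def shannon_entropy_def eta_def integrable_atom_mass)

end

section \<open>Quantization\<close>

definition quantize :: "nat \<Rightarrow> real measure \<Rightarrow> real measure" where
  "quantize m M = distr M borel (quant m)"

lemma Hq_eq_dentropy_quantize: "Hq m M = dentropy (quantize m M)"
  by (simp add: Hq_def quantize_def)

lemma borel_measurable_quant [measurable]: "quant m \<in> borel_measurable borel"
  unfolding quant_def by measurable

lemma vimage_quant_sets [measurable]: "A \<in> sets borel \<Longrightarrow> quant m -` A \<in> sets borel"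
  using measurable_sets[OF borel_measurable_quant, of A m] by simp

lemma vimage_quant:
  assumes "1 \<le> m"
  shows "quant m -` {quant m x} = {quant m x - 1 / (2 * real m) ..< quant m x + 1 / (2 * real m)}"
proof (rule set_eqI)
  fix y
  have "y \<in> quant m -` {quant m x} \<longleftrightarrow> \<lfloor>1/2 + real m * y\<rfloor> = \<lfloor>1/2 + real m * x\<rfloor>"
    using assms by (simp add: quant_def)
  also have "\<dots> \<longleftrightarrow> y \<in> {quant m x - 1 / (2 * real m) ..< quant m x + 1 / (2 * real m)}"
    using assms by (auto simp: quant_def floor_eq_iff field_simps)
  finally show "y \<in> quant m -` {quant m x}
      \<longleftrightarrow> y \<in> {quant m x - 1 / (2 * real m) ..< quant m x + 1 / (2 * real m)}" .
qed

lemma abs_diff_le_if_quant_eq: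
  assumes "1 \<le> m" "quant m x = quant m y"
  shows "\<bar>x - y\<bar> \<le> 1 / real m"
proof -
  have "x \<in> quant m -` {quant m y}" "y \<in> quant m -` {quant m y}" using assms(2) by auto
  then show ?thesis
    using vimage_quant[OF assms(1), of y] add_divide_distrib[of 1 1 "2 * real m"] by (auto simp: abs_le_iff)
qed

lemma quant_quant [simp]: "quant m (quant m x) = quant m x"
  by (cases "m = 0") (simp_all add: quant_def floor_eq_iff)

lemma abs_diff_quant_le: "1 \<le> m \<Longrightarrow> \<bar>x - quant m x\<bar> \<le> 1 / real m"
  by (rule abs_diff_le_if_quant_eq) simp_all

lemma sets_quantize [simp]: "sets (quantize m M) = sets borel"
  by (simp add: quantize_def)

lemma emeasure_quantize:
  assumes "sets M = sets borel" "A \<in> sets borel"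
  shows "emeasure (quantize m M) A = emeasure M (quant m -` A)"
  using assms by (simp add: quantize_def emeasure_distr space_eq_UNIV_if_sets_borel cong: measurable_cong_sets)

lemma measure_quantize:
  assumes "sets M = sets borel" "A \<in> sets borel"
  shows "measure (quantize m M) A = measure M (quant m -` A)"
  using emeasure_quantize[OF assms] by (simp add: measure_def)

lemma
  fixes f :: "real \<Rightarrow> real"
  assumes M: "sets M = sets borel" and f: "f \<in> borel_measurable borel"
  shows integrable_quantize_iff: "integrable (quantize m M) f \<longleftrightarrow> integrable M (\<lambda>x. f (quant m x))"
    and integral_quantize: "(\<integral>x. f x \<partial>quantize m M) = (\<integral>x. f (quant m x) \<partial>M)"
  using f M by (simp_all add: quantize_def integrable_distr_eq integral_distr cong: measurable_cong_sets)

lemma discrete_law_quantize: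
  assumes "sets M = sets borel"
  shows "discrete_law (quantize m M)"
  unfolding discrete_law_def
proof (intro exI conjI)
  have "range (quant m) \<subseteq> range (\<lambda>k. real_of_int k / real m)"
    by (auto simp: quant_def)
  then show countable: "countable (range (quant m))"
    by (rule countable_subset) simp
  have "quant m -` (UNIV - range (quant m)) = {}" by auto
  moreover have "UNIV - range (quant m) \<in> sets borel"
    using countable_in_sets_borel[OF countable] by auto
  ultimately show "emeasure (quantize m M) (UNIV - range (quant m)) = 0"
    using assms by (simp add: emeasure_quantize)
qed

lemma emeasure_quantize_lborel_singleton:
  assumes "1 \<le> m"
  shows "emeasure (quantize m lborel) {x} = ennreal (indicator (range (quant m)) x / real m)"
proof (cases "x \<in> range (quant m)")
  case True
  then obtain y where "x = quant m y" by auto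
  then show ?thesis
    using assms by (simp add: emeasure_quantize vimage_quant)
next
  case False
  then have "quant m -` {x} = {}" by auto
  then show ?thesis
    using False by (simp add: emeasure_quantize)
qed

lemma (in finite_borel_measure) finite_borel_measure_quantize: "finite_borel_measure (quantize m M)"
proof (intro finite_borel_measure.intro finite_borel_measure_axioms.intro sets_quantize)
  show "finite_measure (quantize m M)"
    unfolding quantize_def using M_is_borel
    by (intro finite_measure_distr) (simp cong: measurable_cong_sets)
qed

context finite_borel_measure
begin

lemma measure_quantize_UNIV: "measure (quantize m M) UNIV = measure M UNIV"
  by (simp add: measure_quantize M_is_borel)

lemma AE_atom_mass_quantize_pos: "AE x in M. 0 < atom_mass (quantize m M) (quant m x)"
proof -
  interpret quantized: finite_borel_measure "quantize m M"
    by (rule finite_borel_measure_quantize)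
  have "AE x in distr M borel (quant m). 0 < atom_mass (quantize m M) x"
    using quantized.AE_atom_mass_pos[OF discrete_law_quantize[OF M_is_borel]]
    unfolding quantize_def [symmetric] .
  then show ?thesis
    by (rule AE_distrD[rotated]) (simp add: M_is_borel cong: measurable_cong_sets)
qed

lemma
  fixes f :: "real \<Rightarrow> real"
  assumes f: "f \<in> borel_measurable borel"
  shows integrable_quant_iff:
      "integrable M (\<lambda>x. f (quant m x))
        \<longleftrightarrow> integrable (count_space UNIV) (\<lambda>x. atom_mass (quantize m M) x * f x)"
    and integral_quant:
      "(\<integral>x. f (quant m x) \<partial>M) = (\<integral>x. atom_mass (quantize m M) x * f x \<partial>count_space UNIV)"
proof -
  interpret quantized: finite_borel_measure "quantize m M"
    by (rule finite_borel_measure_quantize)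
  note discrete = discrete_law_quantize[OF M_is_borel]
  show "integrable M (\<lambda>x. f (quant m x))
      \<longleftrightarrow> integrable (count_space UNIV) (\<lambda>x. atom_mass (quantize m M) x * f x)"
    using quantized.integrable_discrete_iff[OF discrete f] integrable_quantize_iff[OF M_is_borel f] by simp
  show "(\<integral>x. f (quant m x) \<partial>M) = (\<integral>x. atom_mass (quantize m M) x * f x \<partial>count_space UNIV)"
    using quantized.integral_discrete[OF discrete f] integral_quantize[OF M_is_borel f] by simp
qed

lemma finite_atomic_entropy_quantize_iff:
    "finite_atomic_entropy (quantize m M) \<longleftrightarrow> integrable M (\<lambda>x. ln (atom_mass (quantize m M) (quant m x)))"
  and atomic_entropy_quantize:
    "atomic_entropy (quantize m M) = - (\<integral>x. ln (atom_mass (quantize m M) (quant m x)) \<partial>M)"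
proof -
  interpret quantized: finite_borel_measure "quantize m M"
    by (rule finite_borel_measure_quantize)
  note discrete = discrete_law_quantize[OF M_is_borel]
  have ln_atom: "(\<lambda>x. ln (atom_mass (quantize m M) x)) \<in> borel_measurable borel" by measurable
  show "finite_atomic_entropy (quantize m M) \<longleftrightarrow> integrable M (\<lambda>x. ln (atom_mass (quantize m M) (quant m x)))"
    using quantized.finite_atomic_entropy_discrete_iff[OF discrete] integrable_quantize_iff[OF M_is_borel ln_atom]
    by simp
  show "atomic_entropy (quantize m M) = - (\<integral>x. ln (atom_mass (quantize m M) (quant m x)) \<partial>M)"
    using quantized.atomic_entropy_discrete[OF discrete] integral_quantize[OF M_is_borel ln_atom] by simp
qed

lemma atom_mass_quantize_le: "atom_mass (quantize m M) x \<le> measure M UNIV"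
  using bounded_measure[of "quant m -` {x}"] by (simp add: measure_quantize M_is_borel)

lemma atom_mass_le_quantize: "atom_mass M x \<le> atom_mass (quantize m M) (quant m x)"
  by (auto simp: measure_quantize M_is_borel intro!: finite_measure_mono)

lemma atom_mass_quantize_tendsto: "(\<lambda>m. atom_mass (quantize m M) (quant m x)) \<longlonglongrightarrow> atom_mass M x"
proof (rule tendsto_sandwich[where f="\<lambda>_. atom_mass M x"])
  let ?B = "\<lambda>m. cball x (1 / real (Suc m))"
  have "(\<lambda>m. measure M (?B m)) \<longlonglongrightarrow> measure M (\<Inter>m. ?B m)"
  proof (rule finite_Lim_measure_decseq)
    show "decseq ?B"
      by (intro decseq_SucI subset_cball) (auto simp: field_simps)
  qed (auto simp: M_is_borel)
  moreover have "(\<Inter>m. ?B m) = {x}"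
  proof -
    have "y = x" if "\<forall>m. dist x y \<le> 1 / real (Suc m)" for y
      using that LIMSEQ_le_const[OF LIMSEQ_Suc[OF lim_1_over_n], of "dist x y"] by auto
    then show ?thesis by auto
  qed
  ultimately show "(\<lambda>m. measure M (?B (m - 1))) \<longlonglongrightarrow> atom_mass M x"
    by (intro filterlim_compose[OF _ filterlim_minus_const_nat_at_top, of "\<lambda>m. measure M (?B m)"]) simp
  show "\<forall>\<^sub>F m in sequentially. atom_mass (quantize m M) (quant m x) \<le> measure M (?B (m - 1))"
  proof (rule eventually_sequentiallyI[of 1])
    fix m :: nat assume m: "1 \<le> m"
    then have "quant m -` {quant m x} \<subseteq> ?B (m - 1)"
      by (auto simp: dist_real_def intro!: abs_diff_le_if_quant_eq)
    then show "atom_mass (quantize m M) (quant m x) \<le> measure M (?B (m - 1))"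
      by (auto simp: measure_quantize M_is_borel intro!: finite_measure_mono)
  qed
qed (auto intro: always_eventually atom_mass_le_quantize)

lemma
  assumes disc: "discrete_law M" and fin: "finite_atomic_entropy M"
  shows finite_atomic_entropy_quantize_discrete: "finite_atomic_entropy (quantize m M)"
    and atomic_entropy_quantize_discrete_tendsto:
      "(\<lambda>m. atomic_entropy (quantize m M)) \<longlonglongrightarrow> atomic_entropy M"
proof -
  interpret quantized: finite_borel_measure "quantize m M" for m
    by (rule finite_borel_measure_quantize)
  let ?q = "measure M UNIV"
  note [measurable_cong] = M_is_borel
  let ?ln_cell = "\<lambda>m x. ln (atom_mass (quantize m M) (quant m x))"
  let ?bound = "\<lambda>x. \<bar>ln (atom_mass M x)\<bar> + \<bar>ln ?q\<bar>"
  have ln_atom_int: "integrable M (\<lambda>x. ln (atom_mass M x))"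
    using fin finite_atomic_entropy_discrete_iff[OF disc] by simp
  then have bound_int: "integrable M ?bound" by simp
  have bound: "AE x in M. norm (?ln_cell m x) \<le> ?bound x" for m
    using AE_atom_mass_pos[OF disc]
  proof eventually_elim
    case (elim x)
    have "ln (atom_mass M x) \<le> ?ln_cell m x" "?ln_cell m x \<le> ln ?q"
      using elim atom_mass_le_quantize[of x m] atom_mass_quantize_le[of m "quant m x"]
      by (auto intro: ln_mono)
    then show ?case by auto
  qed
  have lim: "AE x in M. (\<lambda>m. ?ln_cell m x) \<longlonglongrightarrow> ln (atom_mass M x)"
    using AE_atom_mass_pos[OF disc]
    by eventually_elim (auto intro!: tendsto_ln atom_mass_quantize_tendsto)
  show "finite_atomic_entropy (quantize m M)"
    unfolding finite_atomic_entropy_quantize_iff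
    by (rule Bochner_Integration.integrable_bound[OF bound_int]) (use bound in auto)
  have "(\<lambda>m. \<integral>x. ?ln_cell m x \<partial>M) \<longlonglongrightarrow> (\<integral>x. ln (atom_mass M x) \<partial>M)"
    by (rule integral_dominated_convergence[OF _ _ bound_int lim bound]) auto
  then show "(\<lambda>m. atomic_entropy (quantize m M)) \<longlonglongrightarrow> atomic_entropy M"
    unfolding atomic_entropy_quantize atomic_entropy_discrete[OF disc]
    by (rule tendsto_minus)
qed

end

lemma sqrt_le_min_plus_divide:
  assumes "0 < K" "0 \<le> t"
  shows "sqrt t \<le> min (sqrt t) K + t / K"
proof (cases "sqrt t \<le> K")
  case False
  then have "K * sqrt t \<le> sqrt t * sqrt t"
    using assms by (intro mult_right_mono) auto
  then have "sqrt t \<le> t / K"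
    using assms by (simp add: field_simps)
  then show ?thesis using assms by (simp add: min_def)
qed (use assms in simp)

text \<open>The overlap of the cell masses of A and B is an integral of the square root of their ratio under A.
  When A is discrete and B has no atoms, the ratio tends to 0 almost everywhere; its integrals are bounded,
  so the square roots are uniformly integrable.\<close>

definition cell_ratio :: "real measure \<Rightarrow> real measure \<Rightarrow> nat \<Rightarrow> real \<Rightarrow> real" where
  "cell_ratio A B m x = atom_mass (quantize m B) x / atom_mass (quantize m A) x"

lemma cell_ratio_nonneg: "0 \<le> cell_ratio A B m x"
  by (simp add: cell_ratio_def)

context
  fixes A B :: "real measure"
  assumes A: "finite_borel_measure A" and B: "finite_borel_measure B"
begin

interpretation A: finite_borel_measure A by (rule A)
interpretation B: finite_borel_measure B by (rule B)
interpretation quantized_A: finite_borel_measure "quantize m A" for m by (rule A.finite_borel_measure_quantize)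
interpretation quantized_B: finite_borel_measure "quantize m B" for m by (rule B.finite_borel_measure_quantize)

lemma borel_measurable_cell_ratio: "cell_ratio A B m \<in> borel_measurable borel"
  unfolding cell_ratio_def [abs_def] by measurable

lemma borel_measurable_cell_ratio_quant: "(\<lambda>x. cell_ratio A B m (quant m x)) \<in> borel_measurable A"
  using measurable_compose[OF borel_measurable_quant borel_measurable_cell_ratio] A.M_is_borel
  by (simp cong: measurable_cong_sets)

lemma integrable_cell_ratio: "integrable A (\<lambda>x. cell_ratio A B m (quant m x))"
  and integral_cell_ratio_le: "(\<integral>x. cell_ratio A B m (quant m x) \<partial>A) \<le> measure B UNIV"
proof -
  let ?a = "atom_mass (quantize m A)" and ?b = "atom_mass (quantize m B)"
  have weighted: "?a x * cell_ratio A B m x \<le> ?b x" for x by (simp add: cell_ratio_def)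
  have weighted_int: "integrable (count_space UNIV) (\<lambda>x. ?a x * cell_ratio A B m x)"
    by (rule Bochner_Integration.integrable_bound[OF quantized_B.integrable_atom_mass[of m]])
       (auto simp: cell_ratio_def)
  then show "integrable A (\<lambda>x. cell_ratio A B m (quant m x))"
    by (simp add: A.integrable_quant_iff borel_measurable_cell_ratio)
  have "(\<integral>x. cell_ratio A B m (quant m x) \<partial>A) \<le> (\<integral>x. ?b x \<partial>count_space UNIV)"
    unfolding A.integral_quant[OF borel_measurable_cell_ratio]
    using weighted_int quantized_B.integrable_atom_mass weighted by (intro integral_mono)
  also have "\<dots> \<le> measure B UNIV"
    using quantized_B.integral_atom_mass_le by (simp add: B.measure_quantize_UNIV)
  finally show "(\<integral>x. cell_ratio A B m (quant m x) \<partial>A) \<le> measure B UNIV" .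
qed

lemma integral_sqrt_mult_quantize:
  "(\<integral>x. sqrt (atom_mass (quantize m A) x * atom_mass (quantize m B) x) \<partial>count_space UNIV)
    = (\<integral>x. sqrt (cell_ratio A B m (quant m x)) \<partial>A)"
proof -
  let ?a = "atom_mass (quantize m A)" and ?b = "atom_mass (quantize m B)"
  have "sqrt (?a x * ?b x) = ?a x * sqrt (cell_ratio A B m x)" for x
    by (cases "?a x = 0") (auto simp: cell_ratio_def real_sqrt_mult real_sqrt_divide field_simps)
  then show ?thesis
    using A.integral_quant[of "\<lambda>x. sqrt (cell_ratio A B m x)" m]
    by (simp add: measurable_compose[OF borel_measurable_cell_ratio])
qed

lemma integral_sqrt_cell_ratio_le:
  assumes K: "0 < K"
  shows "(\<integral>x. sqrt (cell_ratio A B m (quant m x)) \<partial>A)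
    \<le> (\<integral>x. min (sqrt (cell_ratio A B m (quant m x))) K \<partial>A) + measure B UNIV / K"
proof -
  let ?t = "\<lambda>x. cell_ratio A B m (quant m x)"
  note [measurable] = borel_measurable_cell_ratio_quant
  have min_int: "integrable A (\<lambda>x. min (sqrt (?t x)) K)"
    by (rule A.integrable_const_bound[where B=K]) (use K cell_ratio_nonneg in auto)
  have "(\<integral>x. sqrt (?t x) \<partial>A) \<le> (\<integral>x. min (sqrt (?t x)) K + ?t x / K \<partial>A)"
    using K by (intro integral_mono' sqrt_le_min_plus_divide cell_ratio_nonneg Bochner_Integration.integrable_add
        min_int integrable_divide integrable_cell_ratio) (auto simp: cell_ratio_nonneg)
  also have "\<dots> = (\<integral>x. min (sqrt (?t x)) K \<partial>A) + (\<integral>x. ?t x \<partial>A) / K"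
    using min_int integrable_cell_ratio[of m] by simp
  also have "(\<integral>x. ?t x \<partial>A) / K \<le> measure B UNIV / K"
    using integral_cell_ratio_le[of m] K by (intro divide_right_mono) auto
  finally show ?thesis by simp
qed

lemma integral_min_sqrt_cell_ratio_tendsto_0:
  assumes disc: "discrete_law A" and atomless: "\<And>x. measure B {x} = 0" and K: "0 < K"
  shows "(\<lambda>m. \<integral>x. min (sqrt (cell_ratio A B m (quant m x))) K \<partial>A) \<longlonglongrightarrow> 0"
proof -
  note [measurable] = borel_measurable_cell_ratio_quant
  have "(\<lambda>m. \<integral>x. min (sqrt (cell_ratio A B m (quant m x))) K \<partial>A) \<longlonglongrightarrow> (\<integral>x. 0 \<partial>A)"
  proof (rule integral_dominated_convergence[where w="\<lambda>_. K"])
    show "AE x in A. (\<lambda>m. min (sqrt (cell_ratio A B m (quant m x))) K) \<longlonglongrightarrow> 0"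
      using A.AE_atom_mass_pos[OF disc]
    proof eventually_elim
      case (elim x)
      have "(\<lambda>m. cell_ratio A B m (quant m x)) \<longlonglongrightarrow> measure B {x} / measure A {x}"
        unfolding cell_ratio_def using elim
        by (intro tendsto_divide A.atom_mass_quantize_tendsto B.atom_mass_quantize_tendsto) simp
      then have "(\<lambda>m. min (sqrt (cell_ratio A B m (quant m x))) K)
          \<longlonglongrightarrow> min (sqrt (measure B {x} / measure A {x})) K"
        by (intro tendsto_min tendsto_real_sqrt tendsto_const)
      then show ?case using K by (simp add: atomless)
    qed
  qed (use K cell_ratio_nonneg in auto)
  then show ?thesis by simp
qed

lemma integral_sqrt_mult_quantize_tendsto_0:
  assumes "discrete_law A" and "\<And>x. measure B {x} = 0"
  shows "(\<lambda>m. \<integral>x. sqrt (atom_mass (quantize m A) x * atom_mass (quantize m B) x) \<partial>count_space UNIV)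
    \<longlonglongrightarrow> 0"
  unfolding integral_sqrt_mult_quantize
proof (rule order_tendstoI)
  fix e :: real assume e: "0 < e"
  define K where "K = (2 * measure B UNIV + 1) / e"
  have K: "0 < K" using e by (simp add: K_def add_nonneg_pos)
  have "2 * measure B UNIV < e * K" using e by (simp add: K_def)
  then have tail: "measure B UNIV / K < e / 2" using K by (simp add: field_simps)
  have "\<forall>\<^sub>F m in sequentially. (\<integral>x. min (sqrt (cell_ratio A B m (quant m x))) K \<partial>A) < e / 2"
    using e by (intro order_tendstoD(2)[OF integral_min_sqrt_cell_ratio_tendsto_0[OF assms K]]) simp
  then show "\<forall>\<^sub>F m in sequentially. (\<integral>x. sqrt (cell_ratio A B m (quant m x)) \<partial>A) < e"
  proof eventually_elim
    case (elim m)
    then show ?case using integral_sqrt_cell_ratio_le[OF K, of m] tail by linarith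
  qed
next
  fix e :: real assume "e < 0"
  then show "\<forall>\<^sub>F m in sequentially. e < (\<integral>x. sqrt (cell_ratio A B m (quant m x)) \<partial>A)"
    by (auto intro!: always_eventually less_le_trans[OF _ Bochner_Integration.integral_nonneg]
        simp: cell_ratio_nonneg)
qed

end

section \<open>Measures with a density\<close>

locale density_measure =
  fixes M :: "real measure" and g :: "real \<Rightarrow> real"
  assumes measurable_density [measurable]: "g \<in> borel_measurable borel"
    and nonneg_density: "\<And>x. 0 \<le> g x"
    and integrable_density: "integrable lborel g"
    and eq_density: "M = density lborel (\<lambda>x. ennreal (g x))"
begin

lemma emeasure_eq_integral:
  assumes [measurable]: "S \<in> sets borel"
  shows "emeasure M S = ennreal (\<integral>x. indicator S x * g x \<partial>lborel)"
proof -
  have "emeasure M S = (\<integral>\<^sup>+x. ennreal (indicator S x * g x) \<partial>lborel)"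
    unfolding eq_density by (subst emeasure_density) (auto intro!: nn_integral_cong simp: indicator_def)
  also have "\<dots> = ennreal (\<integral>x. indicator S x * g x \<partial>lborel)"
    using integrable_mult_indicator[OF _ integrable_density, of S] nonneg_density
    by (intro nn_integral_eq_integral) auto
  finally show ?thesis .
qed

sublocale finite_borel_measure M
proof (intro finite_borel_measure.intro finite_measureI finite_borel_measure_axioms.intro)
  show "emeasure M (space M) \<noteq> \<infinity>"
    using emeasure_eq_integral[of UNIV] by (simp add: eq_density)
qed (simp add: eq_density)

lemma measure_eq_integral: "S \<in> sets borel \<Longrightarrow> measure M S = (\<integral>x. indicator S x * g x \<partial>lborel)"
  unfolding measure_def emeasure_eq_integral
  by (intro enn2real_ennreal Bochner_Integration.integral_nonneg mult_nonneg_nonneg nonneg_density) auto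

lemma integral_density_eq: "(\<integral>x. g x \<partial>lborel) = measure M UNIV"
  using measure_eq_integral[of UNIV] by simp

lemma
  fixes f :: "real \<Rightarrow> real"
  assumes "f \<in> borel_measurable borel"
  shows integrable_iff_lborel: "integrable M f \<longleftrightarrow> integrable lborel (\<lambda>x. g x * f x)"
    and integral_eq_lborel: "(\<integral>x. f x \<partial>M) = (\<integral>x. g x * f x \<partial>lborel)"
  unfolding eq_density using assms by (simp_all add: nonneg_density integrable_real_density integral_real_density)

lemma AE_iff_lborel: "(AE x in M. P x) \<longleftrightarrow> (AE x in lborel. 0 < g x \<longrightarrow> P x)"
  unfolding eq_density by (subst AE_density) (auto simp: nonneg_density)

lemma emeasure_null_set: "N \<in> null_sets lborel \<Longrightarrow> emeasure M N = 0"
  unfolding eq_density using absolutely_continuousI_density[of "\<lambda>x. ennreal (g x)" lborel]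
  by (auto simp: absolutely_continuous_def)

lemma measure_singleton: "measure M {x} = 0"
  using emeasure_null_set[OF countable_imp_null_set_lborel, of "{x}"] by (simp add: measure_def)

lemma density_measure_affine:
  assumes t: "t \<noteq> 0"
  shows "density_measure (distr M borel (\<lambda>x. (x - c) / t)) (\<lambda>x. \<bar>t\<bar> * g (c + t * x))"
proof
  show "integrable lborel (\<lambda>x. \<bar>t\<bar> * g (c + t * x))"
    using lborel_integrable_real_affine[OF integrable_density t] by simp
  show "distr M borel (\<lambda>x. (x - c) / t) = density lborel (\<lambda>x. ennreal (\<bar>t\<bar> * g (c + t * x)))"
  proof (rule measure_eqI)
    fix S assume "S \<in> sets (distr M borel (\<lambda>x. (x - c) / t))"
    then have [measurable]: "S \<in> sets borel" by simp
    note [measurable_cong] = M_is_borel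
    have "(\<lambda>x. (x - c) / t) -` S \<in> sets borel"
      using measurable_sets[of "\<lambda>x. (x - c) / t" borel borel S] by simp
    then have "emeasure (distr M borel (\<lambda>x. (x - c) / t)) S
        = (\<integral>\<^sup>+x. ennreal (g x) * indicator ((\<lambda>x. (x - c) / t) -` S) x \<partial>lborel)"
      by (subst emeasure_distr) (simp_all add: eq_density emeasure_density)
    also have "\<dots> = (\<integral>\<^sup>+x. ennreal (g x) * indicator S ((x - c) / t) \<partial>lborel)"
      by (intro nn_integral_cong) (auto simp: indicator_def)
    also have "\<dots> = ennreal \<bar>t\<bar> * (\<integral>\<^sup>+x. ennreal (g (c + t * x)) * indicator S x \<partial>lborel)"
      using t by (subst nn_integral_real_affine[OF _ t, of _ c]) auto
    also have "\<dots> = (\<integral>\<^sup>+x. ennreal (\<bar>t\<bar> * g (c + t * x)) * indicator S x \<partial>lborel)"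
      using t by (subst nn_integral_cmult[symmetric]) (auto simp: ennreal_mult nonneg_density mult.assoc)
    also have "\<dots> = emeasure (density lborel (\<lambda>x. ennreal (\<bar>t\<bar> * g (c + t * x)))) S"
      by (subst emeasure_density) auto
    finally show "emeasure (distr M borel (\<lambda>x. (x - c) / t)) S
        = emeasure (density lborel (\<lambda>x. ennreal (\<bar>t\<bar> * g (c + t * x)))) S" .
  qed simp
qed (auto simp: nonneg_density)

end

lemma AE_lborel_if_negligible:
  assumes "negligible N" "\<And>x. x \<notin> N \<Longrightarrow> P x"
  shows "AE x in lborel. P (x::real)"
proof -
  have "AE x in lebesgue. P x"
    using assms by (intro AE_I'[of N]) (auto simp: negligible_iff_null_sets)
  then show ?thesis by (simp add: AE_completion_iff)
qed

lemma (in density_measure) cdf_has_right_derivative_AE: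
  "AE x in lborel. (cdf M has_real_derivative g x) (at_right x)"
proof -
  have "g integrable_on cbox a b" for a b
    using integrable_on_lborel[OF integrable_density] integrable_on_subcbox[of g UNIV a b] by simp
  then obtain N where N: "negligible N"
    "\<And>x e. x \<notin> N \<Longrightarrow> 0 < e \<Longrightarrow> \<exists>d>0. \<forall>h. 0 < h \<and> h < d \<longrightarrow>
       norm (integral (cbox x (x + h *\<^sub>R One)) g /\<^sub>R h ^ DIM(real) - g x) < e"
    using integrable_ccontinuous_explicit[of g] by metis
  have increment: "integral {x..y} g = cdf M y - cdf M x" if "x < y" for x y
  proof -
    have "set_integrable lborel {x..y} g"
      unfolding set_integrable_def using integrable_density by (intro integrable_mult_indicator) auto
    then have "integral {x..y} g = measure M {x..y}"
      using set_borel_integral_eq_integral(2)[of "{x..y}" g]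
      by (simp add: set_lebesgue_integral_def measure_eq_integral)
    also have "\<dots> = measure M {x<..y} + measure M {x}"
      using that by (subst finite_measure_Union[symmetric])
        (auto simp: M_is_borel intro!: arg_cong[where f="measure M"])
    finally show ?thesis using that by (simp add: cdf_diff_eq measure_singleton)
  qed
  show ?thesis
  proof (rule AE_lborel_if_negligible[OF N(1)])
    fix x assume x: "x \<notin> N"
    show "(cdf M has_real_derivative g x) (at_right x)"
      unfolding has_field_derivative_iff
    proof (rule tendstoI)
      fix e :: real assume "0 < e"
      from N(2)[OF x this] have "\<exists>d>0. \<forall>h. 0 < h \<and> h < d \<longrightarrow> \<bar>integral {x..x + h} g / h - g x\<bar> < e"
        by (simp add: divide_inverse_commute)
      then obtain d where d: "0 < d"
        "\<And>h. 0 < h \<Longrightarrow> h < d \<Longrightarrow> \<bar>integral {x..x + h} g / h - g x\<bar> < e"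
        by blast
      have "dist ((cdf M y - cdf M x) / (y - x)) (g x) < e" if "x < y" "y < x + d" for y
        using d(2)[of "y - x"] that increment[of x y] by (simp add: dist_real_def)
      then show "\<forall>\<^sub>F y in at_right x. dist ((cdf M y - cdf M x) / (y - x)) (g x) < e"
        unfolding eventually_at_right_field using d(1) by (intro exI[of _ "x + d"]) auto
    qed
  qed
qed

lemma (in density_measure) cdf_has_derivative_AE:
  "AE x in lborel. (cdf M has_real_derivative g x) (at x)"
proof -
  interpret reflected: density_measure "distr M borel uminus" "\<lambda>x. g (- x)"
    using density_measure_affine[of "-1" 0] by simp
  have cdf_reflected: "cdf (distr M borel uminus) x = measure M UNIV - cdf M (- x)" for x
  proof -
    note [measurable_cong] = M_is_borel
    have "uminus -` {..x} = {- x..}" by auto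
    then have "cdf (distr M borel uminus) x = measure M {- x..}"
      by (simp add: cdf_def measure_distr)
    also have "\<dots> = measure M (UNIV - {..- x}) + measure M {- x}"
      by (subst finite_measure_Union[symmetric])
        (auto simp: M_is_borel intro!: arg_cong[where f="measure M"])
    also have "\<dots> = measure M UNIV - cdf M (- x)"
      using finite_measure_compl[of "{..- x}"] by (simp add: M_is_borel measure_singleton cdf_def)
    finally show ?thesis .
  qed
  have "AE x in distr lborel borel uminus.
      (cdf (distr M borel uminus) has_real_derivative g (- x)) (at_right x)"
    using reflected.cdf_has_right_derivative_AE by (subst lborel_distr_uminus)
  then have reflected_derivative: "AE x in lborel.
      (cdf (distr M borel uminus) has_real_derivative g x) (at_right (- x))"
    using AE_distrD[of uminus lborel borel
        "\<lambda>x. (cdf (distr M borel uminus) has_real_derivative g (- x)) (at_right x)"] by simp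
  show ?thesis
    using cdf_has_right_derivative_AE reflected_derivative
  proof eventually_elim
    case (elim x)
    have "(cdf M (- y) - cdf M x) / (- y - x) = (cdf M x - cdf M (- y)) / (y + x)" for y
      using minus_divide_divide[of "cdf M x - cdf M (- y)" "y + x"] by simp
    then have "((\<lambda>y. (cdf M y - cdf M x) / (y - x)) \<longlongrightarrow> g x) (at_left x)"
      using elim(2) by (simp add: has_field_derivative_iff filterlim_at_left_to_right cdf_reflected)
    then show ?case
      using elim(1) by (simp add: has_field_derivative_iff filterlim_at_split)
  qed
qed

lemma DERIV_straddle:
  fixes f :: "real \<Rightarrow> real"
  assumes deriv: "(f has_real_derivative D) (at x)"
    and straddle: "\<forall>\<^sub>F n in F. u n \<le> x \<and> x \<le> v n \<and> u n < v n"
    and lim: "(u \<longlongrightarrow> x) F" "(v \<longlongrightarrow> x) F"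
  shows "((\<lambda>n. (f (v n) - f (u n)) / (v n - u n)) \<longlongrightarrow> D) F"
proof -
  from deriv obtain q where q: "\<And>z. f z - f x = q z * (z - x)" "isCont q x" "q x = D"
    unfolding CARAT_DERIV by blast
  have "((\<lambda>n. (f (v n) - f (u n)) / (v n - u n) - D) \<longlongrightarrow> 0) F"
  proof (rule tendsto_0_le[where K=1])
    have "((\<lambda>n. \<bar>q (v n) - D\<bar> + \<bar>q (u n) - D\<bar>) \<longlongrightarrow> \<bar>q x - D\<bar> + \<bar>q x - D\<bar>) F"
      using q(2) lim by (intro tendsto_intros isCont_tendsto_compose[of x q])
    then show "((\<lambda>n. \<bar>q (v n) - D\<bar> + \<bar>q (u n) - D\<bar>) \<longlongrightarrow> 0) F"
      by (simp add: q(3))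
    show "\<forall>\<^sub>F n in F. norm ((f (v n) - f (u n)) / (v n - u n) - D) \<le> norm (\<bar>q (v n) - D\<bar> + \<bar>q (u n) - D\<bar>) * 1"
      using straddle
    proof eventually_elim
      case (elim n)
      have "f (v n) - f (u n) = q (v n) * (v n - x) + q (u n) * (x - u n)"
        using q(1)[of "v n"] q(1)[of "u n"] by (simp add: algebra_simps)
      then have "(f (v n) - f (u n)) - D * (v n - u n) = (q (v n) - D) * (v n - x) + (q (u n) - D) * (x - u n)"
        by (simp add: algebra_simps)
      also have "\<bar>\<dots>\<bar> \<le> \<bar>q (v n) - D\<bar> * (v n - x) + \<bar>q (u n) - D\<bar> * (x - u n)"
        using elim by (intro order_trans[OF abs_triangle_ineq]) (simp add: abs_mult)
      also have "\<dots> \<le> \<bar>q (v n) - D\<bar> * (v n - u n) + \<bar>q (u n) - D\<bar> * (v n - u n)"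
        using elim by (intro add_mono mult_left_mono) auto
      finally have "\<bar>(f (v n) - f (u n)) - D * (v n - u n)\<bar> / (v n - u n) \<le> \<bar>q (v n) - D\<bar> + \<bar>q (u n) - D\<bar>"
        using elim by (simp add: divide_le_eq distrib_right)
      moreover have "(f (v n) - f (u n)) / (v n - u n) - D = ((f (v n) - f (u n)) - D * (v n - u n)) / (v n - u n)"
        using elim by (simp add: diff_divide_distrib)
      ultimately show ?case using elim by simp
    qed
  qed
  then show ?thesis by (rule LIM_zero_cancel)
qed

lemma quant_tendsto: "(\<lambda>m. quant m x) \<longlonglongrightarrow> x"
proof (rule LIM_zero_cancel, rule tendsto_0_le[where K=1])
  show "\<forall>\<^sub>F m in sequentially. norm (quant m x - x) \<le> norm (1 / real m) * 1"
    using abs_diff_quant_le[of _ x] by (intro eventually_sequentiallyI[of 1]) (simp add: abs_minus_commute)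
qed (rule lim_1_over_n)

context density_measure
begin

definition cell_average :: "nat \<Rightarrow> real \<Rightarrow> real" where
  "cell_average m x = real m * atom_mass (quantize m M) (quant m x)"

lemma cell_average_nonneg: "0 \<le> cell_average m x"
  by (simp add: cell_average_def)

lemma cell_average_measurable [measurable]: "cell_average m \<in> borel_measurable borel"
proof -
  interpret quantized: finite_borel_measure "quantize m M" by (rule finite_borel_measure_quantize)
  show ?thesis unfolding cell_average_def [abs_def] by measurable
qed

lemma cell_average_tendsto: "AE x in lborel. (\<lambda>m. cell_average m x) \<longlonglongrightarrow> g x"
  using cdf_has_derivative_AE
proof eventually_elim
  fix x assume deriv: "(cdf M has_real_derivative g x) (at x)"
  let ?u = "\<lambda>m. quant m x - 1 / 2 * (1 / real m)" and ?v = "\<lambda>m. quant m x + 1 / 2 * (1 / real m)"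
  have cell: "quant m -` {quant m x} = {?u m..<?v m}" if "1 \<le> m" for m
    using vimage_quant[OF that, of x] by simp
  have "?u \<longlonglongrightarrow> x - 1 / 2 * 0" "?v \<longlonglongrightarrow> x + 1 / 2 * 0"
    by (intro tendsto_intros quant_tendsto lim_1_over_n)+
  then have "(\<lambda>m. (cdf M (?v m) - cdf M (?u m)) / (?v m - ?u m)) \<longlonglongrightarrow> g x"
  proof (intro DERIV_straddle[OF deriv] eventually_sequentiallyI[of 1])
    fix m :: nat assume m: "1 \<le> m"
    have "x \<in> quant m -` {quant m x}" by simp
    then show "?u m \<le> x \<and> x \<le> ?v m \<and> ?u m < ?v m"
      unfolding cell[OF m] using m by simp
  qed simp_all
  moreover have "\<forall>\<^sub>F m in sequentially. (cdf M (?v m) - cdf M (?u m)) / (?v m - ?u m) = cell_average m x"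
  proof (rule eventually_sequentiallyI[of 1])
    fix m :: nat assume m: "1 \<le> m"
    then have uv: "?u m < ?v m" by simp
    have "cdf M (?v m) - cdf M (?u m) = measure M {?u m<..?v m}"
      using uv by (rule cdf_diff_eq)
    also have "\<dots> = measure M {?u m<..<?v m} + measure M {?v m}"
      using uv by (subst finite_measure_Union[symmetric])
        (auto simp: M_is_borel intro!: arg_cong[where f="measure M"])
    also have "\<dots> = measure M {?u m<..<?v m} + measure M {?u m}"
      by (simp add: measure_singleton)
    also have "\<dots> = measure M {?u m..<?v m}"
      using uv by (subst finite_measure_Union[symmetric])
        (auto simp: M_is_borel intro!: arg_cong[where f="measure M"])
    finally have "cdf M (?v m) - cdf M (?u m) = atom_mass (quantize m M) (quant m x)"
      unfolding cell[OF m, symmetric] by (simp add: measure_quantize M_is_borel)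
    then show "(cdf M (?v m) - cdf M (?u m)) / (?v m - ?u m) = cell_average m x"
      using m by (simp add: cell_average_def)
  qed
  ultimately show "(\<lambda>m. cell_average m x) \<longlonglongrightarrow> g x"
    by (rule Lim_transform_eventually)
qed

end

section \<open>Quantized entropy of measures with a density\<close>

text \<open>In the proof of the limit theorem, entropies are compared with a reference density whose logarithm
  is Lipschitz, so that rounding its argument to the quantization grid is harmless.\<close>

definition log_lipschitz :: "(real \<Rightarrow> real) \<Rightarrow> bool" where
  "log_lipschitz r \<longleftrightarrow> (\<forall>x. 0 < r x) \<and> (\<forall>x y. r x \<le> exp \<bar>x - y\<bar> * r y)"

lemma log_lipschitz_pos: "log_lipschitz r \<Longrightarrow> 0 < r x"
  by (simp add: log_lipschitz_def)

lemma log_lipschitz_ln: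
  assumes r: "log_lipschitz r"
  shows "\<bar>ln (r x) - ln (r y)\<bar> \<le> \<bar>x - y\<bar>"
proof -
  have "ln (r x) \<le> \<bar>x - y\<bar> + ln (r y)" for x y
  proof -
    have "ln (r x) \<le> ln (exp \<bar>x - y\<bar> * r y)"
      using r by (intro ln_mono) (auto simp: log_lipschitz_def)
    also have "\<dots> = \<bar>x - y\<bar> + ln (r y)"
      using log_lipschitz_pos[OF r, of y] by (simp add: ln_mult)
    finally show ?thesis .
  qed
  from this[of x y] this[of y x] show ?thesis by linarith
qed

lemma
  assumes r: "log_lipschitz r" and m: "1 \<le> m"
  shows log_lipschitz_quant_le: "r (quant m x) \<le> exp (1 / real m) * r x"
    and log_lipschitz_quant_ge: "exp (- (1 / real m)) * r x \<le> r (quant m x)"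
    and log_lipschitz_ln_quant: "\<bar>ln (r (quant m x)) - ln (r x)\<bar> \<le> 1 / real m"
proof -
  have dist: "\<bar>quant m x - x\<bar> \<le> 1 / real m" "\<bar>x - quant m x\<bar> \<le> 1 / real m"
    using abs_diff_quant_le[OF m, of x] by (simp_all add: abs_minus_commute)
  have "r y \<le> exp (1 / real m) * r z" if "\<bar>y - z\<bar> \<le> 1 / real m" for y z
  proof -
    have "r y \<le> exp \<bar>y - z\<bar> * r z"
      using r by (simp add: log_lipschitz_def)
    also have "\<dots> \<le> exp (1 / real m) * r z"
      using that log_lipschitz_pos[OF r, of z] by (intro mult_right_mono) auto
    finally show ?thesis .
  qed
  from this[OF dist(1)] this[OF dist(2)]
  show "r (quant m x) \<le> exp (1 / real m) * r x" "exp (- (1 / real m)) * r x \<le> r (quant m x)"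
    by (simp_all add: exp_minus field_simps)
  show "\<bar>ln (r (quant m x)) - ln (r x)\<bar> \<le> 1 / real m"
    using log_lipschitz_ln[OF r] dist(1) by (rule order_trans)
qed

lemma exp_inverse_mult_tendsto:
  "(\<lambda>m. exp (1 / real m) * c) \<longlonglongrightarrow> c" "(\<lambda>m. exp (- (1 / real m)) * c) \<longlonglongrightarrow> c"
  using tendsto_mult_right[OF tendsto_exp[OF lim_1_over_n], of c]
    tendsto_mult_right[OF tendsto_exp[OF tendsto_minus[OF lim_1_over_n]], of c] by simp_all

lemma log_lipschitz_quant_tendsto:
  assumes r: "log_lipschitz r"
  shows "(\<lambda>m. r (quant m x)) \<longlonglongrightarrow> r x"
proof (rule tendsto_sandwich[OF _ _ exp_inverse_mult_tendsto(2,1)])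
  show "\<forall>\<^sub>F m in sequentially. exp (- (1 / real m)) * r x \<le> r (quant m x)"
    using log_lipschitz_quant_ge[OF r] by (rule eventually_sequentiallyI)
  show "\<forall>\<^sub>F m in sequentially. r (quant m x) \<le> exp (1 / real m) * r x"
    using log_lipschitz_quant_le[OF r] by (rule eventually_sequentiallyI)
qed

lemma
  assumes r: "log_lipschitz r" "integrable lborel r"
  shows integrable_log_lipschitz_quant: "1 \<le> m \<Longrightarrow> integrable lborel (\<lambda>x. r (quant m x))"
    and integral_log_lipschitz_quant_tendsto:
      "(\<lambda>m. \<integral>x. r (quant m x) \<partial>lborel) \<longlonglongrightarrow> (\<integral>x. r x \<partial>lborel)"
proof -
  note [measurable] = borel_measurable_integrable[OF r(2)]
  note r_nonneg = log_lipschitz_pos[OF r(1), THEN less_imp_le]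
  show quant_int: "integrable lborel (\<lambda>x. r (quant m x))" if "1 \<le> m" for m
    by (rule Bochner_Integration.integrable_bound[OF integrable_mult_right[OF r(2), of "exp (1 / real m)"]])
       (use log_lipschitz_quant_le[OF r(1) that] r_nonneg in auto)
  have integral_le: "(\<integral>x. r (quant m x) \<partial>lborel) \<le> exp (1 / real m) * (\<integral>x. r x \<partial>lborel)"
    and integral_ge: "exp (- (1 / real m)) * (\<integral>x. r x \<partial>lborel) \<le> (\<integral>x. r (quant m x) \<partial>lborel)"
    if m: "1 \<le> m" for m
    unfolding integral_mult_right_zero[symmetric]
    by (intro integral_mono quant_int m integrable_mult_right r
        log_lipschitz_quant_le[OF r(1) m] log_lipschitz_quant_ge[OF r(1) m])+
  show "(\<lambda>m. \<integral>x. r (quant m x) \<partial>lborel) \<longlonglongrightarrow> (\<integral>x. r x \<partial>lborel)"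
  proof (rule tendsto_sandwich[OF _ _ exp_inverse_mult_tendsto(2,1)])
    show "\<forall>\<^sub>F m in sequentially. exp (- (1 / real m)) * (\<integral>x. r x \<partial>lborel) \<le> (\<integral>x. r (quant m x) \<partial>lborel)"
      using integral_ge by (rule eventually_sequentiallyI)
    show "\<forall>\<^sub>F m in sequentially. (\<integral>x. r (quant m x) \<partial>lborel) \<le> exp (1 / real m) * (\<integral>x. r x \<partial>lborel)"
      using integral_le by (rule eventually_sequentiallyI)
  qed
qed

lemma (in finite_borel_measure)
  assumes r: "log_lipschitz r" "r \<in> borel_measurable borel" "integrable M (\<lambda>x. ln (r x))"
  shows integrable_ln_log_lipschitz_quant: "1 \<le> m \<Longrightarrow> integrable M (\<lambda>x. ln (r (quant m x)))"
    and integral_ln_log_lipschitz_quant_tendsto: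
      "(\<lambda>m. \<integral>x. ln (r (quant m x)) \<partial>M) \<longlonglongrightarrow> (\<integral>x. ln (r x) \<partial>M)"
proof -
  note [measurable] = r(2)
  note [measurable_cong] = M_is_borel
  have diff_int: "integrable M (\<lambda>x. ln (r (quant m x)) - ln (r x))" if "1 \<le> m" for m
    by (rule integrable_const_bound[where B="1 / real m"])
       (use log_lipschitz_ln_quant[OF r(1) that] in auto)
  then show quant_int: "integrable M (\<lambda>x. ln (r (quant m x)))" if "1 \<le> m" for m
    using Bochner_Integration.integrable_add[OF diff_int[OF that] r(3)] by simp
  have diff_le: "\<bar>(\<integral>x. ln (r (quant m x)) \<partial>M) - (\<integral>x. ln (r x) \<partial>M)\<bar> \<le> measure M UNIV * (1 / real m)"
    if m: "1 \<le> m" for m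
  proof -
    have "\<bar>\<integral>x. ln (r (quant m x)) - ln (r x) \<partial>M\<bar> \<le> (\<integral>x. \<bar>ln (r (quant m x)) - ln (r x)\<bar> \<partial>M)"
      by (rule integral_abs_bound)
    also have "\<dots> \<le> (\<integral>x. 1 / real m \<partial>M)"
      using diff_int[OF m] log_lipschitz_ln_quant[OF r(1) m] by (intro integral_mono) auto
    finally show ?thesis
      using quant_int[OF m] r(3) by simp
  qed
  show "(\<lambda>m. \<integral>x. ln (r (quant m x)) \<partial>M) \<longlonglongrightarrow> (\<integral>x. ln (r x) \<partial>M)"
  proof (rule LIM_zero_cancel, rule tendsto_0_le[where K="measure M UNIV"])
    show "\<forall>\<^sub>F m in sequentially. norm ((\<integral>x. ln (r (quant m x)) \<partial>M) - (\<integral>x. ln (r x) \<partial>M))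
        \<le> norm (1 / real m) * measure M UNIV"
      using diff_le by (intro eventually_sequentiallyI[of 1]) (simp add: mult.commute)
  qed (rule lim_1_over_n)
qed

lemma nn_integral_laplace_kernel_le: "(\<integral>\<^sup>+x. ennreal (exp (- \<bar>x - y\<bar>)) \<partial>lborel) \<le> 2" for y :: real
proof -
  let ?density = "exponential_density 1"
  have half: "(\<integral>\<^sup>+x. ennreal (?density x) \<partial>lborel) = 1"
    using prob_space.emeasure_space_1[OF prob_space_exponential_density[of 1]] by (simp add: emeasure_density)
  have "(\<integral>\<^sup>+x. ennreal (exp (- \<bar>x - y\<bar>)) \<partial>lborel) = (\<integral>\<^sup>+x. ennreal (exp (- \<bar>x\<bar>)) \<partial>lborel)"
    by (subst nn_integral_real_affine[of _ 1 y]) auto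
  also have "\<dots> \<le> (\<integral>\<^sup>+x. ennreal (?density x) + ennreal (?density (- x)) \<partial>lborel)"
    by (intro nn_integral_mono) (auto simp: exponential_density_def simp flip: ennreal_plus)
  also have "\<dots> = (\<integral>\<^sup>+x. ennreal (?density x) \<partial>lborel) + (\<integral>\<^sup>+x. ennreal (?density (- x)) \<partial>lborel)"
    by (rule nn_integral_add) auto
  also have "(\<integral>\<^sup>+x. ennreal (?density (- x)) \<partial>lborel) = (\<integral>\<^sup>+x. ennreal (?density x) \<partial>lborel)"
    by (subst nn_integral_real_affine[of _ "-1" 0]) auto
  finally show ?thesis by (simp add: half one_add_one)
qed

context finite_borel_measure
begin

definition laplace_smoothing :: "real \<Rightarrow> real" where
  "laplace_smoothing x = (\<integral>y. exp (- \<bar>x - y\<bar>) \<partial>M)"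

lemma integrable_laplace_kernel: "integrable M (\<lambda>y. exp (- \<bar>x - y\<bar>))"
  by (rule integrable_const_bound[where B=1]) (auto simp: M_is_borel cong: measurable_cong_sets)

lemma borel_measurable_laplace_smoothing [measurable]: "laplace_smoothing \<in> borel_measurable borel"
proof -
  note [measurable_cong] = M_is_borel
  show ?thesis unfolding laplace_smoothing_def [abs_def] by measurable
qed

lemma laplace_smoothing_nonneg: "0 \<le> laplace_smoothing x"
  unfolding laplace_smoothing_def by (intro Bochner_Integration.integral_nonneg) auto

lemma laplace_smoothing_le: "laplace_smoothing x \<le> measure M UNIV"
proof -
  have "laplace_smoothing x \<le> (\<integral>y. 1 \<partial>M)"
    unfolding laplace_smoothing_def by (intro integral_mono integrable_laplace_kernel) auto
  then show ?thesis by simp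
qed

lemma log_lipschitz_laplace_smoothing:
  assumes "0 < measure M UNIV"
  shows "log_lipschitz laplace_smoothing"
  unfolding log_lipschitz_def
proof (intro conjI allI)
  fix x
  have "laplace_smoothing x \<noteq> 0"
  proof
    assume "laplace_smoothing x = 0"
    then have "AE y in M. exp (- \<bar>x - y\<bar>) = 0"
      unfolding laplace_smoothing_def
      using integral_nonneg_eq_0_iff_AE[OF integrable_laplace_kernel[of x]] by auto
    then have "emeasure M UNIV = 0"
      by (auto simp: AE_iff_null null_sets_def M_is_borel)
    then show False using assms by (simp add: measure_def)
  qed
  then show "0 < laplace_smoothing x"
    using laplace_smoothing_nonneg[of x] by simp
  fix z
  have "laplace_smoothing x \<le> (\<integral>y. exp \<bar>x - z\<bar> * exp (- \<bar>z - y\<bar>) \<partial>M)"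
    unfolding laplace_smoothing_def
    by (intro integral_mono integrable_laplace_kernel integrable_mult_right) (auto simp flip: exp_add)
  then show "laplace_smoothing x \<le> exp \<bar>x - z\<bar> * laplace_smoothing z"
    by (simp add: laplace_smoothing_def)
qed

lemma integrable_laplace_smoothing: "integrable lborel laplace_smoothing"
proof (rule integrableI_nonneg)
  interpret pair_sigma_finite lborel M ..
  note [measurable_cong] = M_is_borel
  have "(\<integral>\<^sup>+x. ennreal (laplace_smoothing x) \<partial>lborel) = (\<integral>\<^sup>+x. \<integral>\<^sup>+y. ennreal (exp (- \<bar>x - y\<bar>)) \<partial>M \<partial>lborel)"
    unfolding laplace_smoothing_def
    by (intro nn_integral_cong nn_integral_eq_integral[symmetric] integrable_laplace_kernel) auto
  also have "\<dots> = (\<integral>\<^sup>+y. \<integral>\<^sup>+x. ennreal (exp (- \<bar>x - y\<bar>)) \<partial>lborel \<partial>M)"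
    by (rule Fubini'[symmetric]) measurable
  also have "\<dots> \<le> (\<integral>\<^sup>+y. 2 \<partial>M)"
    by (intro nn_integral_mono nn_integral_laplace_kernel_le)
  also have "\<dots> < \<infinity>"
    by (simp add: emeasure_eq_measure ennreal_mult_less_top)
  finally show "(\<integral>\<^sup>+x. ennreal (laplace_smoothing x) \<partial>lborel) < \<infinity>" .
qed (auto simp: laplace_smoothing_nonneg)

lemma laplace_smoothing_ge: "exp (- 1) * atom_mass (quantize 1 M) (quant 1 x) \<le> laplace_smoothing x"
proof -
  let ?cell = "quant 1 -` {quant 1 x}"
  have "exp (- 1) * atom_mass (quantize 1 M) (quant 1 x) = (\<integral>y. exp (- 1) * indicator ?cell y \<partial>M)"
    by (simp add: measure_quantize M_is_borel)
  also have "\<dots> \<le> laplace_smoothing x"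
    unfolding laplace_smoothing_def
  proof (intro integral_mono integrable_laplace_kernel)
    fix y show "exp (- 1) * indicator ?cell y \<le> exp (- \<bar>x - y\<bar>)"
      using abs_diff_le_if_quant_eq[of 1 x y] by (auto simp: indicator_def)
  qed (auto simp: M_is_borel emeasure_eq_measure)
  finally show ?thesis .
qed

lemma integrable_ln_laplace_smoothing:
  assumes "0 < measure M UNIV" and fin: "finite_atomic_entropy (quantize 1 M)"
  shows "integrable M (\<lambda>x. ln (laplace_smoothing x))"
proof (rule Bochner_Integration.integrable_bound)
  let ?cell_mass = "\<lambda>x. atom_mass (quantize 1 M) (quant 1 x)"
  let ?bound = "\<lambda>x. 1 + \<bar>ln (?cell_mass x)\<bar> + \<bar>ln (measure M UNIV)\<bar>"
  show "integrable M ?bound"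
    using fin by (simp add: finite_atomic_entropy_quantize_iff)
  show "AE x in M. norm (ln (laplace_smoothing x)) \<le> norm (?bound x)"
    using AE_atom_mass_quantize_pos[of 1]
  proof eventually_elim
    case (elim x)
    have "ln (exp (- 1) * ?cell_mass x) \<le> ln (laplace_smoothing x)"
      using laplace_smoothing_ge[of x] elim by (intro ln_mono) auto
    then have "ln (?cell_mass x) - 1 \<le> ln (laplace_smoothing x)"
      using elim by (simp add: ln_mult)
    moreover have "ln (laplace_smoothing x) \<le> ln (measure M UNIV)"
      using log_lipschitz_pos[OF log_lipschitz_laplace_smoothing[OF assms(1)], of x] laplace_smoothing_le[of x]
      by (intro ln_mono) auto
    ultimately show ?case unfolding real_norm_def by linarith
  qed
qed (simp add: M_is_borel cong: measurable_cong_sets)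

end

definition divergence_term :: "real \<Rightarrow> real \<Rightarrow> real" where
  "divergence_term t u = u - t - t * ln u - eta t"

lemma divergence_term_nonneg: "0 \<le> t \<Longrightarrow> 0 < u \<Longrightarrow> 0 \<le> divergence_term t u"
  using eta_le_cross_entropy[of t u] by (simp add: divergence_term_def)

lemma divergence_term_tendsto:
  assumes "(t \<longlongrightarrow> t0) F" "(u \<longlongrightarrow> u0) F" "0 < u0"
  shows "((\<lambda>n. divergence_term (t n) (u n)) \<longlongrightarrow> divergence_term t0 u0) F"
  unfolding divergence_term_def using assms
  by (intro tendsto_intros isCont_tendsto_compose[OF isCont_eta]) auto

lemma
  assumes "entropic N f" "integrable N u" "integrable N (\<lambda>x. f x * ln (u x))"
  shows integrable_divergence_term: "integrable N (\<lambda>x. divergence_term (f x) (u x))"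
    and integral_divergence_term: "(\<integral>x. divergence_term (f x) (u x) \<partial>N)
      = (\<integral>x. u x \<partial>N) - (\<integral>x. f x \<partial>N) - (\<integral>x. f x * ln (u x) \<partial>N) - shannon_entropy N f"
  using assms by (auto simp: divergence_term_def shannon_entropy_def entropicD)

lemma eventually_less_integral_if_AE_tendsto:
  fixes f :: "nat \<Rightarrow> 'a \<Rightarrow> real"
  assumes f: "\<And>n. integrable N (f n)" "\<And>n x. 0 \<le> f n x"
    and g: "integrable N g" "\<And>x. 0 \<le> g x"
    and lim: "AE x in N. (\<lambda>n. f n x) \<longlonglongrightarrow> g x" and a: "a < (\<integral>x. g x \<partial>N)"
  shows "\<forall>\<^sub>F n in sequentially. a < (\<integral>x. f n x \<partial>N)"
proof (cases "a < 0")
  case True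
  then show ?thesis
    using f(2) by (intro always_eventually allI) (auto intro!: less_le_trans[of a 0] Bochner_Integration.integral_nonneg)
next
  case False
  have "ennreal a < ennreal (\<integral>x. g x \<partial>N)"
    using False a by (simp add: ennreal_less_iff)
  also have "\<dots> = (\<integral>\<^sup>+x. ennreal (g x) \<partial>N)"
    using g by (intro nn_integral_eq_integral[symmetric]) auto
  also have "\<dots> = (\<integral>\<^sup>+x. liminf (\<lambda>n. ennreal (f n x)) \<partial>N)"
    using lim by (intro nn_integral_cong_AE) (auto elim!: eventually_mono intro!: lim_imp_Liminf[symmetric])
  also have "\<dots> \<le> liminf (\<lambda>n. \<integral>\<^sup>+x. ennreal (f n x) \<partial>N)"
    using f(1) by (intro nn_integral_liminf) auto
  also have "\<dots> = liminf (\<lambda>n. ennreal (\<integral>x. f n x \<partial>N))"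
    using f by (simp add: nn_integral_eq_integral)
  finally have "\<forall>\<^sub>F n in sequentially. ennreal a < ennreal (\<integral>x. f n x \<partial>N)"
    by (rule less_LiminfD)
  then show ?thesis
    using False by (simp add: ennreal_less_iff)
qed

context density_measure
begin

lemma
  fixes f :: "real \<Rightarrow> real"
  assumes m: "1 \<le> m" and [measurable]: "f \<in> borel_measurable borel"
  shows integrable_cell_average_mult_iff:
      "integrable lborel (\<lambda>x. cell_average m x * f (quant m x)) \<longleftrightarrow> integrable M (\<lambda>x. f (quant m x))"
    and integral_cell_average_mult:
      "(\<integral>x. cell_average m x * f (quant m x) \<partial>lborel) = (\<integral>x. f (quant m x) \<partial>M)"
proof -
  interpret quantized: finite_borel_measure "quantize m M" by (rule finite_borel_measure_quantize)
  let ?h = "\<lambda>x. real m * atom_mass (quantize m M) x * f x"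
  let ?w = "\<lambda>x. indicator (range (quant m)) x / real m"
  have w_h: "?w x * ?h x = atom_mass (quantize m M) x * f x" for x
  proof (cases "x \<in> range (quant m)")
    case False
    then have "quant m -` {x} = {}" by auto
    then show ?thesis using False by (simp add: measure_quantize M_is_borel)
  qed (use m in simp)
  have h: "?h \<in> borel_measurable borel" by measurable
  note lborel_discrete = sets_quantize discrete_law_quantize[OF sets_lborel] emeasure_quantize_lborel_singleton[OF m] _ h
  show "integrable lborel (\<lambda>x. cell_average m x * f (quant m x)) \<longleftrightarrow> integrable M (\<lambda>x. f (quant m x))"
    using integrable_discrete_law_iff[OF lborel_discrete, unfolded w_h] integrable_quantize_iff[OF sets_lborel h, of m]
      integrable_quant_iff[of f m]
    by (simp add: cell_average_def)
  show "(\<integral>x. cell_average m x * f (quant m x) \<partial>lborel) = (\<integral>x. f (quant m x) \<partial>M)"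
    using integral_discrete_law[OF lborel_discrete, unfolded w_h] integral_quantize[OF sets_lborel h, of m]
      integral_quant[of f m]
    by (simp add: cell_average_def)
qed

lemma
  assumes m: "1 \<le> m"
  shows integrable_cell_average: "integrable lborel (cell_average m)"
    and integral_cell_average: "(\<integral>x. cell_average m x \<partial>lborel) = measure M UNIV"
  using integrable_cell_average_mult_iff[OF m, of "\<lambda>_. 1"] integral_cell_average_mult[OF m, of "\<lambda>_. 1"]
  by simp_all

lemma AE_ln_cell_average:
  assumes "1 \<le> m"
  shows "AE x in M. ln (cell_average m x) = ln (real m) + ln (atom_mass (quantize m M) (quant m x))"
  using AE_atom_mass_quantize_pos[of m]
  by eventually_elim (use assms in \<open>simp add: cell_average_def ln_mult\<close>)

lemma
  assumes m: "1 \<le> m"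
  shows integrable_ln_cell_average_iff:
      "integrable M (\<lambda>x. ln (cell_average m x)) \<longleftrightarrow> finite_atomic_entropy (quantize m M)"
    and integral_ln_cell_average:
      "finite_atomic_entropy (quantize m M) \<Longrightarrow>
        (\<integral>x. ln (cell_average m x) \<partial>M) = measure M UNIV * ln (real m) - atomic_entropy (quantize m M)"
proof -
  interpret quantized: finite_borel_measure "quantize m M" by (rule finite_borel_measure_quantize)
  note [measurable_cong] = M_is_borel
  let ?ln_mass = "\<lambda>x. ln (atom_mass (quantize m M) (quant m x))"
  have "integrable M (\<lambda>x. ln (cell_average m x)) \<longleftrightarrow> integrable M (\<lambda>x. ln (real m) + ?ln_mass x)"
    using AE_ln_cell_average[OF m] by (intro integrable_cong_AE) auto
  then show "integrable M (\<lambda>x. ln (cell_average m x)) \<longleftrightarrow> finite_atomic_entropy (quantize m M)"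
    unfolding finite_atomic_entropy_quantize_iff
    by (auto dest: Bochner_Integration.integrable_diff[OF _ integrable_const[of "ln (real m)"]])
  assume "finite_atomic_entropy (quantize m M)"
  then have "integrable M ?ln_mass"
    by (simp add: finite_atomic_entropy_quantize_iff)
  moreover have "(\<integral>x. ln (cell_average m x) \<partial>M) = (\<integral>x. ln (real m) + ?ln_mass x \<partial>M)"
    using AE_ln_cell_average[OF m] by (intro integral_cong_AE) auto
  ultimately show "(\<integral>x. ln (cell_average m x) \<partial>M) = measure M UNIV * ln (real m) - atomic_entropy (quantize m M)"
    by (simp add: atomic_entropy_quantize)
qed

lemma
  assumes m: "1 \<le> m"
  shows entropic_cell_average_iff:
      "entropic lborel (cell_average m) \<longleftrightarrow> finite_atomic_entropy (quantize m M)"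
    and shannon_entropy_cell_average:
      "finite_atomic_entropy (quantize m M) \<Longrightarrow>
        shannon_entropy lborel (cell_average m) = atomic_entropy (quantize m M) - measure M UNIV * ln (real m)"
proof -
  interpret quantized: finite_borel_measure "quantize m M" by (rule finite_borel_measure_quantize)
  let ?f = "\<lambda>x. ln (real m * atom_mass (quantize m M) x)"
  have f: "?f \<in> borel_measurable borel" by measurable
  have f_eq: "?f (quant m x) = ln (cell_average m x)" for x
    by (simp add: cell_average_def)
  show "entropic lborel (cell_average m) \<longleftrightarrow> finite_atomic_entropy (quantize m M)"
    using integrable_cell_average_mult_iff[OF m f, unfolded f_eq] integrable_ln_cell_average_iff[OF m]
    by (simp add: entropic_def cell_average_nonneg integrable_cell_average[OF m] eta_def)
  show "shannon_entropy lborel (cell_average m) = atomic_entropy (quantize m M) - measure M UNIV * ln (real m)"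
    if "finite_atomic_entropy (quantize m M)"
    using integral_cell_average_mult[OF m f, unfolded f_eq] integral_ln_cell_average[OF m that]
    by (simp add: shannon_entropy_def eta_def)
qed

lemma shannon_entropy_le_cell_average:
  assumes g: "entropic lborel g" and m: "1 \<le> m" and fin: "finite_atomic_entropy (quantize m M)"
  shows "shannon_entropy lborel g \<le> shannon_entropy lborel (cell_average m)"
proof -
  have ln_average: "(\<lambda>x. ln (cell_average m x)) \<in> borel_measurable borel" by measurable
  have "AE x in lborel. 0 < g x \<longrightarrow> 0 < cell_average m x"
    using AE_atom_mass_quantize_pos[of m] unfolding AE_iff_lborel
    by eventually_elim (use m in \<open>simp add: cell_average_def\<close>)
  moreover have "integrable lborel (\<lambda>x. g x * ln (cell_average m x))"
    using fin integrable_ln_cell_average_iff[OF m] integrable_iff_lborel[OF ln_average] by simp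
  ultimately have "shannon_entropy lborel g \<le> (\<integral>x. cell_average m x \<partial>lborel) - (\<integral>x. g x \<partial>lborel)
      - (\<integral>x. g x * ln (cell_average m x) \<partial>lborel)"
    by (intro shannon_entropy_le_cross_entropy g integrable_cell_average m cell_average_nonneg)
  also have "\<dots> = shannon_entropy lborel (cell_average m)"
    using integral_ln_cell_average[OF m fin] integral_eq_lborel[OF ln_average] shannon_entropy_cell_average[OF m fin]
    by (simp add: integral_cell_average[OF m] integral_density_eq)
  finally show ?thesis .
qed

lemma finite_atomic_entropy_quantize:
  assumes r: "log_lipschitz r" "integrable lborel r" "integrable M (\<lambda>x. ln (r x))" and m: "1 \<le> m"
  shows "finite_atomic_entropy (quantize m M)"
proof -
  have r_measurable [measurable]: "r \<in> borel_measurable borel" using r(2) by auto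
  let ?avg = "cell_average m"
  define L where "L = \<bar>ln (real m * measure M UNIV)\<bar>"
  let ?bound = "\<lambda>x. r (quant m x) + ?avg x + \<bar>?avg x * ln (r (quant m x))\<bar> + L * ?avg x"
  have "integrable lborel (\<lambda>x. ?avg x * ln (r (quant m x)))"
    using integrable_ln_log_lipschitz_quant[OF r(1) r_measurable r(3) m]
    by (subst integrable_cell_average_mult_iff[OF m]) auto
  then have bound_int: "integrable lborel ?bound"
    using integrable_log_lipschitz_quant[OF r(1,2) m] integrable_cell_average[OF m] by auto
  have "\<bar>eta (?avg x)\<bar> \<le> ?bound x" for x
  proof -
    note avg_nonneg = cell_average_nonneg[of m x] and r_pos = log_lipschitz_pos[OF r(1), of "quant m x"]
    have "eta (?avg x) \<le> r (quant m x) - ?avg x - ?avg x * ln (r (quant m x))"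
      using avg_nonneg r_pos by (rule eta_le_cross_entropy)
    moreover have "- eta (?avg x) \<le> L * ?avg x"
    proof (cases "?avg x = 0")
      case False
      have "?avg x \<le> real m * measure M UNIV"
        unfolding cell_average_def by (intro mult_left_mono atom_mass_quantize_le) simp
      then have "ln (?avg x) \<le> L"
        using False avg_nonneg unfolding L_def by (intro order_trans[OF ln_mono abs_ge_self]) auto
      then show ?thesis
        using avg_nonneg mult_left_mono[of "ln (?avg x)" L "?avg x"] by (simp add: eta_def mult.commute)
    qed simp
    moreover have "0 \<le> L * ?avg x" using avg_nonneg by (simp add: L_def)
    ultimately show ?thesis using avg_nonneg r_pos by linarith
  qed
  then have "integrable lborel (\<lambda>x. eta (?avg x))"
    by (intro Bochner_Integration.integrable_bound[OF bound_int]) (auto intro: order_trans[OF _ abs_ge_self])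
  then have "entropic lborel ?avg"
    by (simp add: entropic_def cell_average_nonneg integrable_cell_average[OF m])
  then show ?thesis by (simp add: entropic_cell_average_iff[OF m])
qed

lemma
  assumes r: "log_lipschitz r" "integrable lborel r" "integrable M (\<lambda>x. ln (r x))" and m: "1 \<le> m"
  shows integrable_divergence_cell_average:
      "integrable lborel (\<lambda>x. divergence_term (cell_average m x) (r (quant m x)))"
    and integral_divergence_cell_average:
      "(\<integral>x. divergence_term (cell_average m x) (r (quant m x)) \<partial>lborel)
        = (\<integral>x. r (quant m x) \<partial>lborel) - measure M UNIV - (\<integral>x. ln (r (quant m x)) \<partial>M)
          - shannon_entropy lborel (cell_average m)"
proof -
  have r_measurable [measurable]: "r \<in> borel_measurable borel" using r(2) by auto
  have ln_r: "(\<lambda>x. ln (r x)) \<in> borel_measurable borel" by measurable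
  have average: "entropic lborel (cell_average m)"
    using finite_atomic_entropy_quantize[OF r m] entropic_cell_average_iff[OF m] by simp
  have average_ln: "integrable lborel (\<lambda>x. cell_average m x * ln (r (quant m x)))"
    "(\<integral>x. cell_average m x * ln (r (quant m x)) \<partial>lborel) = (\<integral>x. ln (r (quant m x)) \<partial>M)"
    using integrable_ln_log_lipschitz_quant[OF r(1) r_measurable r(3) m]
      integrable_cell_average_mult_iff[OF m ln_r] integral_cell_average_mult[OF m ln_r] by simp_all
  note divergence = average integrable_log_lipschitz_quant[OF r(1,2) m] average_ln(1)
  show "integrable lborel (\<lambda>x. divergence_term (cell_average m x) (r (quant m x)))"
    using divergence by (rule integrable_divergence_term)
  show "(\<integral>x. divergence_term (cell_average m x) (r (quant m x)) \<partial>lborel)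
      = (\<integral>x. r (quant m x) \<partial>lborel) - measure M UNIV - (\<integral>x. ln (r (quant m x)) \<partial>M)
        - shannon_entropy lborel (cell_average m)"
    using integral_divergence_term[OF divergence] by (simp add: average_ln(2) integral_cell_average[OF m])
qed

lemma
  assumes g: "entropic lborel g" and r: "integrable lborel r" "integrable M (\<lambda>x. ln (r x))"
  shows integrable_divergence_density: "integrable lborel (\<lambda>x. divergence_term (g x) (r x))"
    and integral_divergence_density:
      "(\<integral>x. divergence_term (g x) (r x) \<partial>lborel)
        = (\<integral>x. r x \<partial>lborel) - measure M UNIV - (\<integral>x. ln (r x) \<partial>M) - shannon_entropy lborel g"
proof -
  have [measurable]: "r \<in> borel_measurable borel" using r(1) by auto
  have ln_r: "(\<lambda>x. ln (r x)) \<in> borel_measurable borel" by measurable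
  have g_ln_r: "integrable lborel (\<lambda>x. g x * ln (r x))"
    using r(2) integrable_iff_lborel[OF ln_r] by simp
  show "integrable lborel (\<lambda>x. divergence_term (g x) (r x))"
    using g r(1) g_ln_r by (rule integrable_divergence_term)
  show "(\<integral>x. divergence_term (g x) (r x) \<partial>lborel)
      = (\<integral>x. r x \<partial>lborel) - measure M UNIV - (\<integral>x. ln (r x) \<partial>M) - shannon_entropy lborel g"
    using integral_divergence_term[OF g r(1) g_ln_r] integral_eq_lborel[OF ln_r] by (simp add: integral_density_eq)
qed

text \<open>Fatou's lemma is applied to the relative entropies of the cell averages with respect to the rounded
  reference density.\<close>

lemma eventually_shannon_entropy_cell_average_less:
  assumes g: "entropic lborel g" and r: "log_lipschitz r" "integrable lborel r" "integrable M (\<lambda>x. ln (r x))"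
    and e: "0 < e"
  shows "\<forall>\<^sub>F m in sequentially. shannon_entropy lborel (cell_average m) < shannon_entropy lborel g + e"
proof -
  let ?cross = "\<lambda>m. (\<integral>x. r (quant m x) \<partial>lborel) - measure M UNIV - (\<integral>x. ln (r (quant m x)) \<partial>M)"
  let ?cross_lim = "(\<integral>x. r x \<partial>lborel) - measure M UNIV - (\<integral>x. ln (r x) \<partial>M)"
  have "?cross \<longlonglongrightarrow> ?cross_lim"
    by (intro tendsto_diff tendsto_const integral_log_lipschitz_quant_tendsto
        integral_ln_log_lipschitz_quant_tendsto r) (use r(2) in auto)
  then have cross_less: "\<forall>\<^sub>F m in sequentially. ?cross m < ?cross_lim + e / 2"
    using e by (intro order_tendstoD(2)) auto
  have "\<forall>\<^sub>F m in sequentially. (\<integral>x. divergence_term (g x) (r x) \<partial>lborel) - e / 2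
      < (\<integral>x. divergence_term (cell_average (Suc m) x) (r (quant (Suc m) x)) \<partial>lborel)"
  proof (rule eventually_less_integral_if_AE_tendsto)
    show "AE x in lborel. (\<lambda>m. divergence_term (cell_average (Suc m) x) (r (quant (Suc m) x)))
        \<longlonglongrightarrow> divergence_term (g x) (r x)"
      using cell_average_tendsto
      by eventually_elim (intro divergence_term_tendsto LIMSEQ_Suc log_lipschitz_quant_tendsto log_lipschitz_pos r)
  qed (use e integrable_divergence_density[OF g r(2,3)] integrable_divergence_cell_average[OF r] in
      \<open>auto intro!: divergence_term_nonneg cell_average_nonneg nonneg_density log_lipschitz_pos[OF r(1)]\<close>)
  then have "\<forall>\<^sub>F m in sequentially. (\<integral>x. divergence_term (g x) (r x) \<partial>lborel) - e / 2
      < (\<integral>x. divergence_term (cell_average m x) (r (quant m x)) \<partial>lborel)"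
    by (rule eventually_sequentially_Suc[THEN iffD1])
  then show ?thesis
    using cross_less eventually_ge_at_top[of 1]
  proof eventually_elim
    case (elim m)
    then show ?case
      using integral_divergence_density[OF g r(2,3)] integral_divergence_cell_average[OF r elim(3)] by simp
  qed
qed

theorem
  assumes pos: "0 < measure M UNIV" and g: "entropic lborel g" and fin: "finite_atomic_entropy (quantize 1 M)"
  shows finite_atomic_entropy_quantize_density: "1 \<le> m \<Longrightarrow> finite_atomic_entropy (quantize m M)"
    and atomic_entropy_quantize_density_tendsto:
      "(\<lambda>m. atomic_entropy (quantize m M) - measure M UNIV * ln (real m)) \<longlonglongrightarrow> shannon_entropy lborel g"
proof -
  note reference = log_lipschitz_laplace_smoothing[OF pos] integrable_laplace_smoothing
    integrable_ln_laplace_smoothing[OF pos fin]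
  show finite: "finite_atomic_entropy (quantize m M)" if "1 \<le> m" for m
    using reference that by (rule finite_atomic_entropy_quantize)
  have "(\<lambda>m. shannon_entropy lborel (cell_average m)) \<longlonglongrightarrow> shannon_entropy lborel g"
  proof (rule order_tendstoI)
    fix a assume "shannon_entropy lborel g < a"
    then show "\<forall>\<^sub>F m in sequentially. shannon_entropy lborel (cell_average m) < a"
      using eventually_shannon_entropy_cell_average_less[OF g reference, of "a - shannon_entropy lborel g"] by simp
  next
    fix a assume "a < shannon_entropy lborel g"
    then show "\<forall>\<^sub>F m in sequentially. a < shannon_entropy lborel (cell_average m)"
      using shannon_entropy_le_cell_average[OF g _ finite]
      by (intro eventually_sequentiallyI[of 1]) (auto intro: less_le_trans)
  qed
  then show "(\<lambda>m. atomic_entropy (quantize m M) - measure M UNIV * ln (real m)) \<longlonglongrightarrow> shannon_entropy lborel g"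
    by (rule Lim_transform_eventually)
       (auto intro!: eventually_sequentiallyI[of 1] shannon_entropy_cell_average finite)
qed

end

section \<open>Quantized entropy of mixtures\<close>

lemma (in finite_borel_measure) finite_atomic_entropy_quantize_mono:
  assumes N: "finite_borel_measure N" "\<And>S. S \<in> sets borel \<Longrightarrow> measure M S \<le> measure N S"
    and fin: "finite_atomic_entropy (quantize m N)"
  shows "finite_atomic_entropy (quantize m M)"
  by (rule entropic_dominated[OF fin, where C=1])
     (use N M_is_borel in \<open>auto simp: measure_quantize finite_borel_measure.M_is_borel\<close>)

lemma
  assumes A: "finite_borel_measure A" "discrete_law A" "finite_atomic_entropy A"
    and B: "density_measure B g" "entropic lborel g" "0 < measure B UNIV"
    and M: "finite_borel_measure M" "\<And>S. S \<in> sets borel \<Longrightarrow> measure M S = measure A S + measure B S"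
    and fin: "finite_atomic_entropy (quantize 1 M)"
  shows finite_atomic_entropy_quantize_mixture: "1 \<le> m \<Longrightarrow> finite_atomic_entropy (quantize m M)"
    and atomic_entropy_quantize_mixture_tendsto:
      "(\<lambda>m. atomic_entropy (quantize m M) - measure B UNIV * ln (real m))
        \<longlonglongrightarrow> atomic_entropy A + shannon_entropy lborel g"
proof -
  interpret A: finite_borel_measure A by fact
  interpret B: density_measure B g by fact
  interpret M: finite_borel_measure M by fact
  have finA: "finite_atomic_entropy (quantize m A)" for m
    by (rule A.finite_atomic_entropy_quantize_discrete[OF A(2,3)])
  have fin1: "finite_atomic_entropy (quantize 1 B)"
    using fin by (rule B.finite_atomic_entropy_quantize_mono[OF M(1), rotated]) (simp add: M(2))
  have finB: "finite_atomic_entropy (quantize m B)" if "1 \<le> m" for m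
    using B.finite_atomic_entropy_quantize_density[OF B(3,2) fin1 that] .
  have atoms: "atom_mass (quantize m M) = (\<lambda>x. atom_mass (quantize m A) x + atom_mass (quantize m B) x)" for m
    by (simp add: measure_quantize A.M_is_borel B.M_is_borel M.M_is_borel M(2))
  show "finite_atomic_entropy (quantize m M)" if "1 \<le> m"
    unfolding atoms by (intro entropic_add finA finB that)
  let ?HA = "\<lambda>m. atomic_entropy (quantize m A)" and ?HB = "\<lambda>m. atomic_entropy (quantize m B)"
  let ?overlap = "\<lambda>m. \<integral>x. sqrt (atom_mass (quantize m A) x * atom_mass (quantize m B) x) \<partial>count_space UNIV"
  have upper: "atomic_entropy (quantize m M) \<le> ?HA m + ?HB m"
    and lower: "?HA m + ?HB m - 4 * ?overlap m \<le> atomic_entropy (quantize m M)" if "1 \<le> m" for m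
    using shannon_entropy_add_le[OF finA[of m] finB[OF that]] shannon_entropy_add_defect_le[OF finA[of m] finB[OF that]]
    unfolding atoms by simp_all
  have sum_lim: "(\<lambda>m. ?HA m + (?HB m - measure B UNIV * ln (real m))) \<longlonglongrightarrow> atomic_entropy A + shannon_entropy lborel g"
    by (intro tendsto_add A.atomic_entropy_quantize_discrete_tendsto A(2,3)
        B.atomic_entropy_quantize_density_tendsto B(2,3) fin1)
  have overlap_lim: "?overlap \<longlonglongrightarrow> 0"
    by (intro integral_sqrt_mult_quantize_tendsto_0 A(1,2) B.finite_borel_measure_axioms B.measure_singleton)
  show "(\<lambda>m. atomic_entropy (quantize m M) - measure B UNIV * ln (real m))
      \<longlonglongrightarrow> atomic_entropy A + shannon_entropy lborel g"
  proof (rule tendsto_sandwich[OF _ _ _ sum_lim])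
    show "(\<lambda>m. ?HA m + (?HB m - measure B UNIV * ln (real m)) - 4 * ?overlap m)
        \<longlonglongrightarrow> atomic_entropy A + shannon_entropy lborel g"
      using tendsto_diff[OF sum_lim tendsto_mult_left[OF overlap_lim, of 4]] by simp
  qed (use upper lower in \<open>auto intro!: eventually_sequentiallyI[of 1] simp: algebra_simps\<close>)
qed

section \<open>Differential entropy and convolutions\<close>

lemma density_measure_dens:
  assumes M: "finite_borel_measure M" and ac: "absolutely_continuous lborel M"
  shows "density_measure M (dens M)"
proof
  interpret M: finite_borel_measure M by fact
  note ac_sets = ac M.M_is_borel[folded sets_lborel]
  show dens_measurable: "dens M \<in> borel_measurable borel"
    unfolding dens_def by measurable
  show dens_nonneg: "0 \<le> dens M x" for x
    by (simp add: dens_def)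
  have "AE x in lborel. RN_deriv lborel M x \<noteq> \<infinity>"
    using ac_sets by (intro sigma_finite_measure.RN_deriv_finite lborel.sigma_finite_measure_axioms
        M.sigma_finite_measure_axioms)
  then have RN_deriv_eq: "AE x in lborel. RN_deriv lborel M x = ennreal (dens M x)"
    by eventually_elim (simp add: dens_def less_top)
  have "M = density lborel (RN_deriv lborel M)"
    using ac_sets by (intro sigma_finite_measure.density_RN_deriv[symmetric] lborel.sigma_finite_measure_axioms)
  also have "\<dots> = density lborel (\<lambda>x. ennreal (dens M x))"
    using RN_deriv_eq dens_measurable by (intro density_cong) auto
  finally show M_eq: "M = density lborel (\<lambda>x. ennreal (dens M x))" .
  have "(\<integral>\<^sup>+x. ennreal (dens M x) \<partial>lborel) = emeasure (density lborel (\<lambda>x. ennreal (dens M x))) UNIV"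
    using dens_measurable by (subst emeasure_density) auto
  also have "\<dots> < \<infinity>"
    unfolding M_eq[symmetric] by (simp add: M.emeasure_eq_measure)
  finally show "integrable lborel (dens M)"
    using dens_measurable dens_nonneg by (intro integrableI_nonneg) auto
qed

lemma
  assumes M: "finite_borel_measure M" and wd: "dentropy_wd M"
  shows entropic_dens: "entropic lborel (dens M)"
    and diff_entropy_eq_shannon_entropy: "diff_entropy M = shannon_entropy lborel (dens M)"
proof -
  interpret density_measure M "dens M"
    using assms by (intro density_measure_dens) (auto simp: dentropy_wd_def)
  have "integrable lborel (\<lambda>x. dens M x * \<bar>ln (dens M x)\<bar>)"
    using wd by (simp add: dentropy_wd_def)
  then have "integrable lborel (\<lambda>x. eta (dens M x))"
    by (rule Bochner_Integration.integrable_bound) (auto simp: eta_def abs_mult)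
  then show "entropic lborel (dens M)"
    by (simp add: entropic_def nonneg_density integrable_density)
  show "diff_entropy M = shannon_entropy lborel (dens M)"
    by (simp add: diff_entropy_def shannon_entropy_def eta_def)
qed

lemma density_measure_AE_le:
  assumes "density_measure M f" "density_measure N g"
    and measure_le: "\<And>S. S \<in> sets borel \<Longrightarrow> measure M S \<le> c * measure N S"
  shows "AE x in lborel. f x \<le> c * g x"
proof -
  interpret M: density_measure M f by fact
  interpret N: density_measure N g by fact
  define S where "S = {x. c * g x < f x}"
  have S [measurable]: "S \<in> sets borel" unfolding S_def by measurable
  let ?excess = "\<lambda>x. indicator S x * f x - c * (indicator S x * g x)"
  have ints: "integrable lborel (\<lambda>x. indicator S x * f x)" "integrable lborel (\<lambda>x. indicator S x * g x)"
    using integrable_mult_indicator[OF _ M.integrable_density, of S]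
      integrable_mult_indicator[OF _ N.integrable_density, of S] by simp_all
  have nonneg: "0 \<le> ?excess x" for x by (auto simp: indicator_def S_def)
  have "(\<integral>x. ?excess x \<partial>lborel) = measure M S - c * measure N S"
    using ints by (simp add: M.measure_eq_integral N.measure_eq_integral)
  then have "(\<integral>x. ?excess x \<partial>lborel) = 0"
    using measure_le[OF S] nonneg by (intro antisym Bochner_Integration.integral_nonneg) auto
  then have "AE x in lborel. ?excess x = 0"
    using integral_nonneg_eq_0_iff_AE[of lborel ?excess] ints nonneg by simp
  then show ?thesis
    by eventually_elim (auto simp: indicator_def S_def split: if_splits)
qed

lemma real_distribution_convolution:
  assumes "real_distribution M" "real_distribution N"
  shows "real_distribution (M \<star> N)"
proof -
  interpret M: real_distribution M by fact
  interpret N: real_distribution N by fact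
  interpret pair_prob_space M N ..
  show ?thesis unfolding convolution_def by (intro real_distribution_distr) measurable
qed

lemma char_convolution:
  assumes "real_distribution M" "real_distribution N"
  shows "char (M \<star> N) t = char M t * char N t"
proof -
  interpret M: real_distribution M by fact
  interpret N: real_distribution N by fact
  interpret pair_prob_space M N ..
  have int: "integrable (M \<Otimes>\<^sub>M N) (\<lambda>(x, y). iexp (t * x) * iexp (t * y))"
    by (intro integrable_const_bound[where B=1]) (auto simp: norm_mult)
  have "char (M \<star> N) t = (\<integral>z. (case z of (x, y) \<Rightarrow> iexp (t * x) * iexp (t * y)) \<partial>(M \<Otimes>\<^sub>M N))"
    unfolding char_def convolution_def
    by (subst integral_distr)
       (auto intro!: Bochner_Integration.integral_cong simp: exp_add distrib_left split_beta')
  also have "\<dots> = (\<integral>x. \<integral>y. iexp (t * x) * iexp (t * y) \<partial>N \<partial>M)"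
    using integral_fst'[OF int] by simp
  also have "\<dots> = char M t * char N t"
    by (simp add: char_def)
  finally show ?thesis .
qed

lemma convolution_eqI_char:
  assumes "real_distribution L" "real_distribution M" "real_distribution N"
    and "\<And>t. char L t = char M t * char N t"
  shows "L = (M \<star> N)"
  using assms by (intro Levy_uniqueness real_distribution_convolution) (auto simp: char_convolution)

lemma real_distribution_return: "real_distribution (return borel (x::real))"
  unfolding real_distribution_def real_distribution_axioms_def by (auto intro!: prob_space_return)

lemma char_return: "char (return borel x) t = iexp (t * x)"
  unfolding char_def by (subst integral_return) auto

primrec convolution_power :: "real measure \<Rightarrow> nat \<Rightarrow> real measure" where
  "convolution_power M 0 = return borel 0"
| "convolution_power M (Suc k) = (M \<star> convolution_power M k)"

lemma real_distribution_convolution_power: "real_distribution M \<Longrightarrow> real_distribution (convolution_power M k)"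
  by (induction k) (auto intro: real_distribution_return real_distribution_convolution)

lemma char_convolution_power: "real_distribution M \<Longrightarrow> char (convolution_power M k) t = char M t ^ k"
  by (induction k) (auto simp: char_return char_convolution real_distribution_convolution_power)

lemma (in density_measure) density_convolution_AE:
  assumes R: "real_distribution R" and f: "density_measure (M \<star> R) f"
  shows "AE x in lborel. ennreal (f x) = (\<integral>\<^sup>+y. ennreal (g (x - y)) \<partial>R)"
proof -
  interpret f: density_measure "M \<star> R" f by fact
  interpret R: real_distribution R by fact
  interpret P: pair_sigma_finite lborel R ..
  let ?F = "\<lambda>x. \<integral>\<^sup>+y. ennreal (g (x - y)) \<partial>R"
  have "density lborel (\<lambda>x. ennreal (f x)) = density lborel ?F"
  proof (rule measure_eqI)
    fix S assume "S \<in> sets (density lborel (\<lambda>x. ennreal (f x)))"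
    then have [measurable]: "S \<in> sets borel" by simp
    have "(M \<star> R) = (R \<star> M)"
      by (intro convolution_commutative finite_measure_axioms R.finite_measure_axioms M_is_borel R.events_eq_borel)
    then have "emeasure (M \<star> R) S = (\<integral>\<^sup>+x. \<integral>\<^sup>+y. indicator S (x + y) \<partial>M \<partial>R)"
      using convolution_emeasure'[OF _ R.finite_measure_axioms finite_measure_axioms M_is_borel R.events_eq_borel]
      by simp
    also have "\<dots> = (\<integral>\<^sup>+x. \<integral>\<^sup>+y. ennreal (g y) * indicator S (x + y) \<partial>lborel \<partial>R)"
      unfolding eq_density by (intro nn_integral_cong) (subst nn_integral_density, auto)
    also have "\<dots> = (\<integral>\<^sup>+x. \<integral>\<^sup>+y. ennreal (g (y - x)) * indicator S y \<partial>lborel \<partial>R)"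
    proof (rule nn_integral_cong)
      fix x show "(\<integral>\<^sup>+y. ennreal (g y) * indicator S (x + y) \<partial>lborel)
          = (\<integral>\<^sup>+y. ennreal (g (y - x)) * indicator S y \<partial>lborel)"
        by (subst nn_integral_real_affine[of _ 1 "- x"]) (auto simp: algebra_simps)
    qed
    also have "\<dots> = (\<integral>\<^sup>+y. \<integral>\<^sup>+x. ennreal (g (y - x)) * indicator S y \<partial>R \<partial>lborel)"
      by (rule P.Fubini') measurable
    also have "\<dots> = (\<integral>\<^sup>+y. ?F y * indicator S y \<partial>lborel)"
      by (intro nn_integral_cong nn_integral_multc) measurable
    also have "\<dots> = emeasure (density lborel ?F) S"
      by (subst emeasure_density) auto
    finally show "emeasure (density lborel (\<lambda>x. ennreal (f x))) S = emeasure (density lborel ?F) S"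
      by (simp add: f.eq_density[symmetric])
  qed simp
  then show ?thesis
    by (intro sigma_finite_measure.density_unique[OF lborel.sigma_finite_measure_axioms]) auto
qed

lemma (in real_distribution)
  fixes h :: "real \<Rightarrow> real"
  assumes h: "integrable lborel h"
  shows AE_integrable_translates: "AE x in lborel. integrable M (\<lambda>y. h (x - y))"
    and integrable_average_translates: "integrable lborel (\<lambda>x. \<integral>y. h (x - y) \<partial>M)"
    and integral_average_translates: "(\<integral>x. \<integral>y. h (x - y) \<partial>M \<partial>lborel) = (\<integral>x. h x \<partial>lborel)"
proof -
  interpret P: pair_sigma_finite lborel M ..
  note [measurable] = borel_measurable_integrable[OF h]
  have pair_int: "integrable (lborel \<Otimes>\<^sub>M M) (\<lambda>(x, y). h (x - y))"
  proof (rule integrableI_bounded)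
    have "(\<integral>\<^sup>+z. ennreal (norm (case z of (x, y) \<Rightarrow> h (x - y))) \<partial>(lborel \<Otimes>\<^sub>M M))
        = (\<integral>\<^sup>+x. \<integral>\<^sup>+y. ennreal \<bar>h (x - y)\<bar> \<partial>M \<partial>lborel)"
      by (subst nn_integral_fst[symmetric]) auto
    also have "\<dots> = (\<integral>\<^sup>+y. \<integral>\<^sup>+x. ennreal \<bar>h (x - y)\<bar> \<partial>lborel \<partial>M)"
      by (rule P.Fubini'[symmetric]) measurable
    also have "\<dots> = (\<integral>\<^sup>+y. \<integral>\<^sup>+x. ennreal \<bar>h x\<bar> \<partial>lborel \<partial>M)"
    proof (rule nn_integral_cong)
      fix y show "(\<integral>\<^sup>+x. ennreal \<bar>h (x - y)\<bar> \<partial>lborel) = (\<integral>\<^sup>+x. ennreal \<bar>h x\<bar> \<partial>lborel)"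
        by (subst nn_integral_real_affine[of _ 1 y]) auto
    qed
    also have "\<dots> < \<infinity>"
      using h emeasure_space_1 by (simp add: integrable_iff_bounded)
    finally show "(\<integral>\<^sup>+z. ennreal (norm (case z of (x, y) \<Rightarrow> h (x - y))) \<partial>(lborel \<Otimes>\<^sub>M M)) < \<infinity>" .
  qed measurable
  show "AE x in lborel. integrable M (\<lambda>y. h (x - y))"
    using P.AE_integrable_fst'[OF pair_int] by simp
  show "integrable lborel (\<lambda>x. \<integral>y. h (x - y) \<partial>M)"
    using P.integrable_fst'[OF pair_int] by simp
  have "(\<integral>x. \<integral>y. h (x - y) \<partial>M \<partial>lborel) = (\<integral>y. \<integral>x. h (x - y) \<partial>lborel \<partial>M)"
    using P.Fubini_integral[OF pair_int] by simp
  also have "\<dots> = (\<integral>y. \<integral>x. h x \<partial>lborel \<partial>M)"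
  proof (rule Bochner_Integration.integral_cong[OF refl])
    fix y show "(\<integral>x. h (x - y) \<partial>lborel) = (\<integral>x. h x \<partial>lborel)"
      using integral_translate[OF translation_invariant_lborel, of h "- y"] by simp
  qed
  finally show "(\<integral>x. \<integral>y. h (x - y) \<partial>M \<partial>lborel) = (\<integral>x. h x \<partial>lborel)"
    using prob_space by simp
qed

theorem shannon_entropy_le_convolution:
  assumes g: "density_measure M g" "entropic lborel g" and R: "real_distribution R"
    and f: "density_measure (M \<star> R) f" "entropic lborel f"
  shows "shannon_entropy lborel g \<le> shannon_entropy lborel f"
proof -
  interpret density_measure M g by fact
  interpret f: density_measure "M \<star> R" f by fact
  interpret R: real_distribution R by fact
  note eta_g = entropicD(3)[OF g(2)]
  have "shannon_entropy lborel g = (\<integral>x. \<integral>y. eta (g (x - y)) \<partial>R \<partial>lborel)"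
    unfolding shannon_entropy_def by (rule R.integral_average_translates[OF eta_g, symmetric])
  also have "\<dots> \<le> shannon_entropy lborel f"
    unfolding shannon_entropy_def
  proof (rule integral_mono_AE[OF R.integrable_average_translates[OF eta_g] entropicD(3)[OF f(2)]])
    show "AE x in lborel. (\<integral>y. eta (g (x - y)) \<partial>R) \<le> eta (f x)"
      using density_convolution_AE[OF R f(1)] R.AE_integrable_translates[OF integrable_density]
        R.AE_integrable_translates[OF eta_g]
    proof eventually_elim
      case (elim x)
      then have entropic_x: "entropic R (\<lambda>y. g (x - y))"
        by (simp add: entropic_def nonneg_density)
      have "ennreal (f x) = ennreal (\<integral>y. g (x - y) \<partial>R)"
        using elim(1,2) by (simp add: nn_integral_eq_integral nonneg_density)
      then have "f x = (\<integral>y. g (x - y) \<partial>R)"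
        by (simp add: f.nonneg_density nonneg_density Bochner_Integration.integral_nonneg)
      then show ?case
        using R.shannon_entropy_le_eta_integral[OF entropic_x] by (simp add: shannon_entropy_def)
    qed
  qed
  finally show ?thesis .
qed

lemma quant_1_add:
  obtains i where "i \<in> {- 1, 0, 1}" "quant 1 (x + y) = quant 1 x + quant 1 y + i"
proof -
  define i where "i = \<lfloor>1/2 + (x + y)\<rfloor> - \<lfloor>1/2 + x\<rfloor> - \<lfloor>1/2 + y\<rfloor>"
  have "- 1 \<le> i" "i \<le> 1" unfolding i_def by linarith+
  then have "i \<in> {- 1, 0, 1}" by auto
  then show ?thesis
    by (intro that[of "real_of_int i"]) (auto simp: quant_def i_def)
qed

lemma atom_mass_quantize_convolution_ge:
  assumes M: "real_distribution M" and R: "real_distribution R"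
  shows "atom_mass (quantize 1 M) a * atom_mass (quantize 1 R) b
    \<le> (\<Sum>i\<in>{- 1, 0, 1}. atom_mass (quantize 1 (M \<star> R)) (a + (b + i)))"
proof -
  interpret M: real_distribution M by fact
  interpret R: real_distribution R by fact
  interpret C: real_distribution "M \<star> R" using M R by (rule real_distribution_convolution)
  interpret pair_prob_space M R ..
  let ?cell = "\<lambda>x. quant 1 -` {x}"
  let ?U = "\<Union>i\<in>{- 1, 0, 1}. ?cell (a + (b + i))"
  have U: "?U \<in> sets borel" by (intro sets.finite_UN vimage_quant_sets) auto
  have "atom_mass (quantize 1 M) a * atom_mass (quantize 1 R) b = measure (M \<Otimes>\<^sub>M R) (?cell a \<times> ?cell b)"
    unfolding measure_def
    by (subst R.emeasure_pair_measure_Times) (auto simp: enn2real_mult emeasure_quantize)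
  also have "\<dots> \<le> measure (M \<Otimes>\<^sub>M R) ((\<lambda>(x, y). x + y) -` ?U \<inter> space (M \<Otimes>\<^sub>M R))"
  proof (rule finite_measure_mono)
    show "?cell a \<times> ?cell b \<subseteq> (\<lambda>(x, y). x + y) -` ?U \<inter> space (M \<Otimes>\<^sub>M R)"
    proof
      fix z assume "z \<in> ?cell a \<times> ?cell b"
      moreover obtain x y where "z = (x, y)" by force
      moreover obtain i where "i \<in> {- 1, 0, 1}" "quant 1 (x + y) = quant 1 x + quant 1 y + i"
        by (rule quant_1_add)
      ultimately show "z \<in> (\<lambda>(x, y). x + y) -` ?U \<inter> space (M \<Otimes>\<^sub>M R)"
        by (auto simp: space_pair_measure add.assoc)
    qed
    show "(\<lambda>(x, y). x + y) -` ?U \<inter> space (M \<Otimes>\<^sub>M R) \<in> sets (M \<Otimes>\<^sub>M R)"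
      using U by (intro measurable_sets[where A=borel]) auto
  qed
  also have "\<dots> = measure (M \<star> R) ?U"
    unfolding convolution_def using U by (subst measure_distr) simp_all
  also have "\<dots> \<le> (\<Sum>i\<in>{- 1, 0, 1}. measure (M \<star> R) (?cell (a + (b + i))))"
    by (intro measure_UNION_le) (auto intro: vimage_quant_sets)
  finally show ?thesis by (simp add: measure_quantize)
qed

lemma finite_atomic_entropy_quantize_factor:
  assumes M: "real_distribution M" and R: "real_distribution R"
    and fin: "finite_atomic_entropy (quantize 1 (M \<star> R))"
  shows "finite_atomic_entropy (quantize 1 M)"
proof -
  interpret M: real_distribution M by fact
  interpret R: real_distribution R by fact
  let ?q = "atom_mass (quantize 1 (M \<star> R))"
  obtain b where b: "0 < atom_mass (quantize 1 R) b"
    using eventually_happens'[OF R.ae_filter_bot R.AE_atom_mass_quantize_pos[of 1]] by blast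
  have "atom_mass (quantize 1 R) b \<le> 1"
    using R.atom_mass_quantize_le[of 1 b] R.prob_le_1 by (rule order_trans)
  then have C: "1 \<le> 1 / atom_mass (quantize 1 R) b" using b by simp
  define u where "u a = ?q (a + (b + - 1)) + ?q (a + (b + 0)) + ?q (a + (b + 1))" for a
  have u: "entropic (count_space UNIV) u"
    unfolding u_def by (intro entropic_add entropic_translate translation_invariant_count_space fin)
  show ?thesis
  proof (rule entropic_dominated[OF u _ _ _ C])
    have "atom_mass (quantize 1 M) a \<le> 1 / atom_mass (quantize 1 R) b * u a" for a
      using atom_mass_quantize_convolution_ge[OF M R, of a b] b by (simp add: u_def field_simps)
    then show "AE a in count_space UNIV. atom_mass (quantize 1 M) a \<le> 1 / atom_mass (quantize 1 R) b * u a"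
      by simp
  qed simp_all
qed

section \<open>Limits along fine resolutions\<close>

definition uniform_resolution_limit ::
    "(nat \<Rightarrow> real measure) \<Rightarrow> (nat \<Rightarrow> nat \<Rightarrow> real) \<Rightarrow> (nat \<Rightarrow> real) \<Rightarrow> (nat \<Rightarrow> nat) \<Rightarrow> bool" where
  "uniform_resolution_limit P F \<zeta> mn \<longleftrightarrow>
     (\<forall>\<epsilon>>0. \<forall>\<^sub>F n in sequentially. \<forall>m\<ge>mn n. Hq m (P n) < \<infinity> \<and> \<bar>F n m - \<zeta> n\<bar> \<le> \<epsilon>)"

lemma ex_uniform_resolution_limit:
  assumes lim: "\<And>n. N \<le> n \<Longrightarrow> F n \<longlonglongrightarrow> \<zeta> n"
    and fin: "\<And>n m. N \<le> n \<Longrightarrow> 1 \<le> m \<Longrightarrow> Hq m (P n) < \<infinity>"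
  shows "\<exists>mn. uniform_resolution_limit P F \<zeta> mn"
proof -
  have "\<exists>M. \<forall>m\<ge>M. Hq m (P n) < \<infinity> \<and> \<bar>F n m - \<zeta> n\<bar> < 1 / real (Suc n)" if "N \<le> n" for n
  proof -
    have "\<exists>M. \<forall>m\<ge>M. norm (F n m - \<zeta> n) < 1 / real (Suc n)"
      using lim[OF that] by (rule LIMSEQ_D) simp
    then obtain M where "\<forall>m\<ge>M. norm (F n m - \<zeta> n) < 1 / real (Suc n)" ..
    then show ?thesis
      using fin[OF that] by (intro exI[of _ "max 1 M"]) auto
  qed
  then obtain mn where mn:
    "\<And>n m. N \<le> n \<Longrightarrow> mn n \<le> m \<Longrightarrow> Hq m (P n) < \<infinity> \<and> \<bar>F n m - \<zeta> n\<bar> < 1 / real (Suc n)"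
    by metis
  have "uniform_resolution_limit P F \<zeta> mn"
    unfolding uniform_resolution_limit_def
  proof (intro allI impI)
    fix \<epsilon> :: real assume "0 < \<epsilon>"
    then have "\<forall>\<^sub>F n in sequentially. 1 / real (Suc n) < \<epsilon>"
      by (rule order_tendstoD(2)[OF LIMSEQ_Suc[OF lim_1_over_n]])
    then show "\<forall>\<^sub>F n in sequentially. \<forall>m\<ge>mn n. Hq m (P n) < \<infinity> \<and> \<bar>F n m - \<zeta> n\<bar> \<le> \<epsilon>"
      using eventually_ge_at_top[of N] by eventually_elim (auto dest!: mn intro: less_imp_le less_trans)
  qed
  then show ?thesis by blast
qed

lemma logarithmic_bounds_without_constants:
  fixes z :: "nat \<Rightarrow> real"
  assumes a: "0 < a"
    and lower: "\<And>n. N \<le> n \<Longrightarrow> a * ln (real n) - b \<le> z n"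
    and upper: "\<And>n. N \<le> n \<Longrightarrow> z n \<le> a' * ln (real n) + b'"
  obtains c1 c2 N' where "0 < c1" "c1 \<le> c2" "N \<le> N'" "1 \<le> N'"
    "\<And>n. N' \<le> n \<Longrightarrow> c1 * ln (real n) \<le> z n \<and> z n \<le> c2 * ln (real n)"
proof -
  define c2 where "c2 = max (a / 2) (a' + 1)"
  have "filterlim (\<lambda>n. ln (real n)) at_top sequentially"
    by (rule filterlim_compose[OF ln_at_top filterlim_real_sequentially])
  then have "\<forall>\<^sub>F n in sequentially. max (2 * b / a) b' \<le> ln (real n)"
    unfolding filterlim_at_top by blast
  then obtain N0 where N0: "\<And>n. N0 \<le> n \<Longrightarrow> max (2 * b / a) b' \<le> ln (real n)"
    by (auto simp: eventually_sequentially)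
  show ?thesis
  proof
    fix n assume "max (max N N0) 1 \<le> n"
    then have n: "N \<le> n" "N0 \<le> n" "1 \<le> n" by simp_all
    have "b \<le> a / 2 * ln (real n)"
      using N0[OF n(2)] a by (simp add: field_simps)
    then have "a / 2 * ln (real n) \<le> z n"
      using lower[OF n(1)] by simp
    moreover have "z n \<le> (a' + 1) * ln (real n)"
      using upper[OF n(1)] N0[OF n(2)] by (simp add: algebra_simps)
    moreover have "(a' + 1) * ln (real n) \<le> c2 * ln (real n)"
      using n(3) by (intro mult_right_mono) (auto simp: c2_def)
    ultimately show "a / 2 * ln (real n) \<le> z n \<and> z n \<le> c2 * ln (real n)" by linarith
  qed (use a in \<open>auto simp: c2_def\<close>)
qed

lemma ex_logarithmic_resolution_limit:
  assumes a: "0 < a"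
    and lower: "\<And>n. N \<le> n \<Longrightarrow> a * ln (real n) - b \<le> z n"
    and upper: "\<And>n. N \<le> n \<Longrightarrow> z n \<le> a' * ln (real n) + b'"
    and lim: "\<And>n. N \<le> n \<Longrightarrow> F n \<longlonglongrightarrow> z n"
    and fin: "\<And>n m. N \<le> n \<Longrightarrow> 1 \<le> m \<Longrightarrow> Hq m (P n) < \<infinity>"
  shows "\<exists>mn \<zeta> c1 c2. 0 < c1 \<and> c1 \<le> c2 \<and>
    (\<forall>n\<ge>1. c1 * ln (real n) \<le> \<zeta> n \<and> \<zeta> n \<le> c2 * ln (real n)) \<and> uniform_resolution_limit P F \<zeta> mn"
proof -
  from a lower upper obtain c1 c2 N' where c_bounds: "0 < c1" "c1 \<le> c2" "N \<le> N'" "1 \<le> N'"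
    and z: "\<And>n. N' \<le> n \<Longrightarrow> c1 * ln (real n) \<le> z n \<and> z n \<le> c2 * ln (real n)"
    by (rule logarithmic_bounds_without_constants) blast+
  \<comment> \<open>Bounds without additive constants hold for z only eventually.\<close>
  define \<zeta> where "\<zeta> n = (if N' \<le> n then z n else c1 * ln (real n))" for n
  have "c1 * ln (real n) \<le> \<zeta> n \<and> \<zeta> n \<le> c2 * ln (real n)" if "1 \<le> n" for n
    using z[of n] c_bounds(2) that by (simp add: \<zeta>_def mult_right_mono)
  moreover have "\<exists>mn. uniform_resolution_limit P F \<zeta> mn"
  proof (rule ex_uniform_resolution_limit)
    fix n assume n: "N' \<le> n"
    then show "F n \<longlonglongrightarrow> \<zeta> n"
      using lim[of n] c_bounds(3) by (simp add: \<zeta>_def)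
    show "Hq m (P n) < \<infinity>" if "1 \<le> m" for m
      using c_bounds(3) n that by (intro fin) simp
  qed
  ultimately show ?thesis using c_bounds(1,2) by blast
qed

section \<open>Continuous laws\<close>

context real_distribution
begin

lemma Hq_less_top_iff: "Hq m M < \<infinity> \<longleftrightarrow> finite_atomic_entropy (quantize m M)"
  and enn2real_Hq: "enn2real (Hq m M) = atomic_entropy (quantize m M)"
proof -
  interpret quantized: finite_borel_measure "quantize m M" by (rule finite_borel_measure_quantize)
  have "measure (quantize m M) UNIV \<le> 1" by (simp add: measure_quantize_UNIV)
  then show "Hq m M < \<infinity> \<longleftrightarrow> finite_atomic_entropy (quantize m M)"
    and "enn2real (Hq m M) = atomic_entropy (quantize m M)"
    unfolding Hq_eq_dentropy_quantize
    by (simp_all add: quantized.finite_atomic_entropy_iff_dentropy quantized.enn2real_dentropy)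
qed

end

locale divisible_family =
  fixes P :: "nat \<Rightarrow> real measure" and \<psi> :: "real \<Rightarrow> complex"
  assumes real_distribution_P: "1 \<le> n \<Longrightarrow> real_distribution (P n)"
    and char_P: "1 \<le> n \<Longrightarrow> char (P n) t = exp (\<psi> t / of_nat n)"
begin

lemma P_1_eq_convolution:
  assumes n: "1 \<le> n"
  shows "P 1 = (P n \<star> convolution_power (P n) (n - 1))"
proof (rule convolution_eqI_char)
  fix t
  have "char (P n) t * char (convolution_power (P n) (n - 1)) t = char (P n) t ^ Suc (n - 1)"
    unfolding char_convolution_power[OF real_distribution_P[OF n]] by simp
  also have "\<dots> = exp (of_nat n * (\<psi> t / of_nat n))"
    using n unfolding exp_of_nat_mult by (simp add: char_P del: power_Suc)
  also have "\<dots> = char (P 1) t"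
    using n by (simp add: char_P)
  finally show "char (P 1) t = char (P n) t * char (convolution_power (P n) (n - 1)) t" by simp
qed (use n in \<open>auto intro!: real_distribution_P real_distribution_convolution_power\<close>)

lemma finite_atomic_entropy_quantize_P:
  assumes fin: "Hq 1 (P 1) < \<infinity>" and n: "1 \<le> n"
  shows "finite_atomic_entropy (quantize 1 (P n))"
proof (rule finite_atomic_entropy_quantize_factor)
  show "finite_atomic_entropy (quantize 1 (P n \<star> convolution_power (P n) (n - 1)))"
    using fin real_distribution.Hq_less_top_iff[OF real_distribution_P[of 1]]
    unfolding P_1_eq_convolution[OF n, symmetric] by simp
qed (intro real_distribution_P real_distribution_convolution_power n)+

lemma P_eq_convolution_Suc:
  assumes n: "1 \<le> n"
  shows "P n = (P (Suc n) \<star> P (n * Suc n))"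
proof (rule convolution_eqI_char)
  fix t
  have "of_nat n \<noteq> (0::complex)" "1 + of_nat n \<noteq> (0::complex)"
    using n of_nat_neq_0[of n, where ?'a=complex] by auto
  then have "\<psi> t / of_nat n = \<psi> t / (1 + of_nat n) + \<psi> t / (of_nat n * (1 + of_nat n))"
    by (simp add: divide_simps) (simp add: algebra_simps)
  then have "\<psi> t / of_nat n = \<psi> t / of_nat (Suc n) + \<psi> t / of_nat (n * Suc n)"
    by (simp only: of_nat_mult of_nat_Suc)
  then show "char (P n) t = char (P (Suc n)) t * char (P (n * Suc n)) t"
    using n by (simp add: char_P exp_add del: of_nat_Suc of_nat_mult mult_Suc_right)
qed (use n in \<open>auto intro: real_distribution_P\<close>)

context
  assumes fin: "Hq 1 (P 1) < \<infinity>" and wd: "\<forall>n\<ge>1. dentropy_wd (P n)"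
begin

lemma
  assumes n: "1 \<le> n"
  shows density_measure_P: "density_measure (P n) (dens (P n))"
    and entropic_dens_P: "entropic lborel (dens (P n))"
    and diff_entropy_P: "diff_entropy (P n) = shannon_entropy lborel (dens (P n))"
proof -
  interpret real_distribution "P n" using n by (rule real_distribution_P)
  show "density_measure (P n) (dens (P n))"
    using wd n by (intro density_measure_dens finite_borel_measure_M) (simp add: dentropy_wd_def)
  show "entropic lborel (dens (P n))" "diff_entropy (P n) = shannon_entropy lborel (dens (P n))"
    using wd n by (auto intro: entropic_dens diff_entropy_eq_shannon_entropy finite_borel_measure_M)
qed

theorem ex_uniform_resolution_limit_continuous:
  "\<exists>mn. uniform_resolution_limit P (\<lambda>n m. real n * enn2real (Hq m (P n)) / real n - ln (real m))
     (\<lambda>n. diff_entropy (P n)) mn"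
proof (rule ex_uniform_resolution_limit[where N=1])
  fix n :: nat assume n: "1 \<le> n"
  interpret real_distribution "P n" using n by (rule real_distribution_P)
  interpret density_measure "P n" "dens (P n)" using n by (rule density_measure_P)
  have pos: "0 < measure (P n) UNIV" using prob_space by simp
  note quantized_limit = pos entropic_dens_P[OF n] finite_atomic_entropy_quantize_P[OF fin n]
  show "Hq m (P n) < \<infinity>" if "1 \<le> m" for m
    unfolding Hq_less_top_iff using quantized_limit that by (rule finite_atomic_entropy_quantize_density)
  show "(\<lambda>m. real n * enn2real (Hq m (P n)) / real n - ln (real m)) \<longlonglongrightarrow> diff_entropy (P n)"
    using atomic_entropy_quantize_density_tendsto[OF quantized_limit] n prob_space
    by (simp add: enn2real_Hq diff_entropy_P)
qed

theorem diff_entropy_Suc_le: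
  assumes n: "1 \<le> n"
  shows "diff_entropy (P (Suc n)) \<le> diff_entropy (P n)"
proof -
  have "shannon_entropy lborel (dens (P (Suc n))) \<le> shannon_entropy lborel (dens (P n))"
  proof (rule shannon_entropy_le_convolution)
    show "density_measure (P (Suc n) \<star> P (n * Suc n)) (dens (P n))"
      unfolding P_eq_convolution_Suc[OF n, symmetric] using n by (rule density_measure_P)
  qed (use n in \<open>auto intro: density_measure_P entropic_dens_P real_distribution_P\<close>)
  then show ?thesis
    using n by (simp add: diff_entropy_P)
qed

end

end

section \<open>Total mass of the atoms\<close>

definition atomic_mass :: "real measure \<Rightarrow> ennreal" where
  "atomic_mass M = (\<integral>\<^sup>+x. emeasure M {x} \<partial>count_space UNIV)"

lemma atomic_mass_eq_emeasure:
  assumes M: "sets M = sets borel" and D: "countable D" and null: "\<And>x. x \<notin> D \<Longrightarrow> emeasure M {x} = 0"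
  shows "atomic_mass M = emeasure M D"
proof -
  have "emeasure M D = (\<integral>\<^sup>+x. emeasure M {x} \<partial>count_space D)"
    using D M by (intro emeasure_countable_singleton) auto
  also have "\<dots> = atomic_mass M"
    unfolding atomic_mass_def by (intro nn_integral_count_space_eq) (auto simp: null)
  finally show ?thesis ..
qed

lemma atomic_mass_discrete_law:
  assumes M: "sets M = sets borel" and "discrete_law M"
  shows "atomic_mass M = emeasure M UNIV"
proof -
  obtain D where D: "countable D" "emeasure M (UNIV - D) = 0"
    using \<open>discrete_law M\<close> by (auto simp: discrete_law_def)
  note D_sets = countable_in_sets_borel[OF D(1)]
  have "emeasure M {x} = 0" if "x \<notin> D" for x
    using emeasure_mono[of "{x}" "UNIV - D" M] D_sets D(2) that by (simp add: M)
  with M D(1) have "atomic_mass M = emeasure M D"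
    by (rule atomic_mass_eq_emeasure)
  also have "\<dots> = emeasure M D + emeasure M (UNIV - D)" by (simp add: D(2))
  also have "\<dots> = emeasure M UNIV"
    using D_sets by (subst plus_emeasure) (auto simp: M intro!: arg_cong[where f="emeasure M"])
  finally show ?thesis .
qed

lemma (in finite_borel_measure) discrete_law_if_atomic_mass:
  assumes "atomic_mass M = emeasure M UNIV"
  shows "discrete_law M"
  unfolding discrete_law_def
proof (intro exI conjI)
  let ?S = "{x. 0 < atom_mass M x}"
  show countable: "countable ?S"
    using countable_support by (simp add: zero_less_measure_iff)
  then have "emeasure M ?S = emeasure M UNIV"
    using assms by (subst atomic_mass_eq_emeasure[OF M_is_borel, symmetric])
      (auto simp: less_le emeasure_eq_measure)
  then show "emeasure M (UNIV - ?S) = 0"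
    using countable_in_sets_borel[OF countable] by (subst emeasure_Diff) (auto simp: M_is_borel emeasure_eq_measure)
qed

lemma atomic_mass_translate:
  assumes M: "sets M = sets borel"
  shows "atomic_mass (distr M borel (\<lambda>x. x + c)) = atomic_mass M"
proof -
  have "(\<lambda>x. x + c) -` {x} = {x + - c}" for x :: real by auto
  then have "emeasure (distr M borel (\<lambda>x. x + c)) {x} = emeasure M {x + - c}" for x
    using M by (simp add: emeasure_distr space_eq_UNIV_if_sets_borel cong: measurable_cong_sets)
  then show ?thesis
    unfolding atomic_mass_def
    by (simp only: nn_integral_bij_count_space[OF bij_plus_right, of "\<lambda>x. emeasure M {x}" "- c"])
qed

lemma nn_integral_countable_support:
  fixes M :: "real measure"
  assumes M: "sets M = sets borel" and f: "f \<in> borel_measurable borel"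
    and T: "countable T" "\<And>x. x \<notin> T \<Longrightarrow> f x = 0"
  shows "(\<integral>\<^sup>+x. f x \<partial>M) = (\<integral>\<^sup>+x. f x * emeasure M {x} \<partial>count_space UNIV)"
proof -
  have f_M: "f \<in> borel_measurable M" using f M by (simp cong: measurable_cong_sets)
  have T_sets: "T \<in> sets M" unfolding M using T(1) by (rule countable_in_sets_borel)
  have "(\<integral>\<^sup>+x. f x \<partial>M) = (\<integral>\<^sup>+x. f x * indicator T x \<partial>M)"
    using T(2) by (intro nn_integral_cong) (auto simp: indicator_def)
  also have "\<dots> = emeasure (density M f) T"
    using f_M T_sets by (simp add: emeasure_density)
  also have "\<dots> = (\<integral>\<^sup>+x. emeasure (density M f) {x} \<partial>count_space T)"
    using T(1) M by (intro emeasure_countable_singleton) auto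
  also have "\<dots> = (\<integral>\<^sup>+x. f x * emeasure M {x} \<partial>count_space T)"
  proof (rule nn_integral_cong)
    fix x
    have "emeasure (density M f) {x} = (\<integral>\<^sup>+y. f x * indicator {x} y \<partial>M)"
      using f_M M by (subst emeasure_density) (auto intro!: nn_integral_cong simp: indicator_def)
    then show "emeasure (density M f) {x} = f x * emeasure M {x}"
      using M by (simp add: nn_integral_cmult_indicator)
  qed
  also have "\<dots> = (\<integral>\<^sup>+x. f x * emeasure M {x} \<partial>count_space UNIV)"
    by (intro nn_integral_count_space_eq) (auto simp: T(2))
  finally show ?thesis .
qed

lemma emeasure_convolution_singleton:
  assumes M: "finite_borel_measure M" and N: "finite_borel_measure N"
  shows "emeasure (M \<star> N) {z} = (\<integral>\<^sup>+x. emeasure N {z - x} * emeasure M {x} \<partial>count_space UNIV)"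
proof -
  interpret M: finite_borel_measure M by fact
  interpret N: finite_borel_measure N by fact
  have translate: "{a. a + x \<in> {z}} = {z - x}" for x by auto
  have "emeasure (M \<star> N) {z} = (\<integral>\<^sup>+x. emeasure N {z - x} \<partial>M)"
    using convolution_emeasure[of "{z}", OF _ M.finite_measure_axioms N.finite_measure_axioms N.M_is_borel M.M_is_borel]
    unfolding translate by simp
  also have "\<dots> = (\<integral>\<^sup>+x. emeasure N {z - x} * emeasure M {x} \<partial>count_space UNIV)"
  proof (rule nn_integral_countable_support[OF M.M_is_borel])
    have "(\<lambda>x. ennreal (atom_mass N (z - x))) \<in> borel_measurable borel"
      using measurable_compose[OF _ N.borel_measurable_atom_mass, of "\<lambda>x. z - x"] by simp
    then show "(\<lambda>x. emeasure N {z - x}) \<in> borel_measurable borel"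
      by (simp add: N.emeasure_eq_measure)
    show "countable ((\<lambda>x. z - x) ` {x. measure N {x} \<noteq> 0})"
      using N.countable_support by (rule countable_image)
    show "emeasure N {z - x} = 0" if "x \<notin> (\<lambda>x. z - x) ` {x. measure N {x} \<noteq> 0}" for x
      using that by (auto simp: N.emeasure_eq_measure image_iff)
  qed
  finally show ?thesis .
qed

theorem atomic_mass_convolution:
  assumes M: "finite_borel_measure M" and N: "finite_borel_measure N"
  shows "atomic_mass (M \<star> N) = atomic_mass M * atomic_mass N"
proof -
  have "atomic_mass (M \<star> N)
      = (\<integral>\<^sup>+z. \<integral>\<^sup>+x. emeasure N {z - x} * emeasure M {x} \<partial>count_space UNIV \<partial>count_space UNIV)"
    by (simp add: atomic_mass_def emeasure_convolution_singleton[OF M N])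
  also have "\<dots> = (\<integral>\<^sup>+x. \<integral>\<^sup>+z. emeasure N {z - x} * emeasure M {x} \<partial>count_space UNIV \<partial>count_space UNIV)"
    using nn_integral_fst_count_space[of "\<lambda>(z, x). emeasure N {z - x} * emeasure M {x}"]
      nn_integral_snd_count_space[of "\<lambda>(z, x). emeasure N {z - x} * emeasure M {x}"] by simp
  also have "\<dots> = (\<integral>\<^sup>+x. atomic_mass N * emeasure M {x} \<partial>count_space UNIV)"
  proof (rule nn_integral_cong)
    fix x
    have "(\<integral>\<^sup>+z. emeasure N {z - x} \<partial>count_space UNIV) = atomic_mass N"
      unfolding atomic_mass_def
      using nn_integral_bij_count_space[OF bij_plus_right, of "\<lambda>z. emeasure N {z}" "- x"] by simp
    then show "(\<integral>\<^sup>+z. emeasure N {z - x} * emeasure M {x} \<partial>count_space UNIV) = atomic_mass N * emeasure M {x}"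
      by (simp add: nn_integral_multc)
  qed
  also have "\<dots> = atomic_mass N * atomic_mass M"
    unfolding atomic_mass_def [of M] by (rule nn_integral_cmult) simp
  also have "\<dots> = atomic_mass M * atomic_mass N"
    by (rule mult.commute)
  finally show ?thesis .
qed

lemma atomic_mass_convolution_power:
  assumes M: "real_distribution M"
  shows "atomic_mass (convolution_power M k) = atomic_mass M ^ k"
proof (induction k)
  case 0
  have "discrete_law (return borel (0::real))"
    unfolding discrete_law_def by (intro exI[of _ "{0}"]) (simp add: emeasure_return)
  then show ?case by (simp add: atomic_mass_discrete_law emeasure_return)
next
  case (Suc k)
  have "finite_borel_measure M" "finite_borel_measure (convolution_power M k)"
    using M real_distribution_convolution_power[OF M]
    by (simp_all add: real_distribution.finite_borel_measure_M)
  then show ?case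
    using Suc by (simp add: atomic_mass_convolution)
qed

section \<open>Compound Poisson laws\<close>

definition compound_poisson :: "real \<Rightarrow> real measure \<Rightarrow> real measure" where
  "compound_poisson r A = measure_pmf (poisson_pmf r) \<bind> convolution_power A"

lemma real_distribution_imp_space_subprob_algebra:
  "real_distribution M \<Longrightarrow> M \<in> space (subprob_algebra borel)"
  by (simp add: space_subprob_algebra prob_space_imp_subprob_space real_distribution_def
      real_distribution_axioms_def)

lemma
  assumes K: "\<And>k. real_distribution (K k)"
  shows emeasure_bind_pmf:
      "S \<in> sets borel \<Longrightarrow> emeasure (measure_pmf p \<bind> K) S = (\<integral>\<^sup>+k. emeasure (K k) S \<partial>measure_pmf p)"
    and real_distribution_bind_pmf: "real_distribution (measure_pmf p \<bind> K)"
proof -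
  have K_kernel: "K \<in> measurable (measure_pmf p) (subprob_algebra borel)"
    using K by (auto intro: real_distribution_imp_space_subprob_algebra)
  show emeasure_bind: "emeasure (measure_pmf p \<bind> K) S = (\<integral>\<^sup>+k. emeasure (K k) S \<partial>measure_pmf p)"
    if "S \<in> sets borel" for S
    using that by (simp add: emeasure_bind[OF _ K_kernel])
  have sets: "sets (measure_pmf p \<bind> K) = sets borel"
    using K by (intro sets_bind) (auto simp: real_distribution.events_eq_borel)
  have "emeasure (K k) UNIV = 1" for k
  proof -
    interpret real_distribution "K k" by (rule K)
    show ?thesis using emeasure_space_1 by simp
  qed
  then have "emeasure (measure_pmf p \<bind> K) UNIV = 1"
    by (simp add: emeasure_bind measure_pmf.emeasure_space_1[simplified])
  then have "prob_space (measure_pmf p \<bind> K)"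
    by (intro prob_spaceI) (simp add: space_eq_UNIV_if_sets_borel[OF sets])
  then show "real_distribution (measure_pmf p \<bind> K)"
    using sets by (simp add: real_distribution_def real_distribution_axioms_def)
qed

lemma integral_bind_pmf:
  fixes f :: "real \<Rightarrow> real"
  assumes K: "\<And>k. real_distribution (K k)" and f: "f \<in> borel_measurable borel" "\<And>x. \<bar>f x\<bar> \<le> c"
  shows "(\<integral>x. f x \<partial>(measure_pmf p \<bind> K)) = (\<integral>k. \<integral>x. f x \<partial>K k \<partial>measure_pmf p)"
proof (rule integral_bind[where B=c and B'=1 and K=borel])
  show "K \<in> measurable (measure_pmf p) (subprob_algebra borel)"
    using K by (auto intro: real_distribution_imp_space_subprob_algebra)
  show "AE k in measure_pmf p. emeasure (K k) (space (K k)) \<le> ennreal 1"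
    using K by (intro AE_I2) (simp add: prob_space.emeasure_space_1 real_distribution_def)
qed (use f in \<open>auto intro: measure_pmf.finite_measure_axioms\<close>)

lemma char_bind_pmf:
  assumes K: "\<And>k. real_distribution (K k)"
  shows "char (measure_pmf p \<bind> K) t = (\<integral>k. char (K k) t \<partial>measure_pmf p)"
proof -
  interpret B: real_distribution "measure_pmf p \<bind> K" using K by (rule real_distribution_bind_pmf)
  have iexp_int: "integrable (K k) (\<lambda>x. iexp (t * x))" for k
  proof -
    interpret real_distribution "K k" by (rule K)
    show ?thesis using integrable_iexp[of "\<lambda>x. complex_of_real (t * x)"] by simp
  qed
  have bind_iexp_int: "integrable (measure_pmf p \<bind> K) (\<lambda>x. iexp (t * x))"
    using B.integrable_iexp[of "\<lambda>x. complex_of_real (t * x)"] by simp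
  have char_int: "integrable (measure_pmf p) (\<lambda>k. char (K k) t)"
    by (rule measure_pmf.integrable_const_bound[where B=1])
       (use real_distribution.cmod_char_le_1[OF K] in auto)
  have bounds: "\<bar>Re (iexp (t * x))\<bar> \<le> 1" "\<bar>Im (iexp (t * x))\<bar> \<le> 1" for x
    using abs_Re_le_cmod[of "iexp (t * x)"] abs_Im_le_cmod[of "iexp (t * x)"]
    unfolding norm_exp_i_times .
  show ?thesis
  proof (rule complex_eqI)
    have "Re (char (measure_pmf p \<bind> K) t) = (\<integral>x. Re (iexp (t * x)) \<partial>(measure_pmf p \<bind> K))"
      unfolding char_def using bind_iexp_int by (subst integral_Re) auto
    also have "\<dots> = (\<integral>k. \<integral>x. Re (iexp (t * x)) \<partial>K k \<partial>measure_pmf p)"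
      using K bounds by (intro integral_bind_pmf) auto
    also have "\<dots> = (\<integral>k. Re (char (K k) t) \<partial>measure_pmf p)"
      unfolding char_def using iexp_int by (simp del: Re_exp)
    finally show "Re (char (measure_pmf p \<bind> K) t) = Re (\<integral>k. char (K k) t \<partial>measure_pmf p)"
      using char_int by simp
    have "Im (char (measure_pmf p \<bind> K) t) = (\<integral>x. Im (iexp (t * x)) \<partial>(measure_pmf p \<bind> K))"
      unfolding char_def using bind_iexp_int by (subst integral_Im) auto
    also have "\<dots> = (\<integral>k. \<integral>x. Im (iexp (t * x)) \<partial>K k \<partial>measure_pmf p)"
      using K bounds by (intro integral_bind_pmf) auto
    also have "\<dots> = (\<integral>k. Im (char (K k) t) \<partial>measure_pmf p)"
      unfolding char_def using iexp_int by (simp del: Im_exp)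
    finally show "Im (char (measure_pmf p \<bind> K) t) = Im (\<integral>k. char (K k) t \<partial>measure_pmf p)"
      using char_int by simp
  qed
qed

lemma real_distribution_compound_poisson:
  "real_distribution A \<Longrightarrow> real_distribution (compound_poisson r A)"
  unfolding compound_poisson_def by (intro real_distribution_bind_pmf real_distribution_convolution_power)

lemma emeasure_compound_poisson:
  assumes A: "real_distribution A" and r: "0 < r" and S: "S \<in> sets borel"
  shows "emeasure (compound_poisson r A) S
    = (\<Sum>k. ennreal (r ^ k / fact k * exp (- r)) * emeasure (convolution_power A k) S)"
  using r emeasure_bind_pmf[OF real_distribution_convolution_power[OF A] S, of "poisson_pmf r" "\<lambda>k. k"]
  by (simp add: compound_poisson_def nn_integral_measure_pmf nn_integral_count_space_nat)

lemma char_compound_poisson: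
  assumes A: "real_distribution A" and r: "0 < r"
  shows "char (compound_poisson r A) t = exp (complex_of_real r * (char A t - 1))"
proof -
  let ?p = "poisson_pmf r"
  interpret A: real_distribution A by fact
  have int: "integrable ?p (\<lambda>k. char A t ^ k)"
    by (rule measure_pmf.integrable_const_bound[where B=1])
       (use A.cmod_char_le_1[of t] in \<open>auto simp: norm_power power_le_one\<close>)
  have "char (compound_poisson r A) t = (\<integral>k. char A t ^ k \<partial>?p)"
    unfolding compound_poisson_def char_convolution_power[OF A, symmetric]
    by (intro char_bind_pmf real_distribution_convolution_power A)
  also have "\<dots> = (\<integral>k. pmf ?p k *\<^sub>R char A t ^ k \<partial>count_space UNIV)"
    unfolding measure_pmf_eq_density by (subst integral_density) auto
  also have "\<dots> = exp (complex_of_real r * (char A t - 1))"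
  proof (rule sums_unique2)
    show "(\<lambda>k. pmf ?p k *\<^sub>R char A t ^ k) sums (\<integral>k. pmf ?p k *\<^sub>R char A t ^ k \<partial>count_space UNIV)"
      using int unfolding measure_pmf_eq_density
      by (intro sums_integral_count_space_nat) (subst (asm) integrable_density, auto)
    have "(\<lambda>k. exp (- r) *\<^sub>R ((of_real r * char A t) ^ k /\<^sub>R fact k)) sums (exp (- r) *\<^sub>R exp (of_real r * char A t))"
      by (intro sums_scaleR_right exp_converges)
    moreover have "exp (- r) *\<^sub>R exp (of_real r * char A t) = exp (complex_of_real r * (char A t - 1))"
      by (simp add: scaleR_conv_of_real exp_of_real[symmetric] exp_add[symmetric] algebra_simps del: exp_of_real)
    moreover have "exp (- r) *\<^sub>R ((of_real r * char A t) ^ k /\<^sub>R fact k) = pmf ?p k *\<^sub>R char A t ^ k" for k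
      using r by (simp add: scaleR_conv_of_real power_mult_distrib field_simps)
    ultimately show "(\<lambda>k. pmf ?p k *\<^sub>R char A t ^ k) sums exp (complex_of_real r * (char A t - 1))"
      by simp
  qed
  finally show ?thesis .
qed

lemma atomic_mass_compound_poisson:
  assumes A: "real_distribution A" and r: "0 < r" and a: "atomic_mass A = ennreal a" "0 \<le> a"
  shows "atomic_mass (compound_poisson r A) = ennreal (exp (- (r * (1 - a))))"
proof -
  let ?w = "\<lambda>k. r ^ k / fact k * exp (- r)"
  have "atomic_mass (compound_poisson r A)
      = (\<integral>\<^sup>+x. (\<Sum>k. ennreal (?w k) * emeasure (convolution_power A k) {x}) \<partial>count_space UNIV)"
    by (simp add: atomic_mass_def emeasure_compound_poisson[OF A r])
  also have "\<dots> = (\<Sum>k. ennreal (?w k) * atomic_mass (convolution_power A k))"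
    by (subst nn_integral_suminf) (auto simp: nn_integral_cmult atomic_mass_def)
  also have "\<dots> = (\<Sum>k. ennreal (exp (- r) * ((r * a) ^ k /\<^sub>R fact k)))"
    using r a by (intro suminf_cong)
      (simp add: atomic_mass_convolution_power[OF A] ennreal_power ennreal_mult[symmetric] power_mult_distrib field_simps)
  also have "\<dots> = ennreal (exp (- r) * exp (r * a))"
    using r a(2) sums_mult[OF exp_converges[of "r * a"], of "exp (- r)"]
    by (intro suminf_ennreal_eq) auto
  also have "exp (- r) * exp (r * a) = exp (- (r * (1 - a)))"
    by (simp add: exp_add[symmetric] algebra_simps)
  finally show ?thesis .
qed

lemma compound_poisson_ge_term:
  assumes A: "real_distribution A" and r: "0 < r" and S: "S \<in> sets borel"
  shows "r ^ k / fact k * exp (- r) * measure (convolution_power A k) S \<le> measure (compound_poisson r A) S"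
proof -
  interpret C: real_distribution "compound_poisson r A" using A by (rule real_distribution_compound_poisson)
  interpret K: real_distribution "convolution_power A k" using A by (rule real_distribution_convolution_power)
  let ?f = "\<lambda>k. ennreal (r ^ k / fact k * exp (- r)) * emeasure (convolution_power A k) S"
  have "ennreal (r ^ k / fact k * exp (- r) * measure (convolution_power A k) S) = sum ?f {k}"
    using r by (simp add: K.emeasure_eq_measure flip: ennreal_mult)
  also have "\<dots> \<le> (\<Sum>k. ?f k)" by (rule sum_le_suminf) auto
  also have "\<dots> = ennreal (measure (compound_poisson r A) S)"
    using emeasure_compound_poisson[OF A r S] by (simp add: C.emeasure_eq_measure)
  finally show ?thesis by simp
qed

lemma poisson_weight_scale_le:
  fixes r s :: real
  assumes r: "0 < r" and s: "0 < s" "s \<le> 1"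
  shows "(s * r) ^ Suc k / fact (Suc k) * exp (- (s * r)) \<le> s * exp r * (r ^ Suc k / fact (Suc k) * exp (- r))"
proof -
  have "s ^ Suc k \<le> s" using s by (simp add: mult_left_le power_le_one)
  then have "(s * r) ^ Suc k / fact (Suc k) \<le> s * (r ^ Suc k / fact (Suc k))"
    using r mult_right_mono[of "s ^ Suc k" s "r ^ Suc k / fact (Suc k)"]
    by (simp add: power_mult_distrib del: power_Suc)
  then have "(s * r) ^ Suc k / fact (Suc k) * exp (- (s * r)) \<le> s * (r ^ Suc k / fact (Suc k)) * 1"
    using r s by (intro mult_mono) auto
  also have "\<dots> = s * exp r * (r ^ Suc k / fact (Suc k) * exp (- r))"
    by (simp add: exp_minus)
  finally show ?thesis .
qed

text \<open>Only the zeroth terms of the two series escape the comparison, and they are supported at the origin.\<close>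

lemma compound_poisson_scale_le:
  assumes A: "real_distribution A" and r: "0 < r" and s: "0 < s" "s \<le> 1"
    and S: "S \<in> sets borel" "0 \<notin> S"
  shows "measure (compound_poisson (s * r) A) S \<le> s * exp r * measure (compound_poisson r A) S"
proof -
  have sr_pos: "0 < s * r" using r s by simp
  interpret C: real_distribution "compound_poisson r A" using A by (rule real_distribution_compound_poisson)
  interpret C': real_distribution "compound_poisson (s * r) A" using A by (rule real_distribution_compound_poisson)
  let ?w = "\<lambda>r k. r ^ k / fact k * exp (- r)"
  have "emeasure (compound_poisson (s * r) A) S
      \<le> (\<Sum>k. ennreal (s * exp r) * (ennreal (?w r k) * emeasure (convolution_power A k) S))"
    unfolding emeasure_compound_poisson[OF A sr_pos S(1)]
  proof (intro suminf_le)
    fix k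
    show "ennreal (?w (s * r) k) * emeasure (convolution_power A k) S
        \<le> ennreal (s * exp r) * (ennreal (?w r k) * emeasure (convolution_power A k) S)"
    proof (cases k)
      case 0
      then show ?thesis using S by simp
    next
      case (Suc j)
      then have "ennreal (?w (s * r) k) \<le> ennreal (s * exp r * ?w r k)"
        using poisson_weight_scale_le[OF r s, of j] by (intro ennreal_leI) simp
      also have "\<dots> = ennreal (s * exp r) * ennreal (?w r k)"
        using s r by (intro ennreal_mult) auto
      finally show ?thesis by (simp add: mult_right_mono flip: mult.assoc)
    qed
  qed auto
  also have "\<dots> = ennreal (s * exp r) * emeasure (compound_poisson r A) S"
    by (simp add: emeasure_compound_poisson[OF A r S(1)])
  finally show ?thesis
    using s r by (simp add: C.emeasure_eq_measure C'.emeasure_eq_measure ennreal_mult[symmetric])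
qed

lemma convolution_power_1: "real_distribution A \<Longrightarrow> convolution_power A 1 = A"
  by (intro Levy_uniqueness ext real_distribution_convolution_power)
     (auto simp: char_convolution_power simp del: convolution_power.simps One_nat_def)

lemma measure_distr_translate:
  fixes M :: "real measure"
  assumes M: "sets M = sets borel" and S: "S \<in> sets borel"
  shows "measure (distr M borel (\<lambda>x. x + c)) S = measure M {x. x + c \<in> S}"
proof -
  have "(\<lambda>x. x + c) \<in> measurable M borel" using M by (simp cong: measurable_cong_sets)
  then show ?thesis
    using S by (simp add: measure_distr space_eq_UNIV_if_sets_borel[OF M] vimage_def)
qed

locale compound_poisson_family =
  fixes P :: "nat \<Rightarrow> real measure" and r d :: real and A :: "real measure"
  assumes r_pos: "0 < r" and A_dist: "real_distribution A" and A_zero: "measure A {0} = 0"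
    and P_eq: "1 \<le> n \<Longrightarrow> P n = distr (compound_poisson (r / real n) A) borel (\<lambda>x. x + d / real n)"
begin

lemma real_distribution_P:
  assumes "1 \<le> n"
  shows "real_distribution (P n)"
proof -
  interpret C: real_distribution "compound_poisson (r / real n) A"
    using A_dist by (rule real_distribution_compound_poisson)
  show ?thesis using assms by (simp add: P_eq)
qed

lemma measure_P:
  assumes "1 \<le> n" "S \<in> sets borel"
  shows "measure (P n) S = measure (compound_poisson (r / real n) A) {x. x + d / real n \<in> S}"
  using assms real_distribution_compound_poisson[OF A_dist]
  by (simp add: P_eq measure_distr_translate real_distribution.events_eq_borel)

lemma atomic_mass_P:
  assumes "1 \<le> n" "atomic_mass A = ennreal a" "0 \<le> a"
  shows "atomic_mass (P n) = ennreal (exp (- (r / real n * (1 - a))))"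
  using assms r_pos real_distribution_compound_poisson[OF A_dist]
  by (simp add: P_eq atomic_mass_translate real_distribution.events_eq_borel atomic_mass_compound_poisson A_dist)

abbreviation center :: "nat \<Rightarrow> real" where
  "center n \<equiv> d / real n"

definition shift :: "nat \<Rightarrow> real" where
  "shift n = d - center n"

lemma scaled_measure_P_le:
  assumes n: "1 \<le> n" and S: "S \<in> sets borel" "center n \<notin> S"
  shows "real n * measure (P n) S \<le> exp r * measure (P 1) {x. x - shift n \<in> S}"
proof -
  let ?S = "{x. x + center n \<in> S}"
  have sets: "?S \<in> sets borel" "{x. x - shift n \<in> S} \<in> sets borel"
    using S(1) by measurable
  have "measure (P n) S = measure (compound_poisson (1 / real n * r) A) ?S"
    using measure_P[OF n S(1)] by simp
  also have "\<dots> \<le> 1 / real n * exp r * measure (compound_poisson r A) ?S"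
    using n r_pos S sets by (intro compound_poisson_scale_le A_dist) auto
  also have "measure (compound_poisson r A) ?S = measure (P 1) {x. x - shift n \<in> S}"
    using sets by (simp add: measure_P shift_def algebra_simps)
  finally show ?thesis using n by (simp add: field_simps)
qed

lemma measure_P_center_ge:
  assumes "1 \<le> n"
  shows "1 - r / real n \<le> measure (P n) {center n}"
proof -
  have "1 - r / real n \<le> exp (- (r / real n))"
    using exp_ge_add_one_self[of "- (r / real n)"] by simp
  also have "\<dots> \<le> measure (P n) {center n}"
    using compound_poisson_ge_term[OF A_dist, of "r / real n" "{0}" 0] r_pos assms
    by (simp add: measure_P measure_return)
  finally show ?thesis .
qed

lemma measure_P_center_le:
  assumes n: "1 \<le> n"
  shows "r / real n * exp (- r) \<le> 1 - measure (P n) {center n}"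
proof -
  interpret A: real_distribution A by (rule A_dist)
  interpret P: real_distribution "P n" using n by (rule real_distribution_P)
  have "measure A (UNIV - {0}) = 1"
    using A.prob_compl[of "{0}"] A_zero by simp
  then have "r / real n * exp (- (r / real n)) \<le> measure (compound_poisson (r / real n) A) (UNIV - {0})"
    using compound_poisson_ge_term[OF A_dist, of "r / real n" "UNIV - {0}" 1] r_pos n
    by (simp add: convolution_power_1[OF A_dist] del: convolution_power.simps One_nat_def)
  moreover have "r / real n * exp (- r) \<le> r / real n * exp (- (r / real n))"
    using r_pos n by (intro mult_left_mono) (auto simp: divide_le_eq mult_left_le)
  moreover have "measure (compound_poisson (r / real n) A) (UNIV - {0}) = measure (P n) (UNIV - {center n})"
    using n by (subst measure_P) (auto intro!: arg_cong[where f="measure _"])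
  moreover have "measure (P n) (UNIV - {center n}) = 1 - measure (P n) {center n}"
    using P.prob_compl[of "{center n}"] by simp
  ultimately show ?thesis by linarith
qed

definition off_center_atom_mass :: "nat \<Rightarrow> real \<Rightarrow> real" where
  "off_center_atom_mass n = (atom_mass (P n))(center n := 0)"

lemma off_center_atom_mass_nonneg: "0 \<le> off_center_atom_mass n x"
  by (simp add: off_center_atom_mass_def)

lemma integral_off_center_atom_mass:
  assumes "1 \<le> n"
  shows "(\<integral>x. off_center_atom_mass n x \<partial>count_space UNIV)
    = (\<integral>x. atom_mass (P n) x \<partial>count_space UNIV) - measure (P n) {center n}"
proof -
  interpret P: real_distribution "P n" using assms by (rule real_distribution_P)
  have "off_center_atom_mass n = (\<lambda>x. atom_mass (P n) x - measure (P n) {center n} * indicator {center n} x)"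
    by (auto simp: off_center_atom_mass_def)
  moreover have "integrable (count_space UNIV) (\<lambda>x. measure (P n) {center n} * indicator {center n} x)"
    by (intro integrable_mult_right integrable_real_indicator) auto
  ultimately show ?thesis
    using P.integrable_atom_mass by simp
qed

lemma integral_off_center_atom_mass_le:
  assumes n: "1 \<le> n"
  shows "real n * (\<integral>x. off_center_atom_mass n x \<partial>count_space UNIV) \<le> r"
proof -
  interpret P: real_distribution "P n" using n by (rule real_distribution_P)
  have "(\<integral>x. off_center_atom_mass n x \<partial>count_space UNIV) \<le> r / real n"
    using P.integral_atom_mass_le P.prob_space measure_P_center_ge[OF n]
    by (simp add: integral_off_center_atom_mass[OF n])
  then show ?thesis using n by (simp add: field_simps)
qed

context
  assumes fin: "finite_atomic_entropy (P 1)"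
begin

lemma
  assumes n: "1 \<le> n"
  shows entropic_off_center: "entropic (count_space UNIV) (off_center_atom_mass n)"
    and shannon_entropy_off_center_le:
      "real n * shannon_entropy (count_space UNIV) (off_center_atom_mass n)
        \<le> r * ln (real n) + entropy_majorant (exp r) (count_space UNIV) (atom_mass (P 1))"
proof -
  let ?u = "\<lambda>x. atom_mass (P 1) (x + shift n)"
  have u: "entropic (count_space UNIV) ?u"
    by (rule entropic_translate[OF translation_invariant_count_space fin])
  have "real n * off_center_atom_mass n x \<le> exp r * ?u x" for x
  proof (cases "x = center n")
    case False
    have "{y. y - shift n \<in> {x}} = {x + shift n}" by auto
    then show ?thesis
      using scaled_measure_P_le[OF n, of "{x}"] False by (simp add: off_center_atom_mass_def)
  qed (simp add: off_center_atom_mass_def)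
  then have bounded_AE: "AE x in count_space UNIV. real n * off_center_atom_mass n x \<le> exp r * ?u x" by simp
  note dominated = u _ off_center_atom_mass_nonneg bounded_AE
  show "entropic (count_space UNIV) (off_center_atom_mass n)"
    using r_pos n by (intro entropic_scaled_dominated[OF dominated]) auto
  have "\<bar>real n * shannon_entropy (count_space UNIV) (off_center_atom_mass n)
        - real n * ln (real n) * (\<integral>x. off_center_atom_mass n x \<partial>count_space UNIV)\<bar>
      \<le> entropy_majorant (exp r) (count_space UNIV) ?u"
    using r_pos n by (intro abs_shannon_entropy_scaled_dominated_le[OF dominated]) auto
  moreover have "entropy_majorant (exp r) (count_space UNIV) ?u
      = entropy_majorant (exp r) (count_space UNIV) (atom_mass (P 1))"
    by (rule entropy_majorant_translate[OF translation_invariant_count_space fin])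
  moreover have "real n * ln (real n) * (\<integral>x. off_center_atom_mass n x \<partial>count_space UNIV) \<le> r * ln (real n)"
    using mult_left_mono[OF integral_off_center_atom_mass_le[OF n], of "ln (real n)"] n by (simp add: ac_simps)
  ultimately show "real n * shannon_entropy (count_space UNIV) (off_center_atom_mass n)
      \<le> r * ln (real n) + entropy_majorant (exp r) (count_space UNIV) (atom_mass (P 1))" by linarith
qed

lemma
  assumes n: "1 \<le> n"
  shows finite_atomic_entropy_P: "finite_atomic_entropy (P n)"
    and atomic_entropy_P:
      "atomic_entropy (P n) = eta (measure (P n) {center n}) + shannon_entropy (count_space UNIV) (off_center_atom_mass n)"
  using entropic_fun_upd_0D[OF entropic_off_center[OF n, unfolded off_center_atom_mass_def]]
    shannon_entropy_fun_upd_0[OF entropic_off_center[OF n, unfolded off_center_atom_mass_def]]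
  by (simp_all add: off_center_atom_mass_def)

lemma atomic_entropy_P_le:
  assumes n: "1 \<le> n"
  shows "real n * atomic_entropy (P n)
    \<le> r * ln (real n) + (r + entropy_majorant (exp r) (count_space UNIV) (atom_mass (P 1)))"
proof -
  have "eta (measure (P n) {center n}) \<le> 1 - measure (P n) {center n}"
    using eta_le_cross_entropy[of "measure (P n) {center n}" 1] by simp
  also have "\<dots> \<le> r / real n" using measure_P_center_ge[OF n] by simp
  finally have "real n * eta (measure (P n) {center n}) \<le> r"
    using n by (simp add: field_simps)
  then show ?thesis
    using shannon_entropy_off_center_le[OF n] by (simp add: atomic_entropy_P[OF n] distrib_left)
qed

lemma atomic_entropy_P_nonneg:
  assumes "1 \<le> n"
  shows "0 \<le> atomic_entropy (P n)"
proof -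
  interpret P: real_distribution "P n" using assms by (rule real_distribution_P)
  show ?thesis
    unfolding shannon_entropy_def by (intro Bochner_Integration.integral_nonneg eta_nonneg) auto
qed

lemma atomic_entropy_P_ge:
  assumes disc: "discrete_law (P n)" and n: "1 \<le> n" "r \<le> real n"
  shows "r * exp (- r) * ln (real n) - r * exp (- r) * ln r \<le> real n * atomic_entropy (P n)"
proof -
  interpret P: real_distribution "P n" using n(1) by (rule real_distribution_P)
  let ?\<delta> = "1 - measure (P n) {center n}"
  have "(\<integral>x. atom_mass (P n) x \<partial>count_space UNIV) = 1"
    using P.integral_discrete[OF disc, of "\<lambda>_. 1"] P.prob_space by simp
  then have "eta ?\<delta> \<le> shannon_entropy (count_space UNIV) (off_center_atom_mass n)"
    using eta_integral_le_shannon_entropy[OF entropic_off_center[OF n(1)]]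
    by (simp add: integral_off_center_atom_mass[OF n(1)])
  moreover have "0 \<le> eta (measure (P n) {center n})"
    by (intro eta_nonneg) auto
  ultimately have "eta ?\<delta> \<le> atomic_entropy (P n)"
    by (simp add: atomic_entropy_P[OF n(1)])
  have lower: "r / real n * exp (- r) \<le> ?\<delta>" and upper: "?\<delta> \<le> r / real n"
    using measure_P_center_le[OF n(1)] measure_P_center_ge[OF n(1)] by simp_all
  have "0 < r / real n * exp (- r)" using r_pos n by simp
  with lower have pos: "0 < ?\<delta>" by linarith
  then have "ln ?\<delta> \<le> ln (r / real n)" using upper by (intro ln_mono) auto
  then have "ln (real n) - ln r \<le> - ln ?\<delta>" using r_pos n by (simp add: ln_div)
  moreover have "0 \<le> ln (real n) - ln r" using n r_pos by (simp add: ln_mono)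
  ultimately have "r / real n * exp (- r) * (ln (real n) - ln r) \<le> ?\<delta> * - ln ?\<delta>"
    using lower pos by (intro mult_mono) auto
  also have "\<dots> = eta ?\<delta>"
    by (simp add: eta_def algebra_simps)
  also note \<open>eta ?\<delta> \<le> atomic_entropy (P n)\<close>
  finally have "real n * (r / real n * exp (- r) * (ln (real n) - ln r)) \<le> real n * atomic_entropy (P n)"
    by (rule mult_left_mono) simp
  then show ?thesis using n by (simp add: right_diff_distrib)
qed

end

lemma discrete_law_P:
  assumes disc: "discrete_law (P 1)" and n: "1 \<le> n"
  shows "discrete_law (P n)"
proof -
  interpret A: real_distribution A by (rule A_dist)
  interpret P1: real_distribution "P 1" by (rule real_distribution_P) simp
  interpret P: real_distribution "P n" using n by (rule real_distribution_P)
  have "atomic_mass A \<le> ennreal 1"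
    using A.nn_integral_atom_mass_le A.prob_space by (simp add: atomic_mass_def A.emeasure_eq_measure)
  then obtain a where a: "atomic_mass A = ennreal a" "0 \<le> a"
    by (cases "atomic_mass A") (auto simp: top_unique)
  have "atomic_mass (P 1) = emeasure (P 1) UNIV"
    using P1.M_is_borel disc by (rule atomic_mass_discrete_law)
  also have "\<dots> = 1"
    using P1.emeasure_space_1 unfolding P1.space_UNIV .
  finally have "exp (- (r * (1 - a))) = 1"
    using atomic_mass_P[OF _ a, of 1] by simp
  then have "a = 1" using r_pos by simp
  then have "atomic_mass (P n) = emeasure (P n) UNIV"
    using atomic_mass_P[OF n a] P.emeasure_space_1 by simp
  then show ?thesis by (rule P.discrete_law_if_atomic_mass)
qed

theorem ex_logarithmic_resolution_limit_discrete:
  assumes disc: "discrete_law (P 1)" and H: "dentropy (P 1) < \<infinity>"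
  shows "\<exists>mn \<zeta> c1 c2. 0 < c1 \<and> c1 \<le> c2 \<and>
    (\<forall>n\<ge>1. c1 * ln (real n) \<le> \<zeta> n \<and> \<zeta> n \<le> c2 * ln (real n)) \<and>
    uniform_resolution_limit P (\<lambda>n m. real n * enn2real (Hq m (P n))) \<zeta> mn"
proof -
  interpret P1: real_distribution "P 1" by (rule real_distribution_P) simp
  have fin: "finite_atomic_entropy (P 1)"
    using H P1.finite_atomic_entropy_iff_dentropy[OF P1.prob_le_1] by simp
  show ?thesis
  proof (rule ex_logarithmic_resolution_limit)
    fix n assume "max 1 (nat \<lceil>r\<rceil>) \<le> n"
    then have n: "1 \<le> n" "r \<le> real n" by linarith+
    interpret P: real_distribution "P n" using n(1) by (rule real_distribution_P)
    note quantized = discrete_law_P[OF disc n(1)] finite_atomic_entropy_P[OF fin n(1)]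
    show "r * exp (- r) * ln (real n) - r * exp (- r) * ln r \<le> real n * atomic_entropy (P n)"
      by (rule atomic_entropy_P_ge[OF fin discrete_law_P[OF disc n(1)] n])
    show "real n * atomic_entropy (P n)
        \<le> r * ln (real n) + (r + entropy_majorant (exp r) (count_space UNIV) (atom_mass (P 1)))"
      by (rule atomic_entropy_P_le[OF fin n(1)])
    show "(\<lambda>m. real n * enn2real (Hq m (P n))) \<longlonglongrightarrow> real n * atomic_entropy (P n)"
      unfolding P.enn2real_Hq by (intro tendsto_mult_left P.atomic_entropy_quantize_discrete_tendsto quantized)
    show "Hq m (P n) < \<infinity>" for m
      unfolding P.Hq_less_top_iff by (intro P.finite_atomic_entropy_quantize_discrete quantized)
  qed (use r_pos in simp)
qed

end

section \<open>Discrete-continuous laws\<close>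

abbreviation restricted :: "real measure \<Rightarrow> real set \<Rightarrow> real measure" where
  "restricted M S \<equiv> density M (indicator S)"

context finite_borel_measure
begin

lemma
  assumes S: "S \<in> sets borel"
  shows finite_borel_measure_restricted: "finite_borel_measure (restricted M S)"
    and measure_restricted_borel: "T \<in> sets borel \<Longrightarrow> measure (restricted M S) T = measure M (S \<inter> T)"
    and finite_borel_measure_cond_law: "finite_borel_measure (cond_law M S)"
    and measure_cond_law: "T \<in> sets borel \<Longrightarrow> measure (cond_law M S) T = measure M (S \<inter> T) / measure M S"
proof -
  have emeasure_eq: "emeasure (restricted M S) T = ennreal (measure M (S \<inter> T))" if "T \<in> sets borel" for T
    using S that by (simp add: emeasure_restricted M_is_borel emeasure_eq_measure)
  have emeasure_cond_eq: "emeasure (cond_law M S) T = ennreal (measure M (S \<inter> T) / measure M S)"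
    if "T \<in> sets borel" for T
    using that by (simp add: cond_law_def emeasure_eq ennreal_mult[symmetric])
  show "finite_borel_measure (restricted M S)"
    by (intro finite_borel_measure.intro finite_measureI finite_borel_measure_axioms.intro)
       (simp_all add: M_is_borel emeasure_eq)
  have "space (cond_law M S) = UNIV" "sets (cond_law M S) = sets borel"
    by (simp_all add: cond_law_def space_scale_measure M_is_borel)
  then show "finite_borel_measure (cond_law M S)"
    by (intro finite_borel_measure.intro finite_measureI finite_borel_measure_axioms.intro)
       (simp_all add: emeasure_cond_eq)
  show "measure (restricted M S) T = measure M (S \<inter> T)"
    and "measure (cond_law M S) T = measure M (S \<inter> T) / measure M S" if "T \<in> sets borel"
    using that by (simp_all add: measure_def emeasure_eq emeasure_cond_eq)
qed

end

context real_distribution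
begin

context
  fixes D assumes D: "dc_split M D"
begin

lemma dc_split_sets: "D \<in> sets borel" "UNIV - D \<in> sets borel"
  using D countable_in_sets_borel[of D] by (auto simp: dc_split_def)

lemma dc_split_compl: "measure M (UNIV - D) = 1 - measure M D"
  using prob_compl[of D] dc_split_sets by simp

lemma dc_split_null:
  assumes N: "N \<in> null_sets lborel"
  shows "measure M ((UNIV - D) \<inter> N) = 0"
proof -
  have "N \<in> null_sets (cond_law M (UNIV - D))"
    using D N by (auto simp: dc_split_def continuous_law_def absolutely_continuous_def)
  then have "measure (cond_law M (UNIV - D)) N = 0"
    by (auto simp: measure_def)
  moreover have "N \<in> sets borel" using N by auto
  ultimately show ?thesis
    using D dc_split_compl by (simp add: measure_cond_law[OF dc_split_sets(2)] dc_split_def)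
qed

lemma dc_split_atom_mass: "x \<notin> D \<Longrightarrow> measure M {x} = 0"
proof -
  assume "x \<notin> D"
  then have "(UNIV - D) \<inter> {x} = {x}" by auto
  then show ?thesis using dc_split_null[OF countable_imp_null_set_lborel, of "{x}"] by simp
qed

lemma atomic_mass_dc_split: "atomic_mass M = ennreal (measure M D)"
  using D dc_split_atom_mass
  by (subst atomic_mass_eq_emeasure[of _ D]) (auto simp: dc_split_def emeasure_eq_measure)

lemma dc_split_density_measure:
  "density_measure (restricted M (UNIV - D)) (dens (restricted M (UNIV - D)))"
proof (rule density_measure_dens)
  interpret continuous: finite_borel_measure "restricted M (UNIV - D)"
    using dc_split_sets(2) by (rule finite_borel_measure_restricted)
  show "finite_borel_measure (restricted M (UNIV - D))"
    by (rule continuous.finite_borel_measure_axioms)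
  show "absolutely_continuous lborel (restricted M (UNIV - D))"
    unfolding absolutely_continuous_def
  proof
    fix N :: "real set" assume N: "N \<in> null_sets lborel"
    then have "measure (restricted M (UNIV - D)) N = 0"
      using dc_split_null[OF N] by (subst measure_restricted_borel[OF dc_split_sets(2)]) auto
    then show "N \<in> null_sets (restricted M (UNIV - D))"
      using N by (intro null_setsI) (auto simp: continuous.emeasure_eq_measure)
  qed
qed

lemma dc_split_entropic_density:
  assumes wd: "dentropy_wd (cond_law M (UNIV - D))"
  shows "entropic lborel (dens (restricted M (UNIV - D)))"
proof -
  interpret continuous: density_measure "restricted M (UNIV - D)" "dens (restricted M (UNIV - D))"
    by (rule dc_split_density_measure)
  have finite: "finite_borel_measure (cond_law M (UNIV - D))"
    using dc_split_sets(2) by (rule finite_borel_measure_cond_law)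
  have q: "0 < measure M (UNIV - D)" "measure M (UNIV - D) \<le> 1"
    using D dc_split_compl by (simp_all add: dc_split_def)
  have "AE x in lborel. dens (restricted M (UNIV - D)) x \<le> 1 * dens (cond_law M (UNIV - D)) x"
  proof (rule density_measure_AE_le[OF dc_split_density_measure density_measure_dens[OF finite]])
    show "absolutely_continuous lborel (cond_law M (UNIV - D))"
      using wd by (simp add: dentropy_wd_def)
    fix S :: "real set" assume "S \<in> sets borel"
    then show "measure (restricted M (UNIV - D)) S \<le> 1 * measure (cond_law M (UNIV - D)) S"
      using q by (simp add: measure_restricted_borel measure_cond_law dc_split_sets(2) le_divide_eq mult_left_le)
  qed
  then show ?thesis
    by (rule entropic_dominated[OF entropic_dens[OF finite wd], rotated 2])
       (simp_all add: continuous.nonneg_density)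
qed

lemma finite_atomic_entropy_dc_split:
  assumes H: "dentropy (cond_law M D) < \<infinity>"
  shows "finite_atomic_entropy M"
proof -
  interpret conditional: finite_borel_measure "cond_law M D"
    using dc_split_sets(1) by (rule finite_borel_measure_cond_law)
  have "measure (cond_law M D) UNIV \<le> 1"
    using D by (simp add: measure_cond_law[OF dc_split_sets(1)] dc_split_def)
  with H have fin: "finite_atomic_entropy (cond_law M D)"
    by (simp add: conditional.finite_atomic_entropy_iff_dentropy)
  have "atom_mass M x \<le> 1 * atom_mass (cond_law M D) x" for x
  proof (cases "x \<in> D")
    case True
    then have "D \<inter> {x} = {x}" by auto
    then show ?thesis
      using D by (simp add: measure_cond_law[OF dc_split_sets(1)] dc_split_def le_divide_eq mult_left_le)
  qed (simp add: dc_split_atom_mass)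
  then show ?thesis
    by (intro entropic_dominated[OF fin, where C=1]) auto
qed

theorem
  assumes wd: "dentropy_wd (cond_law M (UNIV - D))"
    and fin: "finite_atomic_entropy M" "finite_atomic_entropy (quantize 1 M)"
  shows finite_atomic_entropy_quantize_dc_split: "1 \<le> m \<Longrightarrow> finite_atomic_entropy (quantize m M)"
    and atomic_entropy_quantize_dc_split_tendsto:
      "(\<lambda>m. atomic_entropy (quantize m M) - (1 - measure M D) * ln (real m))
        \<longlonglongrightarrow> atomic_entropy M + shannon_entropy lborel (dens (restricted M (UNIV - D)))"
proof -
  let ?A = "restricted M D" and ?B = "restricted M (UNIV - D)"
  interpret A: finite_borel_measure ?A using dc_split_sets(1) by (rule finite_borel_measure_restricted)
  have "measure ?A (UNIV - D) = 0"
    using dc_split_sets by (simp add: measure_restricted_borel)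
  then have disc: "discrete_law ?A"
    using D by (auto simp: discrete_law_def dc_split_def A.emeasure_eq_measure)
  have atoms: "atom_mass ?A = atom_mass M"
  proof
    fix x show "atom_mass ?A x = atom_mass M x"
      using dc_split_atom_mass[of x] dc_split_sets by (cases "x \<in> D") (simp_all add: measure_restricted_borel)
  qed
  have mass: "measure ?B UNIV = 1 - measure M D"
    using dc_split_sets(2) by (simp add: measure_restricted_borel dc_split_compl)
  have split: "measure M S = measure ?A S + measure ?B S" if "S \<in> sets borel" for S
    using that dc_split_sets
    by (simp add: measure_restricted_borel) (subst finite_measure_Union[symmetric], auto intro!: arg_cong[where f=prob])
  note mixture = A.finite_borel_measure_axioms disc _ dc_split_density_measure dc_split_entropic_density[OF wd] _
    finite_borel_measure_axioms split fin(2)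
  show "finite_atomic_entropy (quantize m M)" if "1 \<le> m"
    using D that fin(1) by (intro finite_atomic_entropy_quantize_mixture[OF mixture]) (simp_all add: atoms mass dc_split_def)
  show "(\<lambda>m. atomic_entropy (quantize m M) - (1 - measure M D) * ln (real m))
      \<longlonglongrightarrow> atomic_entropy M + shannon_entropy lborel (dens ?B)"
    using atomic_entropy_quantize_mixture_tendsto[OF mixture] D fin(1) by (simp add: atoms mass dc_split_def)
qed

end

end

lemma scaled_one_minus_exp_ge:
  assumes "0 < x" "1 \<le> n"
  shows "x / (1 + x) \<le> real n * (1 - exp (- (x / real n)))"
proof -
  have "exp (- (x / real n)) \<le> 1 / (1 + x / real n)"
    using exp_ge_add_one_self[of "x / real n"] assms by (simp add: exp_minus field_simps add_pos_pos)
  then have "real n * (1 - 1 / (1 + x / real n)) \<le> real n * (1 - exp (- (x / real n)))"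
    by (intro mult_left_mono) auto
  moreover have "real n * (1 - 1 / (1 + x / real n)) = x / (1 + x / real n)"
    using assms by (simp add: field_simps add_pos_pos)
  moreover have "x / (1 + x) \<le> x / (1 + x / real n)"
    using assms by (intro divide_left_mono) (auto simp: divide_le_eq add_pos_pos mult_le_cancel_left1)
  ultimately show ?thesis by linarith
qed

lemma quotient_bounds_if_abs_diff_le:
  fixes a b c K L Q \<rho> :: real
  assumes "0 < \<rho>" "\<rho> \<le> Q" and b: "\<bar>b - Q * L\<bar> \<le> K" and a: "0 \<le> a" "a \<le> c"
  shows "L - K / \<rho> \<le> (a + b) / Q" "(a + b) / Q \<le> L + (c + K) / \<rho>"
proof -
  have Q: "0 < Q" using assms by simp
  have "K / Q \<le> K / \<rho>" "(c + K) / Q \<le> (c + K) / \<rho>"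
    using assms Q by (auto intro!: divide_left_mono)
  moreover have "(Q * L - K) / Q \<le> (a + b) / Q" "(a + b) / Q \<le> (Q * L + (c + K)) / Q"
    using b a Q by (auto intro!: divide_right_mono)
  moreover have "(Q * L - K) / Q = L - K / Q" "(Q * L + (c + K)) / Q = L + (c + K) / Q"
    using Q by (simp_all add: diff_divide_distrib add_divide_distrib)
  ultimately show "L - K / \<rho> \<le> (a + b) / Q" "(a + b) / Q \<le> L + (c + K) / \<rho>" by linarith+
qed

context compound_poisson_family
begin

lemma continuous_part_scaled_le:
  assumes D: "dc_split (P 1) D" and n: "1 \<le> n" and Dn: "dc_split (P n) Dn" and S: "S \<in> sets borel"
  shows "real n * measure (restricted (P n) (UNIV - Dn)) S
    \<le> exp r * measure (restricted (P 1) (UNIV - D)) {x. x - shift n \<in> S}"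
proof -
  interpret P1: real_distribution "P 1" by (rule real_distribution_P) simp
  interpret Pn: real_distribution "P n" using n by (rule real_distribution_P)
  note sets_D = P1.dc_split_sets[OF D] and sets_Dn = Pn.dc_split_sets[OF Dn]
  \<comment> \<open>X is null for the continuous part of P n, and the translate of its complement avoids D.\<close>
  let ?X = "insert (center n) ((\<lambda>x. x - shift n) ` D)"
  have "countable ?X" using D by (auto simp: dc_split_def)
  then have X: "?X \<in> sets borel" "?X \<in> null_sets lborel"
    by (auto intro: countable_in_sets_borel countable_imp_null_set_lborel)
  have S_off_X: "S - ?X \<in> sets borel" using S X(1) by (rule sets.Diff)
  have "{x. x - shift n \<in> S} = (\<lambda>x. x - shift n) -` S" by auto
  then have S_shifted: "{x. x - shift n \<in> S} \<in> sets borel"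
    using S measurable_sets[of "\<lambda>x. x - shift n" borel borel S] by simp
  have "measure (restricted (P n) (UNIV - Dn)) S = measure (P n) ((UNIV - Dn) \<inter> S)"
    using S sets_Dn by (simp add: Pn.measure_restricted_borel)
  also have "\<dots> \<le> measure (P n) ((S - ?X) \<union> ((UNIV - Dn) \<inter> ?X))"
    using S_off_X sets_Dn X(1) by (intro Pn.finite_measure_mono) auto
  also have "\<dots> \<le> measure (P n) (S - ?X) + measure (P n) ((UNIV - Dn) \<inter> ?X)"
    using S_off_X sets_Dn X(1) by (intro measure_Un_le) auto
  also have "measure (P n) ((UNIV - Dn) \<inter> ?X) = 0"
    using X(2) by (rule Pn.dc_split_null[OF Dn])
  finally have "real n * measure (restricted (P n) (UNIV - Dn)) S \<le> real n * measure (P n) (S - ?X)"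
    by (intro mult_left_mono) auto
  also have "\<dots> \<le> exp r * measure (P 1) {x. x - shift n \<in> S - ?X}"
    by (rule scaled_measure_P_le[OF n S_off_X]) auto
  also have "\<dots> \<le> exp r * measure (P 1) ((UNIV - D) \<inter> {x. x - shift n \<in> S})"
  proof (intro mult_left_mono P1.finite_measure_mono)
    show "(UNIV - D) \<inter> {x. x - shift n \<in> S} \<in> sets (P 1)"
      unfolding P1.events_eq_borel using S_shifted sets_D by (intro sets.Int)
  qed auto
  also have "\<dots> = exp r * measure (restricted (P 1) (UNIV - D)) {x. x - shift n \<in> S}"
    unfolding P1.measure_restricted_borel[OF sets_D(2) S_shifted] ..
  finally show ?thesis .
qed

lemma abs_shannon_entropy_continuous_part_le:
  assumes D: "dc_split (P 1) D" "dentropy_wd (cond_law (P 1) (UNIV - D))"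
    and n: "1 \<le> n" and Dn: "dc_split (P n) Dn"
  defines "g \<equiv> dens (restricted (P 1) (UNIV - D))" and "gn \<equiv> dens (restricted (P n) (UNIV - Dn))"
  shows "\<bar>real n * shannon_entropy lborel gn - real n * ln (real n) * (1 - measure (P n) Dn)\<bar>
    \<le> entropy_majorant (exp r) lborel g"
proof -
  interpret P1: real_distribution "P 1" by (rule real_distribution_P) simp
  interpret Pn: real_distribution "P n" using n by (rule real_distribution_P)
  let ?B = "restricted (P 1) (UNIV - D)" and ?Bn = "restricted (P n) (UNIV - Dn)"
  interpret B: density_measure ?B g
    unfolding g_def using D(1) by (rule P1.dc_split_density_measure)
  interpret Bn: density_measure ?Bn gn
    unfolding gn_def using Dn by (rule Pn.dc_split_density_measure)
  have translated: "density_measure (distr ?B borel (\<lambda>x. x + - shift n)) (\<lambda>x. g (x + shift n))"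
    using B.density_measure_affine[of 1 "shift n"] by (simp add: add.commute)
  have "AE x in lborel. gn x \<le> exp r / real n * g (x + shift n)"
  proof (rule density_measure_AE_le[OF Bn.density_measure_axioms translated])
    fix S :: "real set" assume S: "S \<in> sets borel"
    show "measure ?Bn S \<le> exp r / real n * measure (distr ?B borel (\<lambda>x. x + - shift n)) S"
      unfolding measure_distr_translate[OF B.M_is_borel S]
      using continuous_part_scaled_le[OF D(1) n Dn S] n by (simp add: field_simps)
  qed
  then have bounded_AE: "AE x in lborel. real n * gn x \<le> exp r * g (x + shift n)"
    by eventually_elim (use n in \<open>simp add: field_simps\<close>)
  have g: "entropic lborel g"
    unfolding g_def by (rule P1.dc_split_entropic_density[OF D])
  have "\<bar>real n * shannon_entropy lborel gn - real n * ln (real n) * (\<integral>x. gn x \<partial>lborel)\<bar>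
      \<le> entropy_majorant (exp r) lborel (\<lambda>x. g (x + shift n))"
    using r_pos n bounded_AE
    by (intro abs_shannon_entropy_scaled_dominated_le entropic_translate translation_invariant_lborel g)
       (auto simp: Bn.nonneg_density)
  also have "\<dots> = entropy_majorant (exp r) lborel g"
    by (rule entropy_majorant_translate[OF translation_invariant_lborel g])
  also have "(\<integral>x. gn x \<partial>lborel) = 1 - measure (P n) Dn"
    using Pn.dc_split_sets(2)[OF Dn]
    by (simp add: Bn.integral_density_eq Pn.measure_restricted_borel Pn.dc_split_compl[OF Dn])
  finally show ?thesis .
qed

lemma entropy_dc_split_P_bounds:
  assumes D: "dc_split (P 1) D" "dentropy_wd (cond_law (P 1) (UNIV - D))" and fin: "finite_atomic_entropy (P 1)"
    and n: "1 \<le> n" and Dn: "dc_split (P n) Dn" and \<rho>: "0 < \<rho>" "\<rho> \<le> real n * (1 - measure (P n) Dn)"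
  defines "H \<equiv> (atomic_entropy (P n) + shannon_entropy lborel (dens (restricted (P n) (UNIV - Dn))))
      / (1 - measure (P n) Dn)"
    and "K1 \<equiv> r + entropy_majorant (exp r) (count_space UNIV) (atom_mass (P 1))"
    and "K2 \<equiv> entropy_majorant (exp r) lborel (dens (restricted (P 1) (UNIV - D)))"
  shows "ln (real n) - K2 / \<rho> \<le> H" and "H \<le> (1 + r / \<rho>) * ln (real n) + (K1 + K2) / \<rho>"
proof -
  let ?h = "shannon_entropy lborel (dens (restricted (P n) (UNIV - Dn)))"
  have cont: "\<bar>real n * ?h - real n * (1 - measure (P n) Dn) * ln (real n)\<bar> \<le> K2"
    using abs_shannon_entropy_continuous_part_le[OF D n Dn] by (simp add: K2_def mult_ac)
  have disc: "0 \<le> real n * atomic_entropy (P n)" "real n * atomic_entropy (P n) \<le> r * ln (real n) + K1"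
    using atomic_entropy_P_nonneg[OF fin n] atomic_entropy_P_le[OF fin n] by (simp_all add: K1_def)
  have "H = (real n * atomic_entropy (P n) + real n * ?h) / (real n * (1 - measure (P n) Dn))"
    using n by (simp add: H_def flip: distrib_left)
  then show "ln (real n) - K2 / \<rho> \<le> H" "H \<le> (1 + r / \<rho>) * ln (real n) + (K1 + K2) / \<rho>"
    using quotient_bounds_if_abs_diff_le[OF \<rho> cont disc] by (simp_all only: distrib_right add_divide_distrib) simp_all
qed

theorem ex_logarithmic_resolution_limit_if_dc_split:
  assumes D: "dc_split (P 1) D" and HD: "dentropy (cond_law (P 1) D) < \<infinity>"
    and fin_quantized: "\<And>n. 1 \<le> n \<Longrightarrow> finite_atomic_entropy (quantize 1 (P n))"
    and Dn: "\<forall>n\<ge>1. \<exists>Dn. dc_split (P n) Dn \<and> dentropy_wd (cond_law (P n) (UNIV - Dn))"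
    and a: "atomic_mass A = ennreal a" "0 \<le> a" "a < 1"
  shows "\<exists>mn \<zeta> c1 c2. 0 < c1 \<and> c1 \<le> c2 \<and>
    (\<forall>n\<ge>1. c1 * ln (real n) \<le> \<zeta> n \<and> \<zeta> n \<le> c2 * ln (real n)) \<and>
    uniform_resolution_limit P (\<lambda>n m. real n * enn2real (Hq m (P n))
      / (real n * (1 - exp (- (r / real n) * (1 - a)))) - ln (real m)) \<zeta> mn"
proof -
  interpret P1: real_distribution "P 1" by (rule real_distribution_P) simp
  note fin = P1.finite_atomic_entropy_dc_split[OF D HD]
  obtain E where E: "\<And>n. 1 \<le> n \<Longrightarrow> dc_split (P n) (E n)"
      "\<And>n. 1 \<le> n \<Longrightarrow> dentropy_wd (cond_law (P n) (UNIV - E n))"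
    using Dn by metis
  define x where "x = r * (1 - a)"
  have x: "0 < x" using r_pos a by (simp add: x_def)
  define q where "q n = 1 - exp (- (r / real n) * (1 - a))" for n
  have q_eq: "1 - measure (P n) (E n) = q n" if n: "1 \<le> n" for n
    using real_distribution.atomic_mass_dc_split[OF real_distribution_P[OF n] E(1)[OF n]] atomic_mass_P[OF n a(1,2)]
    by (simp add: q_def)
  define \<rho> where "\<rho> = x / (1 + x)"
  have \<rho>: "0 < \<rho>" using x by (simp add: \<rho>_def)
  have scaled_q_ge: "\<rho> \<le> real n * q n" if "1 \<le> n" for n
    using scaled_one_minus_exp_ge[OF x that] by (simp add: q_def x_def \<rho>_def)
  let ?H = "\<lambda>n. (atomic_entropy (P n) + shannon_entropy lborel (dens (restricted (P n) (UNIV - E n)))) / q n"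
  define K1 K2 where "K1 = r + entropy_majorant (exp r) (count_space UNIV) (atom_mass (P 1))"
    and "K2 = entropy_majorant (exp r) lborel (dens (restricted (P 1) (UNIV - E 1)))"
  show ?thesis
  proof (rule ex_logarithmic_resolution_limit)
    fix n :: nat assume n: "1 \<le> n"
    interpret Pn: real_distribution "P n" using n by (rule real_distribution_P)
    show "1 * ln (real n) - K2 / \<rho> \<le> ?H n" "?H n \<le> (1 + r / \<rho>) * ln (real n) + (K1 + K2) / \<rho>"
      using entropy_dc_split_P_bounds[OF E[OF order_refl] fin n E(1)[OF n] \<rho>, unfolded q_eq[OF n], OF scaled_q_ge[OF n]]
      by (simp_all add: K1_def K2_def)
    have "0 < real n * q n" using \<rho> scaled_q_ge[OF n] by (rule less_le_trans)
    then have q_pos: "0 < q n" using n by (simp add: zero_less_mult_iff)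
    note quantized = E(1)[OF n] E(2)[OF n] finite_atomic_entropy_P[OF fin n] fin_quantized[OF n]
    show "Hq m (P n) < \<infinity>" if "1 \<le> m" for m
      unfolding Pn.Hq_less_top_iff using quantized that by (rule Pn.finite_atomic_entropy_quantize_dc_split)
    have "(\<lambda>m. (atomic_entropy (quantize m (P n)) - q n * ln (real m)) / q n) \<longlonglongrightarrow> ?H n"
      using Pn.atomic_entropy_quantize_dc_split_tendsto[OF quantized] q_pos
      unfolding q_eq[OF n] by (intro tendsto_divide tendsto_const) auto
    then show "(\<lambda>m. real n * enn2real (Hq m (P n)) / (real n * (1 - exp (- (r / real n) * (1 - a)))) - ln (real m))
        \<longlonglongrightarrow> ?H n"
      using q_pos n unfolding q_def [symmetric] by (simp add: Pn.enn2real_Hq diff_divide_distrib)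
  qed simp
qed

end

section \<open>Levy exponents with a finite Levy measure\<close>

definition normalize_law :: "real measure \<Rightarrow> real measure" where
  "normalize_law M = density M (\<lambda>_. ennreal (1 / measure M UNIV))"

context finite_borel_measure
begin

lemma emeasure_normalize_law:
  "S \<in> sets borel \<Longrightarrow> emeasure (normalize_law M) S = ennreal (1 / measure M UNIV) * emeasure M S"
  unfolding normalize_law_def
  by (subst emeasure_density) (auto simp: M_is_borel nn_integral_cmult_indicator)

lemma atomic_mass_normalize_law: "atomic_mass (normalize_law M) = ennreal (1 / measure M UNIV) * atomic_mass M"
  by (simp add: atomic_mass_def emeasure_normalize_law nn_integral_cmult)

lemma real_distribution_normalize_law:
  assumes "0 < measure M UNIV"
  shows "real_distribution (normalize_law M)"
proof -
  have "emeasure (normalize_law M) UNIV = 1"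
    using assms by (simp add: emeasure_normalize_law emeasure_eq_measure ennreal_mult[symmetric])
  then have "prob_space (normalize_law M)"
    by (intro prob_spaceI) (simp add: normalize_law_def)
  then show ?thesis
    by (simp add: real_distribution_def real_distribution_axioms_def normalize_law_def M_is_borel)
qed

lemma integrable_iexp_finite: "integrable M (\<lambda>x. iexp (t * x))"
  by (rule integrable_const_bound[where B=1]) (auto simp: M_is_borel cong: measurable_cong_sets)

lemma char_normalize_law:
  assumes "0 < measure M UNIV"
  shows "complex_of_real (measure M UNIV) * char (normalize_law M) t = (\<integral>x. iexp (t * x) \<partial>M)"
proof -
  note [measurable_cong] = M_is_borel
  have "char (normalize_law M) t = (\<integral>x. (1 / measure M UNIV) *\<^sub>R iexp (t * x) \<partial>M)"
    unfolding char_def normalize_law_def by (subst integral_density) auto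
  then show ?thesis using assms by (simp add: scaleR_conv_of_real)
qed

lemma levy_exponent_finite:
  assumes "0 < measure M UNIV"
  shows "levy_exponent \<mu> \<sigma> M t = - complex_of_real (\<sigma>\<^sup>2 / 2 * t\<^sup>2)
    + \<i> * complex_of_real (t * (\<mu> - (\<integral>a. a * indicator {-1<..<1} a \<partial>M)))
    + complex_of_real (measure M UNIV) * (char (normalize_law M) t - 1)"
proof -
  note [measurable_cong] = M_is_borel
  let ?small = "\<lambda>a. a * indicator {-1<..<1} a :: real"
  define J where "J a = complex_of_real (t * ?small a)" for a
  have small_int: "integrable M ?small"
    by (rule integrable_const_bound[where B=1]) (auto simp: indicator_def)
  then have J_int: "integrable M J" unfolding J_def [abs_def] by (intro integrable_of_real integrable_mult_right)
  have "(\<integral>a. iexp (t * a) - 1 - \<i> * complex_of_real (t * a * indicator {-1<..<1} a) \<partial>M)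
      = (\<integral>a. iexp (t * a) - 1 - \<i> * J a \<partial>M)"
    by (simp only: J_def mult.assoc)
  also have "\<dots> = (\<integral>a. iexp (t * a) \<partial>M) - complex_of_real (measure M UNIV) - \<i> * (\<integral>a. J a \<partial>M)"
    using integrable_iexp_finite[of t] J_int by (simp add: scaleR_conv_of_real)
  also have "(\<integral>a. J a \<partial>M) = complex_of_real (\<integral>a. t * ?small a \<partial>M)"
    unfolding J_def [abs_def] using small_int by (intro integral_of_real integrable_mult_right)
  also have "(\<integral>a. t * ?small a \<partial>M) = t * (\<integral>a. ?small a \<partial>M)"
    by (rule integral_mult_right_zero)
  finally show ?thesis
    unfolding levy_exponent_def char_normalize_law[OF assms, symmetric] by (simp add: algebra_simps)
qed

end

lemma char_distr_affine:
  assumes "real_distribution M"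
  shows "char (distr M borel (\<lambda>x. s * x + c)) t = iexp (t * c) * char M (t * s)"
proof -
  interpret real_distribution M by fact
  have "char (distr M borel (\<lambda>x. s * x + c)) t = (\<integral>x. iexp (t * c) * iexp (t * s * x) \<partial>M)"
    unfolding char_def by (subst integral_distr) (auto simp: exp_add[symmetric] algebra_simps)
  then show ?thesis by (simp add: char_def)
qed

lemma ex_atomless_gaussian:
  assumes "\<sigma> \<noteq> 0"
  obtains G where "real_distribution G" "atomic_mass G = 0"
    "\<And>t. char G t = exp (- complex_of_real (\<sigma>\<^sup>2 / 2 * t\<^sup>2))"
proof
  interpret normal: real_distribution std_normal_distribution by (rule real_dist_normal_dist)
  let ?G = "distr std_normal_distribution borel (\<lambda>x. \<sigma> * x + 0)"
  show "real_distribution ?G" by (rule normal.real_distribution_distr) simp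
  have "emeasure ?G {x} = 0" for x
  proof -
    have "(\<lambda>x. \<sigma> * x + 0) -` {x} = {x / \<sigma>}" using assms by auto
    then have "emeasure ?G {x} = emeasure std_normal_distribution {x / \<sigma>}"
      by (simp add: emeasure_distr)
    also have "\<dots> = 0" by (simp add: emeasure_density nn_integral_cmult_indicator)
    finally show ?thesis .
  qed
  then show "atomic_mass ?G = 0" by (simp add: atomic_mass_def)
  fix t
  have "char ?G t = complex_of_real (exp (- (\<sigma>\<^sup>2 / 2 * t\<^sup>2)))"
    by (simp only: char_distr_affine[OF normal.real_distribution_axioms] char_std_normal_distribution)
       (simp add: power_mult_distrib mult.commute)
  also have "\<dots> = exp (complex_of_real (- (\<sigma>\<^sup>2 / 2 * t\<^sup>2)))" by (rule exp_of_real[symmetric])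
  finally show "char ?G t = exp (- complex_of_real (\<sigma>\<^sup>2 / 2 * t\<^sup>2))" by (simp only: of_real_minus)
qed

locale finite_levy = finite_borel_measure \<nu> for \<nu> :: "real measure" +
  fixes \<mu> \<sigma> :: real and P :: "nat \<Rightarrow> real measure"
  assumes mass_pos: "0 < measure \<nu> UNIV" and zero_atom: "measure \<nu> {0} = 0"
    and laws: "\<forall>n\<ge>1. real_distribution (P n) \<and>
                 char (P n) = (\<lambda>\<omega>. exp (levy_exponent \<mu> \<sigma> \<nu> \<omega> / of_nat n))"
begin

abbreviation rate :: real where "rate \<equiv> measure \<nu> UNIV"
abbreviation jump_law :: "real measure" where "jump_law \<equiv> normalize_law \<nu>"
definition drift :: real where "drift = \<mu> - (\<integral>a. a * indicator {-1<..<1} a \<partial>\<nu>)"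

lemma real_distribution_jump_law: "real_distribution jump_law"
  using mass_pos by (rule real_distribution_normalize_law)

lemma char_P:
  "1 \<le> n \<Longrightarrow> char (P n) t = exp ((- complex_of_real (\<sigma>\<^sup>2 / 2 * t\<^sup>2)
     + \<i> * complex_of_real (t * drift) + complex_of_real rate * (char jump_law t - 1)) / of_nat n)"
  using laws by (simp add: levy_exponent_finite[OF mass_pos] drift_def)

lemma char_translated_compound_poisson:
  assumes n: "1 \<le> n"
  shows "char (distr (compound_poisson (rate / real n) jump_law) borel (\<lambda>x. x + drift / real n)) t
    = exp ((\<i> * complex_of_real (t * drift) + complex_of_real rate * (char jump_law t - 1)) / of_nat n)"
proof -
  have "char (distr (compound_poisson (rate / real n) jump_law) borel (\<lambda>x. x + drift / real n)) t
      = iexp (t * (drift / real n)) * char (compound_poisson (rate / real n) jump_law) t"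
    using char_distr_affine[OF real_distribution_compound_poisson[OF real_distribution_jump_law], where s=1] by simp
  also have "\<dots> = exp (\<i> * complex_of_real (t * (drift / real n)) + complex_of_real (rate / real n) * (char jump_law t - 1))"
    using n mass_pos by (subst char_compound_poisson[OF real_distribution_jump_law]) (simp_all add: exp_add)
  also have "\<dots> = exp ((\<i> * complex_of_real (t * drift) + complex_of_real rate * (char jump_law t - 1)) / of_nat n)"
    by (simp add: add_divide_distrib)
  finally show ?thesis .
qed

lemma no_gaussian_part_if_atoms:
  assumes "atomic_mass (P 1) \<noteq> 0"
  shows "\<sigma> = 0"
proof (rule ccontr)
  assume "\<sigma> \<noteq> 0"
  then obtain G where G: "real_distribution G" "atomic_mass G = 0"
    "\<And>t. char G t = exp (- complex_of_real (\<sigma>\<^sup>2 / 2 * t\<^sup>2))"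
    by (rule ex_atomless_gaussian) blast
  let ?R = "distr (compound_poisson rate jump_law) borel (\<lambda>x. x + drift)"
  interpret compound: real_distribution "compound_poisson rate jump_law"
    by (intro real_distribution_compound_poisson real_distribution_jump_law)
  have R: "real_distribution ?R" by simp
  have "P 1 = (G \<star> ?R)"
  proof (rule convolution_eqI_char[OF _ G(1) R])
    show "real_distribution (P 1)" using laws by simp
    fix t
    let ?R_exponent = "\<i> * complex_of_real (t * drift) + complex_of_real rate * (char jump_law t - 1)"
    have "char ?R t = exp ?R_exponent"
      using char_translated_compound_poisson[of 1 t] by simp
    moreover have "char (P 1) t = exp (- complex_of_real (\<sigma>\<^sup>2 / 2 * t\<^sup>2) + ?R_exponent)"
      unfolding char_P[OF order_refl] by (simp only: of_nat_1 div_by_1 add.assoc)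
    ultimately show "char (P 1) t = char G t * char ?R t"
      unfolding G(3) by (simp only: exp_add)
  qed
  then show False
    using assms G(1,2) R by (simp add: atomic_mass_convolution real_distribution.finite_borel_measure_M)
qed

lemma compound_poisson_family:
  assumes "\<sigma> = 0"
  shows "compound_poisson_family P rate drift jump_law"
proof (intro compound_poisson_family.intro mass_pos real_distribution_jump_law)
  have "emeasure jump_law {0} = 0"
    using zero_atom by (simp add: emeasure_normalize_law emeasure_eq_measure)
  then show "measure jump_law {0} = 0"
    by (simp add: measure_def)
  fix n :: nat assume n: "1 \<le> n"
  interpret compound: real_distribution "compound_poisson (rate / real n) jump_law"
    by (intro real_distribution_compound_poisson real_distribution_jump_law)
  show "P n = distr (compound_poisson (rate / real n) jump_law) borel (\<lambda>x. x + drift / real n)"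
  proof (rule Levy_uniqueness)
    show "real_distribution (P n)"
      using laws n by blast
    show "char (P n) = char (distr (compound_poisson (rate / real n) jump_law) borel (\<lambda>x. x + drift / real n))"
      using char_P[OF n] char_translated_compound_poisson[OF n] by (simp add: fun_eq_iff assms)
  qed simp
qed

end

lemma
  fixes M :: "real measure"
  assumes M: "sets M = sets borel" and zero: "emeasure M {0} = 0"
  shows emeasure_off_zero: "emeasure M (UNIV - {0}) = emeasure M UNIV"
    and measure_off_zero: "measure M (UNIV - {0}) = measure M UNIV"
proof -
  show "emeasure M (UNIV - {0}) = emeasure M UNIV"
    using assms by (intro emeasure_Diff_null_set null_setsI) simp_all
  then show "measure M (UNIV - {0}) = measure M UNIV" by (simp add: measure_def)
qed

lemma finite_levyI:
  assumes trip: "levy_triplet \<mu> \<sigma> \<nu>"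
    and laws: "\<forall>n\<ge>1. real_distribution (P n) \<and>
                 char (P n) = (\<lambda>\<omega>. exp (levy_exponent \<mu> \<sigma> \<nu> \<omega> / of_nat n))"
    and finite: "0 < emeasure \<nu> (UNIV - {0})" "emeasure \<nu> (UNIV - {0}) < \<infinity>"
  shows "finite_levy \<nu> \<mu> \<sigma> P"
proof -
  have sets: "sets \<nu> = sets borel" and zero: "emeasure \<nu> {0} = 0"
    using trip by (auto simp: levy_triplet_def)
  note total = finite[unfolded emeasure_off_zero[OF sets zero]]
  interpret finite_borel_measure \<nu>
    using total(2) sets
    by (intro finite_borel_measure.intro finite_measureI finite_borel_measure_axioms.intro)
       (simp_all add: space_eq_UNIV_if_sets_borel)
  show ?thesis
  proof (intro finite_levy.intro finite_levy_axioms.intro finite_borel_measure_axioms laws)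
    show "0 < measure \<nu> UNIV" "measure \<nu> {0} = 0"
      using total(1) zero by (simp_all add: emeasure_eq_measure)
  qed
qed

lemma ennreal_less_if_eq_add:
  fixes a b c :: ennreal
  assumes "ennreal x = a + b + c" "0 < b"
  shows "a < ennreal x"
  using assms by (cases a b c rule: ennreal3_cases) (auto simp flip: ennreal_plus simp: ennreal_less_iff)

lemma
  assumes "finite_borel_measure \<nu>" and sets: "sets \<nu>d = sets borel" "sets \<nu>ac = sets borel"
    and decomp: "\<forall>A\<in>sets borel. emeasure \<nu> A = emeasure \<nu>d A + emeasure \<nu>ac A + emeasure \<nu>cs A"
    and disc_d: "discrete_law \<nu>d" and ac_ac: "absolutely_continuous lborel \<nu>ac"
    and cs_noatom: "\<forall>x. emeasure \<nu>cs {x} = 0" and ac_pos: "0 < emeasure \<nu>ac (UNIV - {0})"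
  shows atomic_mass_levy_decomposition: "atomic_mass \<nu> = ennreal (measure \<nu>d UNIV)"
    and measure_discrete_part_less: "measure \<nu>d UNIV < measure \<nu> UNIV"
proof -
  interpret finite_borel_measure \<nu> by fact
  have "emeasure \<nu>ac {x} = 0" for x
    using ac_ac countable_imp_null_set_lborel[of "{x}"] by (auto simp: absolutely_continuous_def)
  then have "atomic_mass \<nu> = atomic_mass \<nu>d"
    using decomp cs_noatom by (simp add: atomic_mass_def)
  also have "\<dots> = emeasure \<nu>d UNIV"
    using sets(1) disc_d by (rule atomic_mass_discrete_law)
  finally have atomic: "atomic_mass \<nu> = emeasure \<nu>d UNIV" .
  have "0 < emeasure \<nu>ac UNIV"
    using ac_pos emeasure_mono[of "UNIV - {0}" UNIV \<nu>ac] sets(2) by (auto intro: less_le_trans)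
  then have less: "emeasure \<nu>d UNIV < ennreal (measure \<nu> UNIV)"
    using decomp by (intro ennreal_less_if_eq_add[of _ _ _ "emeasure \<nu>cs UNIV"]) (auto simp flip: emeasure_eq_measure)
  then have "emeasure \<nu>d UNIV = ennreal (measure \<nu>d UNIV)"
    by (intro emeasure_eq_ennreal_measure) auto
  with atomic less show "atomic_mass \<nu> = ennreal (measure \<nu>d UNIV)" "measure \<nu>d UNIV < measure \<nu> UNIV"
    by (simp_all add: ennreal_less_iff)
qed

theorem (in finite_levy) ex_resolution_limit_if_discrete:
  assumes disc: "discrete_law (P 1)" and H: "dentropy (P 1) < \<infinity>"
  shows "\<exists>mn \<zeta> c1 c2. 0 < c1 \<and> c1 \<le> c2 \<and>
    (\<forall>n\<ge>1. c1 * ln (real n) \<le> \<zeta> n \<and> \<zeta> n \<le> c2 * ln (real n)) \<and>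
    uniform_resolution_limit P (\<lambda>n m. real n * enn2real (Hq m (P n))) \<zeta> mn"
proof -
  interpret P1: real_distribution "P 1" using laws by simp
  have "atomic_mass (P 1) = emeasure (P 1) UNIV"
    using P1.M_is_borel disc by (rule atomic_mass_discrete_law)
  then have "\<sigma> = 0"
    using P1.emeasure_space_1 unfolding P1.space_UNIV by (intro no_gaussian_part_if_atoms) simp
  then interpret compound_poisson_family P rate drift jump_law
    by (rule compound_poisson_family)
  show ?thesis using disc H by (rule ex_logarithmic_resolution_limit_discrete)
qed

theorem (in finite_levy) ex_resolution_limit_if_discrete_continuous:
  assumes D: "dc_split (P 1) D" and HD: "dentropy (cond_law (P 1) D) < \<infinity>"
    and H_quantized: "Hq 1 (P 1) < \<infinity>"
    and Dn: "\<forall>n\<ge>1. \<exists>Dn. dc_split (P n) Dn \<and> dentropy_wd (cond_law (P n) (UNIV - Dn))"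
    and b: "atomic_mass \<nu> = ennreal b" "0 \<le> b" "b < rate"
  shows "\<exists>mn \<zeta> c1 c2. 0 < c1 \<and> c1 \<le> c2 \<and>
    (\<forall>n\<ge>1. c1 * ln (real n) \<le> \<zeta> n \<and> \<zeta> n \<le> c2 * ln (real n)) \<and>
    uniform_resolution_limit P (\<lambda>n m. real n * enn2real (Hq m (P n))
      / (real n * (1 - exp (- (rate / real n) * (1 - b / rate)))) - ln (real m)) \<zeta> mn"
proof -
  interpret P1: real_distribution "P 1" using laws by simp
  have "\<sigma> = 0"
    using D unfolding dc_split_def by (intro no_gaussian_part_if_atoms) (simp only: P1.atomic_mass_dc_split[OF D], simp)
  then interpret compound_poisson_family P rate drift jump_law
    by (rule compound_poisson_family)
  interpret divisible: divisible_family P "levy_exponent \<mu> \<sigma> \<nu>"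
    using laws by (intro divisible_family.intro) simp_all
  have "atomic_mass jump_law = ennreal (b / rate)"
    using b mass_pos by (simp add: atomic_mass_normalize_law ennreal_mult[symmetric])
  then show ?thesis
    using b mass_pos
    by (intro ex_logarithmic_resolution_limit_if_dc_split[OF D HD _ Dn] divisible.finite_atomic_entropy_quantize_P H_quantized) simp_all
qed

theorem mainTheorem2:
  fixes \<mu> \<sigma> :: real
    and \<nu> \<nu>d \<nu>ac \<nu>cs :: "real measure"
    and P :: "nat \<Rightarrow> real measure"
  assumes trip: "levy_triplet \<mu> \<sigma> \<nu>"
    and sets_d: "sets \<nu>d = sets borel" and sets_ac: "sets \<nu>ac = sets borel"
    and sets_cs: "sets \<nu>cs = sets borel"
    and decomp: "\<forall>A\<in>sets borel. emeasure \<nu> A = emeasure \<nu>d A + emeasure \<nu>ac A + emeasure \<nu>cs A"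
    and disc_d: "discrete_law \<nu>d"
    and ac_ac: "absolutely_continuous lborel \<nu>ac"
    and cs_noatom: "\<forall>x. emeasure \<nu>cs {x} = 0"
    and cs_sing: "\<exists>N\<in>null_sets lborel. emeasure \<nu>cs (UNIV - N) = 0"
    and laws: "\<forall>n\<ge>1. real_distribution (P n) \<and>
                 char (P n) = (\<lambda>\<omega>. exp (levy_exponent \<mu> \<sigma> \<nu> \<omega> / of_nat n))"
  shows
   "(discrete_law (P 1) \<and> dentropy (P 1) < \<infinity> \<and>
       0 < emeasure \<nu> (UNIV - {0}) \<and> emeasure \<nu> (UNIV - {0}) < \<infinity> \<and>
       dentropy (scale_measure (ennreal (1 / measure \<nu> (UNIV - {0}))) \<nu>) < \<infinity>
     \<longrightarrow> (\<exists>(mn :: nat \<Rightarrow> nat) (\<zeta> :: nat \<Rightarrow> real) c1 c2. 0 < c1 \<and> c1 \<le> c2 \<and>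
            (\<forall>n\<ge>1. c1 * ln (real n) \<le> \<zeta> n \<and> \<zeta> n \<le> c2 * ln (real n)) \<and>
            (\<forall>\<epsilon>>0. \<forall>\<^sub>F n in sequentially. \<forall>m\<ge>mn n.
               Hq m (P n) < \<infinity> \<and>
               \<bar>real n * enn2real (Hq m (P n)) - \<zeta> n\<bar> \<le> \<epsilon>)))
  \<and>
   (\<forall>D. dc_split (P 1) D \<and>
       0 < emeasure \<nu> (UNIV - {0}) \<and> emeasure \<nu> (UNIV - {0}) < \<infinity> \<and>
       Hq 1 (P 1) < \<infinity> \<and>
       (\<forall>n\<ge>1. \<exists>Dn. dc_split (P n) Dn \<and> dentropy_wd (cond_law (P n) (UNIV - Dn))) \<and>
       0 < emeasure \<nu>ac (UNIV - {0}) \<and> emeasure \<nu>ac (UNIV - {0}) < \<infinity> \<and>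
       dentropy_wd (scale_measure (ennreal (1 / measure \<nu>ac (UNIV - {0}))) \<nu>ac) \<and>
       dentropy (cond_law (P 1) D) < \<infinity> \<and>
       (emeasure \<nu>d (UNIV - {0}) \<noteq> 0 \<longrightarrow>
          dentropy (scale_measure (ennreal (1 / measure \<nu>d (UNIV - {0}))) \<nu>d) < \<infinity>)
     \<longrightarrow> (let lam = measure \<nu> (UNIV - {0});
             \<alpha> = measure \<nu>d (UNIV - {0}) / lam;
             \<kappa> = (\<lambda>n::nat. real n * (1 - exp (- (lam / real n) * (1 - \<alpha>))))
          in \<exists>(mn :: nat \<Rightarrow> nat) (\<zeta> :: nat \<Rightarrow> real) c1 c2. 0 < c1 \<and> c1 \<le> c2 \<and>
            (\<forall>n\<ge>1. c1 * ln (real n) \<le> \<zeta> n \<and> \<zeta> n \<le> c2 * ln (real n)) \<and>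
            (\<forall>\<epsilon>>0. \<forall>\<^sub>F n in sequentially. \<forall>m\<ge>mn n.
               Hq m (P n) < \<infinity> \<and>
               \<bar>real n * enn2real (Hq m (P n)) / \<kappa> n - ln (real m) - \<zeta> n\<bar> \<le> \<epsilon>)))
  \<and>
   (continuous_law (P 1) \<and>
       (\<sigma> > 0 \<or> emeasure \<nu>ac (UNIV - {0}) = \<infinity>) \<and>
       Hq 1 (P 1) < \<infinity> \<and>
       (\<forall>n\<ge>1. dentropy_wd (P n))
     \<longrightarrow> (\<exists>mn :: nat \<Rightarrow> nat.
            (\<forall>\<epsilon>>0. \<forall>\<^sub>F n in sequentially. \<forall>m\<ge>mn n.
               Hq m (P n) < \<infinity> \<and>
               \<bar>real n * enn2real (Hq m (P n)) / real n - ln (real m)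
                  - diff_entropy (P n)\<bar> \<le> \<epsilon>))
         \<and> (\<forall>n\<ge>1. diff_entropy (P (Suc n)) \<le> diff_entropy (P n)))"
proof (intro conjI impI allI, goal_cases)
  have sets: "sets \<nu> = sets borel" and zero: "emeasure \<nu> {0} = 0" "emeasure \<nu>d {0} = 0"
    using trip decomp by (auto simp: levy_triplet_def)
  interpret divisible: divisible_family P "levy_exponent \<mu> \<sigma> \<nu>"
    using laws by (intro divisible_family.intro) simp_all
  note limit_def = uniform_resolution_limit_def
  {
    case 1
    then interpret finite_levy \<nu> \<mu> \<sigma> P by (intro finite_levyI trip laws) auto
    show ?case using 1 ex_resolution_limit_if_discrete[unfolded limit_def] by blast
  next
    case (2 D)
    then interpret finite_levy \<nu> \<mu> \<sigma> P by (intro finite_levyI trip laws) auto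
    note parts = finite_borel_measure_axioms sets_d sets_ac decomp disc_d ac_ac cs_noatom
    show ?case
      unfolding Let_def measure_off_zero[OF sets zero(1)] measure_off_zero[OF sets_d zero(2)]
      using 2 atomic_mass_levy_decomposition[OF parts] measure_discrete_part_less[OF parts]
      by (intro ex_resolution_limit_if_discrete_continuous[unfolded limit_def]) auto
  next
    case 3
    then show ?case using divisible.ex_uniform_resolution_limit_continuous[unfolded limit_def] by blast
  next
    case 4
    then show ?case using divisible.diff_entropy_Suc_le by blast
  }
qed

end
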